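(* Let $k$ be an algebraically closed field of characteristic $0$. The three numerical semigroups $\langle 5,6,7,8\rangle$, $\langle 3,7,8\rangle$ and $\langle 3,5\rangle$ are of double covering type (over $k$); that is, for each $\tilde H$ among these three semigroups there exist curves $\tilde C$ and $C$ over $k$, a double covering $\pi:\tilde C\to C$, and a ramification point $\tilde P\in\tilde C$ of $\pi$ such that $H(\tilde P)=\tilde H$.
   Context: Fix an algebraically closed field $k$ of characteristic $0$. A curve means a complete nonsingular irreducible curve over $k$. Let $\mathbb{N}_0$ be the additive monoid of non-negative integers. For a point $P$ of a curve $C$, the Weierstrass semigroup of $P$ is $$H(P)=\{\alpha\in\mathbb{N}_0 \mid \text{there exists a rational function } f \text{ on } C \text{ with } (f)_\infty=\alpha P\},$$ where $(f)_\infty$ denotes the polar divisor of $f$. A numerical semigroup is a submonoid $H$ of $\mathbb{N}_0$ whose complement $\mathbb{N}_0\setminus H$ is finite. For positive integers $a_1,\dots,a_n$, $\langle a_1,\dots,a_n\rangle$ denotes the additive submonoid of $\mathbb{N}_0$ generated by $a_1,\dots,a_n$. A numerical semigroup $\tilde H$ is said to be of double covering type if there exists a double covering (a finite morphism of degree $2$) $\pi:\tilde C\to C$ of curves with a ramification point $\tilde P\in\tilde C$ satisfying $H(\tilde P)=\tilde H$. *)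

theory Defs
  imports
    "HOL-Library.Poly_Mapping"
    "HOL-Computational_Algebra.Polynomial"
    "HOL-Algebra.Embedded_Algebras"
    "HOL-Algebra.Ideal"
    "HOL-Analysis.Abstract_Topology"
    "HOL.Hull"
begin

text \<open>
  Complete nonsingular irreducible curves are projective, so a curve is modelled as a
  nonsingular irreducible closed subset of dimension one of some projective space, with
  regular functions, rational functions and morphisms in the sense of classical varieties
  over an algebraically closed field.
\<close>

section \<open>Projective space and its Zariski topology\<close>

text \<open>Polynomials in countably many variables; an exponent vector has type \<^typ>\<open>nat \<Rightarrow>\<^sub>0 nat\<close>.\<close>

type_synonym 'k mpoly = "(nat \<Rightarrow>\<^sub>0 nat) \<Rightarrow>\<^sub>0 'k"

definition mpoly_eval :: "'k::field mpoly \<Rightarrow> (nat \<Rightarrow> 'k) \<Rightarrow> 'k" where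
  "mpoly_eval p x =
     (\<Sum>m\<in>Poly_Mapping.keys p. Poly_Mapping.lookup p m * (\<Prod>i\<in>Poly_Mapping.keys m. x i ^ Poly_Mapping.lookup m i))"

definition homogeneous :: "nat \<Rightarrow> 'k::field mpoly \<Rightarrow> bool" where
  "homogeneous d p \<longleftrightarrow> (\<forall>m\<in>Poly_Mapping.keys p. (\<Sum>i\<in>Poly_Mapping.keys m. Poly_Mapping.lookup m i) = d)"

text \<open>
  A projective point is the set of all its homogeneous coordinate vectors.  Vectors are
  sequences, and the points of $n$-dimensional projective space are those whose coordinates
  of index greater than $n$ vanish; polynomials may therefore involve further variables
  without changing any of the notions below.
\<close>

type_synonym 'k ppoint = "(nat \<Rightarrow> 'k) set"

definition ppoint :: "(nat \<Rightarrow> 'k::field) \<Rightarrow> 'k ppoint" where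
  "ppoint x = {(\<lambda>i. c * x i) | c. c \<noteq> 0}"

definition proj_space :: "nat \<Rightarrow> 'k::field ppoint set" where
  "proj_space n = ppoint ` {x. x \<noteq> (\<lambda>_. 0) \<and> (\<forall>i>n. x i = 0)}"

definition zero_locus :: "nat \<Rightarrow> 'k::field mpoly set \<Rightarrow> 'k ppoint set" where
  "zero_locus n S = {P \<in> proj_space n. \<forall>p\<in>S. \<forall>x\<in>P. mpoly_eval p x = 0}"

definition zariski_open :: "nat \<Rightarrow> 'k::field ppoint set \<Rightarrow> bool" where
  "zariski_open n U \<longleftrightarrow>
     (\<exists>S. (\<forall>p\<in>S. \<exists>d. homogeneous d p) \<and> U = proj_space n - zero_locus n S)"

definition zariski :: "nat \<Rightarrow> 'k::field ppoint topology" where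
  "zariski n = topology (zariski_open n)"

lemma mpoly_eval_superset:
  assumes "finite A" "Poly_Mapping.keys p \<subseteq> A"
  shows "mpoly_eval p x = (\<Sum>m\<in>A. Poly_Mapping.lookup p m * (\<Prod>i\<in>Poly_Mapping.keys m. x i ^ Poly_Mapping.lookup m i))"
  unfolding mpoly_eval_def
  by (rule sum.mono_neutral_left) (use assms in \<open>auto simp: in_keys_iff\<close>)

lemma mpoly_eval_zero [simp]: "mpoly_eval 0 x = 0"
  by (simp add: mpoly_eval_def)

lemma mpoly_eval_add: "mpoly_eval (p + q) x = mpoly_eval p x + mpoly_eval q x"
proof -
  have 1: "finite (Poly_Mapping.keys p \<union> Poly_Mapping.keys q)" "Poly_Mapping.keys (p + q) \<subseteq> Poly_Mapping.keys p \<union> Poly_Mapping.keys q"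
    by (simp_all add: Poly_Mapping.keys_add)
  show ?thesis
    by (subst (1 2 3) mpoly_eval_superset[OF 1(1)])
      (use 1 in \<open>auto simp: lookup_add sum.distrib algebra_simps\<close>)
qed

lemma monomial_eval_add:
  fixes x :: "nat \<Rightarrow> 'k::field" and m m' :: "nat \<Rightarrow>\<^sub>0 nat"
  shows "(\<Prod>i\<in>Poly_Mapping.keys (m + m'). x i ^ Poly_Mapping.lookup (m + m') i) =
     (\<Prod>i\<in>Poly_Mapping.keys m. x i ^ Poly_Mapping.lookup m i) * (\<Prod>i\<in>Poly_Mapping.keys m'. x i ^ Poly_Mapping.lookup m' i)"
proof -
  let ?A = "Poly_Mapping.keys m \<union> Poly_Mapping.keys m'"
  have *: "(\<Prod>i\<in>Poly_Mapping.keys l. x i ^ Poly_Mapping.lookup l i) = (\<Prod>i\<in>?A. x i ^ Poly_Mapping.lookup l i)"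
    if "Poly_Mapping.keys l \<subseteq> ?A" for l
    by (rule prod.mono_neutral_left) (use that in \<open>auto simp: in_keys_iff\<close>)
  have "Poly_Mapping.keys (m + m') \<subseteq> ?A" by (rule Poly_Mapping.keys_add)
  then show ?thesis
    by (subst (1 2 3) *) (auto simp: lookup_add power_add prod.distrib)
qed

lemma mpoly_eval_single:
  "mpoly_eval (Poly_Mapping.single m c) x = c * (\<Prod>i\<in>Poly_Mapping.keys m. x i ^ Poly_Mapping.lookup m i)"
  by (cases "c = 0") (auto simp: mpoly_eval_def)

lemma mpoly_eval_sum: "mpoly_eval (sum f A) x = (\<Sum>a\<in>A. mpoly_eval (f a) x)"
  by (induction A rule: infinite_finite_induct) (auto simp: mpoly_eval_add)

lemma mpoly_sum_monomials:
  fixes p :: "'k::field mpoly"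
  shows "p = (\<Sum>m\<in>Poly_Mapping.keys p. Poly_Mapping.single m (Poly_Mapping.lookup p m))"
proof (rule poly_mapping_eqI)
  fix k
  show "Poly_Mapping.lookup p k = Poly_Mapping.lookup (\<Sum>m\<in>Poly_Mapping.keys p. Poly_Mapping.single m (Poly_Mapping.lookup p m)) k"
    by (simp add: lookup_sum lookup_single when_def sum.delta' in_keys_iff)
qed

lemma mpoly_eval_mult: "mpoly_eval (p * q) x = mpoly_eval p x * mpoly_eval q x"
proof -
  have "p * q = (\<Sum>m\<in>Poly_Mapping.keys p. Poly_Mapping.single m (Poly_Mapping.lookup p m)) *
      (\<Sum>m\<in>Poly_Mapping.keys q. Poly_Mapping.single m (Poly_Mapping.lookup q m))"
    by (simp flip: mpoly_sum_monomials)
  also have "\<dots> = (\<Sum>m\<in>Poly_Mapping.keys p. \<Sum>m'\<in>Poly_Mapping.keys q.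
      Poly_Mapping.single (m + m') (Poly_Mapping.lookup p m * Poly_Mapping.lookup q m'))"
    by (simp add: sum_product mult_single)
  finally have "p * q = \<dots>" .
  then show ?thesis
    by (simp only: mpoly_eval_sum mpoly_eval_single monomial_eval_add)
      (simp add: mpoly_eval_def sum_product algebra_simps)
qed

lemma homogeneous_mult:
  assumes "homogeneous d p" "homogeneous e q"
  shows "homogeneous (d + e) (p * q)"
  unfolding homogeneous_def
proof
  have deg_add: "(\<Sum>i\<in>Poly_Mapping.keys (m + m'). Poly_Mapping.lookup (m + m') i) =
      (\<Sum>i\<in>Poly_Mapping.keys m. Poly_Mapping.lookup m i) + (\<Sum>i\<in>Poly_Mapping.keys m'. Poly_Mapping.lookup m' i)" for m m' :: "nat \<Rightarrow>\<^sub>0 nat"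
  proof -
    let ?A = "Poly_Mapping.keys m \<union> Poly_Mapping.keys m'"
    have *: "(\<Sum>i\<in>Poly_Mapping.keys l. Poly_Mapping.lookup l i) = (\<Sum>i\<in>?A. Poly_Mapping.lookup l i)"
      if "Poly_Mapping.keys l \<subseteq> ?A" for l :: "nat \<Rightarrow>\<^sub>0 nat"
      by (rule sum.mono_neutral_left) (use that in \<open>auto simp: in_keys_iff\<close>)
    have "Poly_Mapping.keys (m + m') \<subseteq> ?A" by (rule Poly_Mapping.keys_add)
    then show ?thesis
      by (subst (1 2 3) *) (auto simp: lookup_add sum.distrib)
  qed
  fix m assume "m \<in> Poly_Mapping.keys (p * q)"
  then obtain a b where "m = a + b" "a \<in> Poly_Mapping.keys p" "b \<in> Poly_Mapping.keys q"
    using keys_mult[of p q] by blast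
  then show "(\<Sum>i\<in>Poly_Mapping.keys m. Poly_Mapping.lookup m i) = d + e"
    using assms by (simp add: deg_add homogeneous_def)
qed

lemma istopology_zariski_open: "istopology (zariski_open n :: 'k::field ppoint set \<Rightarrow> bool)"
  unfolding istopology_def
proof (intro conjI allI impI)
  fix U V :: "'k ppoint set"
  assume "zariski_open n U" "zariski_open n V"
  then obtain S T where
    S: "\<forall>p\<in>S. \<exists>d. homogeneous d p" "U = proj_space n - zero_locus n S" and
    T: "\<forall>p\<in>T. \<exists>d. homogeneous d p" "V = proj_space n - zero_locus n T"
    unfolding zariski_open_def by blast
  let ?R = "(\<lambda>(p, q). p * q) ` (S \<times> T)"
  have hom: "\<forall>p\<in>?R. \<exists>d. homogeneous d p"
    using S(1) T(1) homogeneous_mult by fastforce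
  have scale: "mpoly_eval p (\<lambda>i. c * x i) = c ^ d * mpoly_eval p x"
    if "homogeneous d p" for p :: "'k mpoly" and c d x
    using that unfolding homogeneous_def mpoly_eval_def
    by (auto simp: power_mult_distrib prod.distrib sum_distrib_left simp flip: power_sum
        intro!: sum.cong)
  have mem: "P \<in> proj_space n - zero_locus n R \<longleftrightarrow>
      P \<in> proj_space n \<and> (\<exists>p\<in>R. \<exists>x\<in>P. mpoly_eval p x \<noteq> 0)" for P and R :: "'k mpoly set"
    by (simp add: zero_locus_def) blast
  have vanish: "(\<forall>x\<in>P. mpoly_eval p x = 0) \<or> (\<forall>x\<in>P. mpoly_eval p x \<noteq> 0)"
    if "P \<in> proj_space n" "homogeneous d p" for P d and p :: "'k mpoly"
    using that(1) by (auto simp: proj_space_def ppoint_def scale[OF that(2)])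
  have "P \<in> U \<inter> V \<longleftrightarrow> P \<in> proj_space n - zero_locus n ?R" for P
  proof
    assume "P \<in> U \<inter> V"
    then have "P \<in> U" "P \<in> V" by simp_all
    then obtain p q x y where pq: "p \<in> S" "q \<in> T" "P \<in> proj_space n"
      "x \<in> P" "mpoly_eval p x \<noteq> 0" "y \<in> P" "mpoly_eval q y \<noteq> 0"
      unfolding S(2) T(2) mem by blast
    obtain e where "homogeneous e q"
      using T(1) pq(2) by blast
    then have "mpoly_eval q x \<noteq> 0"
      using vanish[of P e q] pq by blast
    then have "mpoly_eval (p * q) x \<noteq> 0"
      using pq(5) by (simp add: mpoly_eval_mult)
    moreover have "p * q \<in> ?R"
      using pq(1,2) by (intro image_eqI[of _ _ "(p, q)"]) auto
    ultimately show "P \<in> proj_space n - zero_locus n ?R"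
      unfolding mem using pq(3,4) by blast
  next
    assume "P \<in> proj_space n - zero_locus n ?R"
    then obtain r x where r: "r \<in> ?R" "P \<in> proj_space n" "x \<in> P" "mpoly_eval r x \<noteq> 0"
      unfolding mem by blast
    obtain p q where pq: "p \<in> S" "q \<in> T" "r = p * q"
      using r(1) by auto
    then have "mpoly_eval p x \<noteq> 0" "mpoly_eval q x \<noteq> 0"
      using r(4) by (simp_all add: mpoly_eval_mult)
    with pq r show "P \<in> U \<inter> V"
      unfolding S(2) T(2) Int_iff mem by blast
  qed
  then have "U \<inter> V = proj_space n - zero_locus n ?R"
    by blast
  with hom show "zariski_open n (U \<inter> V)"
    unfolding zariski_open_def by blast
next
  fix \<K> :: "'k ppoint set set"
  assume "\<forall>K\<in>\<K>. zariski_open n K"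
  then obtain S where S: "\<forall>K\<in>\<K>. (\<forall>p\<in>S K. \<exists>d. homogeneous d p) \<and>
      K = proj_space n - zero_locus n (S K)"
    unfolding zariski_open_def by metis
  then have hom: "\<forall>p\<in>(\<Union>K\<in>\<K>. S K). \<exists>d. homogeneous d p"
    by blast
  have "\<Union>\<K> = (\<Union>K\<in>\<K>. proj_space n - zero_locus n (S K))"
    using S by blast
  also have "\<dots> = proj_space n - zero_locus n (\<Union>K\<in>\<K>. S K)"
    unfolding zero_locus_def by blast
  finally have "\<Union>\<K> = \<dots>" .
  with hom show "zariski_open n (\<Union>\<K>)"
    unfolding zariski_open_def by blast
qed

lemma openin_zariski [simp]: "openin (zariski n) = zariski_open n"
  by (simp add: zariski_def istopology_zariski_open)

lemma topspace_zariski [simp]: "topspace (zariski n :: 'k::field ppoint topology) = proj_space n"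
proof -
  have "mpoly_eval 1 x = 1" for x :: "nat \<Rightarrow> 'k"
    by (simp add: mpoly_eval_def)
  then have "zariski_open n (proj_space n :: 'k ppoint set)"
    unfolding zariski_open_def
    by (intro exI[of _ "{1}"])
      (auto simp: homogeneous_def zero_locus_def proj_space_def ppoint_def)
  moreover have "zariski_open n U \<Longrightarrow> U \<subseteq> proj_space n" for U :: "'k ppoint set"
    by (auto simp: zariski_open_def)
  ultimately show ?thesis
    by (auto simp: topspace_def)
qed

section \<open>Irreducibility and dimension\<close>

definition irreducible_space :: "'a topology \<Rightarrow> bool" where
  "irreducible_space X \<longleftrightarrow> topspace X \<noteq> {} \<and>
     (\<forall>A B. closedin X A \<and> closedin X B \<and> topspace X = A \<union> B \<longrightarrow>
        A = topspace X \<or> B = topspace X)"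

definition irreducible_chain :: "'a topology \<Rightarrow> (nat \<Rightarrow> 'a set) \<Rightarrow> nat \<Rightarrow> bool" where
  "irreducible_chain X Z n \<longleftrightarrow>
     (\<forall>i\<le>n. closedin X (Z i) \<and> irreducible_space (subtopology X (Z i))) \<and>
     (\<forall>i<n. Z i \<subset> Z (Suc i))"

text \<open>The supremum of the lengths of chains of irreducible closed subsets is \<open>d\<close>.\<close>

definition has_dimension :: "'a topology \<Rightarrow> nat \<Rightarrow> bool" where
  "has_dimension X d \<longleftrightarrow>
     (\<exists>Z. irreducible_chain X Z d) \<and> \<not> (\<exists>Z. irreducible_chain X Z (Suc d))"

section \<open>Regular and rational functions\<close>

text \<open>
  In the following, \<open>X\<close> is a locally closed subset of some projective space, given by its
  induced topology.  A function is regular at a point if near it it is a quotient of two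
  forms of the same degree.
\<close>

definition regular_at :: "'k::field ppoint topology \<Rightarrow> ('k ppoint \<Rightarrow> 'k) \<Rightarrow> 'k ppoint \<Rightarrow> bool" where
  "regular_at X f P \<longleftrightarrow>
     (\<exists>V g h d. openin X V \<and> P \<in> V \<and> homogeneous d g \<and> homogeneous d h \<and>
        (\<forall>Q\<in>V. \<forall>x\<in>Q. mpoly_eval h x \<noteq> 0 \<and> f Q = mpoly_eval g x / mpoly_eval h x))"

definition regular_on :: "'k::field ppoint topology \<Rightarrow> 'k ppoint set \<Rightarrow> ('k ppoint \<Rightarrow> 'k) \<Rightarrow> bool" where
  "regular_on X U f \<longleftrightarrow> (\<forall>P\<in>U. regular_at X f P)"

text \<open>
  For irreducible \<open>X\<close>, a rational function is the class of a function \<open>f\<close> that is regular on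
  some nonempty open set, where functions agreeing on a nonempty open set are identified;
  the values of \<open>f\<close> elsewhere are irrelevant.
\<close>

definition rat_class :: "'k::field ppoint topology \<Rightarrow> ('k ppoint \<Rightarrow> 'k) \<Rightarrow> ('k ppoint \<Rightarrow> 'k) set" where
  "rat_class X f = {g. \<exists>U. openin X U \<and> U \<noteq> {} \<and> (\<forall>P\<in>U. g P = f P)}"

definition function_field :: "'k::field ppoint topology \<Rightarrow> ('k ppoint \<Rightarrow> 'k) set ring" where
  "function_field X = \<lparr>
     carrier = {rat_class X f | f. \<exists>U. openin X U \<and> U \<noteq> {} \<and> regular_on X U f},
     mult = (\<lambda>a b. \<Union>f\<in>a. \<Union>g\<in>b. rat_class X (\<lambda>P. f P * g P)),
     one = rat_class X (\<lambda>_. 1),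
     zero = rat_class X (\<lambda>_. 0),
     add = (\<lambda>a b. \<Union>f\<in>a. \<Union>g\<in>b. rat_class X (\<lambda>P. f P + g P))\<rparr>"

definition local_ring :: "'k::field ppoint topology \<Rightarrow> 'k ppoint \<Rightarrow> ('k ppoint \<Rightarrow> 'k) set ring" where
  "local_ring X P = (function_field X)\<lparr>carrier := {rat_class X f | f. regular_at X f P}\<rparr>"

definition local_max_ideal :: "'k::field ppoint topology \<Rightarrow> 'k ppoint \<Rightarrow> ('k ppoint \<Rightarrow> 'k) set set" where
  "local_max_ideal X P = {rat_class X f | f. regular_at X f P \<and> f P = 0}"

section \<open>Curves, orders and the Weierstrass semigroup\<close>

definition local_parameter ::
  "'k::field ppoint topology \<Rightarrow> 'k ppoint \<Rightarrow> ('k ppoint \<Rightarrow> 'k) set \<Rightarrow> bool" where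
  "local_parameter X P t \<longleftrightarrow>
     t \<in> carrier (local_ring X P) \<and> PIdl\<^bsub>local_ring X P\<^esub> t = local_max_ideal X P"

text \<open>
  A local ring of dimension one is regular iff its maximal ideal is generated by one element,
  which is the nonsingularity condition below.
\<close>

definition curve :: "'k::field ppoint topology \<Rightarrow> bool" where
  "curve X \<longleftrightarrow>
     (\<exists>n C. closedin (zariski n) C \<and> X = subtopology (zariski n) C) \<and>
     irreducible_space X \<and> has_dimension X 1 \<and>
     (\<forall>P\<in>topspace X. \<exists>t. local_parameter X P t)"

text \<open>The following is only meaningful for \<open>a \<noteq> 0\<close>.\<close>

definition order_at :: "'k::field ppoint topology \<Rightarrow> 'k ppoint \<Rightarrow> ('k ppoint \<Rightarrow> 'k) set \<Rightarrow> int" where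
  "order_at X P a = (THE n. \<exists>t u. local_parameter X P t \<and> u \<in> Units (local_ring X P) \<and>
     a = (t [^]\<^bsub>function_field X\<^esub> n) \<otimes>\<^bsub>function_field X\<^esub> u)"

text \<open>Effective divisors are represented by their coefficient functions.\<close>

definition polar_divisor ::
  "'k::field ppoint topology \<Rightarrow> ('k ppoint \<Rightarrow> 'k) set \<Rightarrow> 'k ppoint \<Rightarrow> nat" where
  "polar_divisor X a = (\<lambda>Q. if Q \<in> topspace X then nat (- order_at X Q a) else 0)"

definition weierstrass_semigroup :: "'k::field ppoint topology \<Rightarrow> 'k ppoint \<Rightarrow> nat set" where
  "weierstrass_semigroup X P =
     {\<alpha>. \<exists>a \<in> carrier (function_field X) - {\<zero>\<^bsub>function_field X\<^esub>}.
        polar_divisor X a = (\<lambda>Q. if Q = P then \<alpha> else 0)}"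

section \<open>Double coverings\<close>

definition morphism ::
  "'k::field ppoint topology \<Rightarrow> 'k ppoint topology \<Rightarrow> ('k ppoint \<Rightarrow> 'k ppoint) \<Rightarrow> bool" where
  "morphism X Y \<pi> \<longleftrightarrow> continuous_map X Y \<pi> \<and>
     (\<forall>V f. openin Y V \<and> regular_on Y V f \<longrightarrow>
        regular_on X {P \<in> topspace X. \<pi> P \<in> V} (f \<circ> \<pi>))"

text \<open>
  Affine $n$-space is the open subset of projective space where the coordinate of index 0 does
  not vanish; an affine variety is one isomorphic to a closed subset of it.
\<close>

definition affine_variety :: "'k::field ppoint topology \<Rightarrow> bool" where
  "affine_variety X \<longleftrightarrow>
     (\<exists>n Z \<phi> \<psi>. closedin (zariski n) Z \<and>
        (let A = subtopology (zariski n) {P \<in> Z. \<forall>x\<in>P. x 0 \<noteq> 0} in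
           morphism X A \<phi> \<and> morphism A X \<psi> \<and>
           (\<forall>P\<in>topspace X. \<psi> (\<phi> P) = P) \<and> (\<forall>Q\<in>topspace A. \<phi> (\<psi> Q) = Q)))"

text \<open>
  The target has an affine open cover by sets whose preimages are affine and have coordinate
  rings that are finitely generated as modules over those of the sets.
\<close>

definition finite_morphism ::
  "'k::field ppoint topology \<Rightarrow> 'k ppoint topology \<Rightarrow> ('k ppoint \<Rightarrow> 'k ppoint) \<Rightarrow> bool" where
  "finite_morphism X Y \<pi> \<longleftrightarrow> morphism X Y \<pi> \<and>
     (\<forall>Q\<in>topspace Y. \<exists>V U. openin Y V \<and> Q \<in> V \<and> U = {P \<in> topspace X. \<pi> P \<in> V} \<and>
        affine_variety (subtopology Y V) \<and> affine_variety (subtopology X U) \<and>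
        (\<exists>B. finite B \<and> (\<forall>b\<in>B. regular_on X U b) \<and>
           (\<forall>f. regular_on X U f \<longrightarrow>
              (\<exists>c. (\<forall>b\<in>B. regular_on Y V (c b)) \<and>
                   (\<forall>P\<in>U. f P = (\<Sum>b\<in>B. c b (\<pi> P) * b P))))))"

definition dominant ::
  "'k::field ppoint topology \<Rightarrow> 'k ppoint topology \<Rightarrow> ('k ppoint \<Rightarrow> 'k ppoint) \<Rightarrow> bool" where
  "dominant X Y \<pi> \<longleftrightarrow> Y closure_of (\<pi> ` topspace X) = topspace Y"

definition pullback ::
  "'k::field ppoint topology \<Rightarrow> ('k ppoint \<Rightarrow> 'k ppoint) \<Rightarrow> ('k ppoint \<Rightarrow> 'k) set \<Rightarrow> ('k ppoint \<Rightarrow> 'k) set" where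
  "pullback X \<pi> a = (\<Union>f\<in>a. rat_class X (f \<circ> \<pi>))"

definition has_degree ::
  "'k::field ppoint topology \<Rightarrow> 'k ppoint topology \<Rightarrow> ('k ppoint \<Rightarrow> 'k ppoint) \<Rightarrow> nat \<Rightarrow> bool" where
  "has_degree X Y \<pi> d \<longleftrightarrow> dominant X Y \<pi> \<and>
     ring.dimension (function_field X) d
       (pullback X \<pi> ` carrier (function_field Y)) (carrier (function_field X))"

definition double_covering ::
  "'k::field ppoint topology \<Rightarrow> 'k ppoint topology \<Rightarrow> ('k ppoint \<Rightarrow> 'k ppoint) \<Rightarrow> bool" where
  "double_covering X Y \<pi> \<longleftrightarrow>
     curve X \<and> curve Y \<and> finite_morphism X Y \<pi> \<and> has_degree X Y \<pi> 2"

definition ramification_index ::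
  "'k::field ppoint topology \<Rightarrow> 'k ppoint topology \<Rightarrow> ('k ppoint \<Rightarrow> 'k ppoint) \<Rightarrow> 'k ppoint \<Rightarrow> int" where
  "ramification_index X Y \<pi> P =
     order_at X P (pullback X \<pi> (SOME t. local_parameter Y (\<pi> P) t))"

definition ramification_point ::
  "'k::field ppoint topology \<Rightarrow> 'k ppoint topology \<Rightarrow> ('k ppoint \<Rightarrow> 'k ppoint) \<Rightarrow> 'k ppoint \<Rightarrow> bool" where
  "ramification_point X Y \<pi> P \<longleftrightarrow> P \<in> topspace X \<and> ramification_index X Y \<pi> P > 1"

section \<open>Numerical semigroups\<close>

definition nat_submonoid :: "nat set \<Rightarrow> bool" where
  "nat_submonoid H \<longleftrightarrow> 0 \<in> H \<and> (\<forall>a\<in>H. \<forall>b\<in>H. a + b \<in> H)"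

definition numerical_semigroup :: "nat set \<Rightarrow> bool" where
  "numerical_semigroup H \<longleftrightarrow> nat_submonoid H \<and> finite (- H)"

definition generated_semigroup :: "nat set \<Rightarrow> nat set" where
  "generated_semigroup A = nat_submonoid hull A"

definition double_covering_type :: "'k::field itself \<Rightarrow> nat set \<Rightarrow> bool" where
  "double_covering_type _ H \<longleftrightarrow> numerical_semigroup H \<and>
     (\<exists>(X :: 'k ppoint topology) Y \<pi> P.
        double_covering X Y \<pi> \<and> ramification_point X Y \<pi> P \<and> weierstrass_semigroup X P = H)"

end

theory Submission
  imports Defs "HOL-Computational_Algebra.Formal_Laurent_Series"
begin

text \<open>
  A smooth projective curve with a marked point \<open>\<infinity>\<close> and a local parameter \<open>t\<close> there is given by the
  algebra \<open>A\<close> of functions regular away from \<open>\<infinity>\<close>, as a ring of Laurent series in \<open>t\<close>: a nonzero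
  element of \<open>A\<close> is a constant or has a pole, the pole orders form \<open>H(\<infinity>)\<close>, and smoothness of the affine
  part says that every homomorphism \<open>A \<rightarrow> k\<close> has a local generator. The elements of pole order at most
  \<open>N\<close>, for a large pole order \<open>N\<close>, embed the curve in a projective space. If \<open>A\<close> is stable under
  \<open>t \<mapsto> - t\<close>, then the even series in \<open>A\<close> are the algebra of the quotient curve, and the
  double covering is ramified at \<open>\<infinity>\<close>. It remains to write down, for each of the three semigroups, such
  an algebra as a free module over \<open>k[x]\<close>, with a basis whose pole orders are distinct modulo that of \<open>x\<close>.
\<close>

text \<open>Inside the Laurent series the function field, the valuation at infinity and the
  involution come for free: fractions are series, pole orders are negated subdegrees, and
  \<open>flip\<close> acts on coefficients. Everything else, from the Nullstellensatz to finiteness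
  of the covering, is derived from one tool, the cancellation of leading terms, which works because
  all large multiples of a step \<open>e\<close> are pole orders. The step is 1 for the covering
  curve and 2 for the quotient, whose elements are even series; the ratio is the ramification index.
  Riemann-Roch is avoided: basis elements with pole orders in distinct residue classes cannot
  cancel, so the semigroup is read off from the basis. The hard point is smoothness of the quotient,
  where invariant local generators must be made from generators upstairs, differently at fixed and
  at moved points. The equations were picked to admit an involution with \<open>t\<close> odd:
  cyclic triple covers of the line for the semigroups containing 3, and a canonical curve of genus 5
  for the other, whose pole orders up to 8 = 2 * 5 - 2 are 0, 5, 6, 7, 8.\<close>

unbundle fps_syntax

section \<open>Algebras of Laurent series with poles only\<close>

lemma fls_nth_0_mult:
  fixes f g :: "'k::field fls"
  assumes "fls_subdegree f \<ge> 0" "fls_subdegree g \<ge> 0"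
  shows "(f * g) $$ 0 = f $$ 0 * g $$ 0"
proof -
  have "f = fps_to_fls (fls_regpart f)" "g = fps_to_fls (fls_regpart g)"
    using assms by (simp_all add: fls_regpart_to_fls_trivial)
  then have "(f * g) $$ 0 = (fps_to_fls (fls_regpart f * fls_regpart g)) $$ 0"
    by (metis fls_times_fps_to_fls)
  also have "\<dots> = fps_nth (fls_regpart f * fls_regpart g) 0" by simp
  also have "\<dots> = f $$ 0 * g $$ 0" by simp
  finally show ?thesis .
qed

text \<open>The constant is the quotient of the leading coefficients. This cancellation drives every
  descent on pole orders below.\<close>

lemma fls_cancel_leading:
  fixes a b :: "'k::field fls"
  assumes "b \<noteq> 0" "fls_subdegree a = fls_subdegree b" "a \<noteq> 0"
  obtains c where "c \<noteq> 0" "a - fls_const c * b = 0 \<or> fls_subdegree (a - fls_const c * b) > fls_subdegree a"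
proof
  let ?n = "fls_subdegree a" and ?c = "a $$ fls_subdegree a / b $$ fls_subdegree a"
  show "?c \<noteq> 0" using assms by (metis divide_eq_0_iff nth_fls_subdegree_nonzero)
  have "b $$ ?n \<noteq> 0" using assms by (metis nth_fls_subdegree_nonzero)
  then have "(a - fls_const ?c * b) $$ k = 0" if "k \<le> ?n" for k
    using that assms by (cases "k = ?n") auto
  then show "a - fls_const ?c * b = 0 \<or> fls_subdegree (a - fls_const ?c * b) > ?n"
    by (metis fls_subdegree_greaterI)
qed

lemma fls_subdegree_add_ge:
  "a = 0 \<or> fls_subdegree a \<ge> n \<Longrightarrow> b = 0 \<or> fls_subdegree b \<ge> n \<Longrightarrow> a + b = 0 \<or> fls_subdegree (a + b) \<ge> n"
  for a b :: "'k::field fls"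
  using fls_plus_subdegree[of a b] by (cases "a = 0"; cases "b = 0"; cases "a + b = 0") auto

section \<open>Polynomials over the constants, evaluated at a Laurent series\<close>

definition peval :: "'k::field poly \<Rightarrow> 'k fls \<Rightarrow> 'k fls" where
  "peval p f = poly (map_poly fls_const p) f"

lemma peval_0 [simp]: "peval 0 f = 0"
  by (simp add: peval_def)

lemma peval_pCons [simp]: "peval (pCons c p) f = fls_const c + f * peval p f"
  by (cases "c = 0 \<and> p = 0") (auto simp: peval_def map_poly_pCons)

lemma peval_add: "peval (p + q) f = peval p f + peval q f"
  by (induction p q rule: poly_induct2) (auto simp: algebra_simps simp flip: fls_plus_const)

lemma peval_smult: "peval (Polynomial.smult c p) f = fls_const c * peval p f"
  by (induction p) (auto simp: algebra_simps)

lemma peval_mult: "peval (p * q) f = peval p f * peval q f"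
  by (induction p) (auto simp: peval_add peval_smult algebra_simps)

lemma peval_sum: "peval (sum p I) f = (\<Sum>i\<in>I. peval (p i) f)"
  by (induction I rule: infinite_finite_induct) (auto simp: peval_add)

lemma peval_monom: "peval (Polynomial.monom c n) f = fls_const c * f ^ n"
  by (induction n) (auto simp: monom_0 monom_Suc algebra_simps)

text \<open>The full power of the variable is split off, leaving a cofactor with nonzero constant
  term. At a point where \<open>f\<close> vanishes, \<open>peval q f\<close> is therefore a
  unit.\<close>

lemma peval_split:
  fixes p :: "'k::field poly"
  assumes "p \<noteq> 0"
  obtains j q where "\<And>f. peval p f = f ^ j * peval q f" "poly q 0 \<noteq> 0"
proof -
  obtain q where q: "p = [:- 0, 1:] ^ Polynomial.order 0 p * q" "\<not> [:- 0, 1:] dvd q"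
    using order_decomp[OF assms] by blast
  have "peval ([:0, 1:] ^ n) f = f ^ n" for n and f :: "'k fls"
    by (induction n) (auto simp: peval_mult algebra_simps one_pCons)
  then have "peval p f = f ^ Polynomial.order 0 p * peval q f" for f
    by (subst q(1)) (simp add: peval_mult)
  moreover have "poly q 0 \<noteq> 0" using q(2) by (simp add: poly_eq_0_iff_dvd)
  ultimately show thesis by (rule that)
qed

text \<open>Gaussian elimination by induction on the equations: a pivot \<open>j\<close> in equation
  \<open>w\<close> removes one unknown and one equation.\<close>

lemma homogeneous_system_nontrivial:
  fixes c :: "'i \<Rightarrow> 'w \<Rightarrow> 'k::field"
  assumes "finite T" "finite I" "card I > card T"
  shows "\<exists>x. (\<exists>i\<in>I. x i \<noteq> 0) \<and> (\<forall>w\<in>T. (\<Sum>i\<in>I. x i * c i w) = 0)"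
  using assms
proof (induction T arbitrary: I c rule: finite_induct)
  case empty
  then show ?case by (intro exI[of _ "\<lambda>_. 1"]) (auto simp: card_gt_0_iff)
next
  case (insert w T)
  show ?case
  proof (cases "\<forall>i\<in>I. c i w = 0")
    case True
    obtain x where "\<exists>i\<in>I. x i \<noteq> 0" "\<forall>v\<in>T. (\<Sum>i\<in>I. x i * c i v) = 0"
      using insert.IH[of I c] insert.prems insert.hyps by auto
    with True show ?thesis by (intro exI[of _ x]) auto
  next
    case False
    then obtain j where j: "j \<in> I" "c j w \<noteq> 0" by blast
    let ?I = "I - {j}"
    define d where "d i v = c i v - c i w / c j w * c j v" for i v
    have "card ?I > card T" using insert.prems insert.hyps j by (simp add: card_Diff_singleton)
    then obtain x where x: "\<exists>i\<in>?I. x i \<noteq> 0" "\<forall>v\<in>T. (\<Sum>i\<in>?I. x i * d i v) = 0"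
      using insert.IH[of ?I d] insert.prems by auto
    \<comment> \<open>The value at the pivot is chosen to solve equation \<open>w\<close>; the
      \<open>d\<close> are the coefficients left after substituting it into the other
      equations.\<close>
    define y where "y = x(j := - (\<Sum>i\<in>?I. x i * c i w / c j w))"
    have sum_y: "(\<Sum>i\<in>I. y i * c i v) = (\<Sum>i\<in>?I. x i * d i v)" for v
    proof -
      have "(\<Sum>i\<in>I. y i * c i v) = y j * c j v + (\<Sum>i\<in>?I. y i * c i v)"
        using j insert.prems by (simp add: sum.remove)
      also have "(\<Sum>i\<in>?I. y i * c i v) = (\<Sum>i\<in>?I. x i * c i v)"
        by (rule sum.cong) (auto simp: y_def)
      also have "y j * c j v = - (\<Sum>i\<in>?I. x i * (c i w / c j w * c j v))"
        by (simp add: y_def sum_distrib_right mult.assoc)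
      finally show ?thesis
        by (simp add: d_def sum_subtractf algebra_simps)
    qed
    have "d i w = 0" for i using j by (simp add: d_def)
    then have "\<forall>v\<in>insert w T. (\<Sum>i\<in>I. y i * c i v) = 0"
      using x(2) by (simp add: sum_y)
    moreover have "\<exists>i\<in>I. y i \<noteq> 0" using x(1) by (auto simp: y_def)
    ultimately show ?thesis by blast
  qed
qed

text \<open>The Riemann-Roch space of \<open>d\<close> times infinity. The series 0 passes the bound
  because its subdegree is 0 by convention.\<close>

definition pole_space :: "'k::field fls set \<Rightarrow> nat \<Rightarrow> 'k fls set" where
  "pole_space A d = {a \<in> A. - fls_subdegree a \<le> int d}"

text \<open>A \<open>k\<close>-algebra homomorphism to \<open>k\<close>, extended by 0 outside
  \<open>A\<close>. With this normalisation two points are equal as functions as soon as they agree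
  on \<open>A\<close>.\<close>

definition is_point :: "'k::field fls set \<Rightarrow> ('k fls \<Rightarrow> 'k) \<Rightarrow> bool" where
  "is_point A s \<longleftrightarrow> (\<forall>c. s (fls_const c) = c) \<and>
     (\<forall>a\<in>A. \<forall>b\<in>A. s (a + b) = s a + s b \<and> s (a * b) = s a * s b) \<and> (\<forall>a. a \<notin> A \<longrightarrow> s a = 0)"

text \<open>\<open>t\<close> generates the maximal ideal of the local ring at \<open>s\<close>. The
  equation \<open>f = t * (g / u)\<close> with \<open>u\<close> a unit at \<open>s\<close> is
  written without denominators, so that no localisation has to be built.\<close>

definition local_generator :: "'k::field fls set \<Rightarrow> ('k fls \<Rightarrow> 'k) \<Rightarrow> 'k fls \<Rightarrow> bool" where
  "local_generator A s t \<longleftrightarrow> t \<in> A \<and> s t = 0 \<and>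
     (\<forall>f\<in>A. s f = 0 \<longrightarrow> (\<exists>u\<in>A. \<exists>g\<in>A. s u \<noteq> 0 \<and> f * u = t * g))"

definition fractions :: "'k::field fls set \<Rightarrow> 'k fls set" where
  "fractions A = {a / b | a b. a \<in> A \<and> b \<in> A \<and> b \<noteq> 0}"

lemma fractionsI: "a \<in> A \<Longrightarrow> b \<in> A \<Longrightarrow> b \<noteq> 0 \<Longrightarrow> a / b \<in> fractions A"
  unfolding fractions_def by blast

lemma fractionsE:
  assumes "q \<in> fractions A"
  obtains a b where "a \<in> A" "b \<in> A" "b \<noteq> 0" "q = a / b"
  using assms unfolding fractions_def by blast

text \<open>The step \<open>e\<close> lets the algebra of the quotient curve stay inside the series
  in the parameter of the covering curve; the pole order on the curve itself is then the negated
  subdegree divided by \<open>e\<close>.\<close>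

locale pole_algebra =
  fixes A :: "'k::{alg_closed_field, field_char_0} fls set" and e :: nat
  assumes e_pos: "e > 0"
    and const_in [simp]: "fls_const c \<in> A"
    and add_in: "a \<in> A \<Longrightarrow> b \<in> A \<Longrightarrow> a + b \<in> A"
    and mult_in: "a \<in> A \<Longrightarrow> b \<in> A \<Longrightarrow> a * b \<in> A"
    and subdegree_le_0: "a \<in> A \<Longrightarrow> fls_subdegree a \<le> 0"
    and e_dvd_subdegree: "a \<in> A \<Longrightarrow> int e dvd fls_subdegree a"
    and cofinite_poles: "\<exists>n0. \<forall>n\<ge>n0. e dvd n \<longrightarrow> (\<exists>a\<in>A. fls_subdegree a = - int n)"
begin

lemma zero_in [simp]: "0 \<in> A" and one_in [simp]: "1 \<in> A"
  using const_in[of 0] const_in[of 1] by simp_all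

lemma uminus_in: "a \<in> A \<Longrightarrow> - a \<in> A"
  using mult_in[OF const_in[of "-1"], of a] by simp

lemma diff_in: "a \<in> A \<Longrightarrow> b \<in> A \<Longrightarrow> a - b \<in> A"
  using add_in[of a "- b"] uminus_in[of b] by simp

lemma power_in: "a \<in> A \<Longrightarrow> a ^ n \<in> A"
  by (induction n) (auto intro: mult_in)

lemma sum_in: "(\<And>i. i \<in> I \<Longrightarrow> f i \<in> A) \<Longrightarrow> sum f I \<in> A"
  by (induction I rule: infinite_finite_induct) (auto intro: add_in)

lemma peval_in: "a \<in> A \<Longrightarrow> peval p a \<in> A"
  by (induction p) (auto intro: add_in mult_in)

lemmas closed = add_in mult_in uminus_in diff_in power_in sum_in peval_in const_in zero_in one_in

text \<open>Otherwise subtracting the constant term would leave a nonzero element with a zero at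
  infinity, which \<open>subdegree_le_0\<close> excludes.\<close>

lemma constant_if_no_pole:
  assumes "a \<in> A" "fls_subdegree a = 0"
  shows "a = fls_const (a $$ 0)"
proof (rule ccontr)
  let ?b = "a - fls_const (a $$ 0)"
  assume "a \<noteq> fls_const (a $$ 0)"
  then have "?b \<noteq> 0" by simp
  moreover have "?b $$ k = 0" if "k \<le> 0" for k
    using that assms(2) by (cases "k = 0") auto
  ultimately have "fls_subdegree ?b > 0" by (metis fls_subdegree_greaterI)
  moreover have "?b \<in> A" using assms(1) by (intro closed)
  ultimately show False using subdegree_le_0 by fastforce
qed

text \<open>Taken as a positive multiple of \<open>e\<close>, so that it is itself a pole order and
  elements of at least this pole order are automatically nonzero.\<close>

definition conductor :: nat where
  "conductor = (SOME n0. n0 > 0 \<and> e dvd n0 \<and> (\<forall>n\<ge>n0. e dvd n \<longrightarrow> (\<exists>a\<in>A. fls_subdegree a = - int n)))"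

lemma conductor: "conductor > 0" "e dvd conductor"
    "n \<ge> conductor \<Longrightarrow> e dvd n \<Longrightarrow> \<exists>a\<in>A. a \<noteq> 0 \<and> fls_subdegree a = - int n"
proof -
  obtain n0 where n0: "\<forall>n\<ge>n0. e dvd n \<longrightarrow> (\<exists>a\<in>A. fls_subdegree a = - int n)"
    using cofinite_poles by blast
  have ex: "\<exists>n0. n0 > 0 \<and> e dvd n0 \<and> (\<forall>n\<ge>n0. e dvd n \<longrightarrow> (\<exists>a\<in>A. fls_subdegree a = - int n))"
  \<comment> \<open>The factor \<open>e\<close> makes the bound a multiple of \<open>e\<close>, and
    \<open>Suc\<close> makes it positive even if \<open>n0 = 0\<close>.\<close>
  proof (intro exI[of _ "e * Suc n0"] conjI allI impI)
    fix n assume "e * Suc n0 \<le> n" "e dvd n"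
    moreover have "n0 \<le> e * Suc n0" using e_pos by (cases e) auto
    ultimately show "\<exists>a\<in>A. fls_subdegree a = - int n" using n0 by auto
  qed (use e_pos in auto)
  note c = someI_ex[OF ex, folded conductor_def]
  show "conductor > 0" "e dvd conductor" using c by auto
  assume "n \<ge> conductor" "e dvd n"
  then obtain a where "a \<in> A" "fls_subdegree a = - int n" using c by blast
  moreover have "n > 0" using c \<open>n \<ge> conductor\<close> by auto
  ultimately show "\<exists>a\<in>A. a \<noteq> 0 \<and> fls_subdegree a = - int n" by (intro bexI[of _ a]) auto
qed

lemma pole_space_subset: "pole_space A d \<subseteq> A"
  by (auto simp: pole_space_def)

lemma const_pole_space [simp]: "fls_const c \<in> pole_space A d"
  by (simp add: pole_space_def)

lemma one_pole_space [simp]: "1 \<in> pole_space A d" and zero_pole_space [simp]: "0 \<in> pole_space A d"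
  by (simp_all add: pole_space_def)

lemma add_pole_space: "a \<in> pole_space A d \<Longrightarrow> b \<in> pole_space A d \<Longrightarrow> a + b \<in> pole_space A d"
  using fls_subdegree_add_ge[of a "- int d" b] by (auto simp: pole_space_def intro: closed)

lemma mult_pole_space: "a \<in> pole_space A d \<Longrightarrow> b \<in> pole_space A d' \<Longrightarrow> a * b \<in> pole_space A (d + d')"
  by (cases "a = 0 \<or> b = 0") (auto simp: pole_space_def intro: closed)

lemma scale_pole_space: "a \<in> pole_space A d \<Longrightarrow> fls_const c * a \<in> pole_space A d"
  using mult_pole_space[of "fls_const c" 0 a d] by simp

lemma uminus_pole_space: "a \<in> pole_space A d \<Longrightarrow> - a \<in> pole_space A d"
  by (auto simp: pole_space_def intro: closed)

lemma diff_pole_space: "a \<in> pole_space A d \<Longrightarrow> b \<in> pole_space A d \<Longrightarrow> a - b \<in> pole_space A d"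
  using add_pole_space[of a d "- b"] uminus_pole_space[of b d] by simp

lemma sum_pole_space: "(\<And>i. i \<in> I \<Longrightarrow> f i \<in> pole_space A d) \<Longrightarrow> sum f I \<in> pole_space A d"
  by (induction I rule: infinite_finite_induct) (auto intro: add_pole_space)

lemma power_pole_space: "a \<in> pole_space A d \<Longrightarrow> a ^ n \<in> pole_space A (n * d)"
  by (induction n) (auto intro: mult_pole_space)

lemma in_pole_space: "a \<in> A \<Longrightarrow> \<exists>d0. \<forall>d\<ge>d0. a \<in> pole_space A d"
  by (intro exI[of _ "nat (- fls_subdegree a)"]) (auto simp: pole_space_def)

text \<open>Pole orders of elements of \<open>A\<close> are natural numbers, so a procedure that
  lowers the pole order terminates; 0 is a separate base case because its subdegree carries no
  information.\<close>

lemma pole_descent [consumes 1, case_names zero reduce]: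
  assumes "a \<in> A" and "P 0"
    and step: "\<And>a. a \<in> A \<Longrightarrow> a \<noteq> 0 \<Longrightarrow> (\<And>b. b \<in> A \<Longrightarrow> b = 0 \<or> fls_subdegree b > fls_subdegree a \<Longrightarrow> P b) \<Longrightarrow> P a"
  shows "P a"
proof -
  have "P a" if "a \<in> A" "nat (- fls_subdegree a) = n" for n a
    using that
  proof (induction n arbitrary: a rule: less_induct)
    case (less n)
    show ?case
    proof (cases "a = 0", use \<open>P 0\<close> in simp, rule step[OF less.prems(1)])
      fix b assume b: "b \<in> A" "b = 0 \<or> fls_subdegree b > fls_subdegree a"
      show "P b"
      proof (cases "b = 0")
        case False
        then have "nat (- fls_subdegree b) < n" using b less.prems subdegree_le_0[OF b(1)] by auto
        then show ?thesis using less.IH b by blast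
      qed (use \<open>P 0\<close> in simp)
    qed
  qed
  then show ?thesis using assms(1) by blast
qed

section \<open>Finite dimension of pole spaces and of quotients of the algebra\<close>

lemma pole_space_spanning:
  "\<exists>T. finite T \<and> T \<subseteq> pole_space A d \<and> (\<forall>a\<in>pole_space A d. \<exists>c. a = (\<Sum>w\<in>T. fls_const (c w) * w))"
proof (induction d)
  case 0
  have "a = (\<Sum>w\<in>{1}. fls_const (a $$ 0) * w)" if "a \<in> pole_space A 0" for a
    using that constant_if_no_pole[of a] subdegree_le_0[of a] by (auto simp: pole_space_def)
  then have "\<exists>c. a = (\<Sum>w\<in>{1}. fls_const (c w) * w)" if "a \<in> pole_space A 0" for a
    using that by (intro exI[of _ "\<lambda>_. a $$ 0"]) simp
  then show ?case by (intro exI[of _ "{1}"]) auto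
next
  case (Suc d)
  then obtain T where T: "finite T" "T \<subseteq> pole_space A d"
    and span: "\<And>a. a \<in> pole_space A d \<Longrightarrow> \<exists>c. a = (\<Sum>w\<in>T. fls_const (c w) * w)" by blast
  show ?case
  proof (cases "\<exists>b\<in>A. fls_subdegree b = - int (Suc d)")
    case True
    then obtain b where b: "b \<in> A" "fls_subdegree b = - int (Suc d)" by blast
    then have "b \<noteq> 0" and "b \<notin> T" using T by (auto simp: pole_space_def)
    have "\<exists>c. a = (\<Sum>w\<in>insert b T. fls_const (c w) * w)" if a: "a \<in> pole_space A (Suc d)" for a
    proof -
      \<comment> \<open>Raising the bound by one costs at most one new generator: a multiple of
        \<open>b\<close> removes the leading term of order \<open>Suc d\<close>.\<close>
      have "\<exists>k. a - fls_const k * b \<in> pole_space A d"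
      proof (cases "a \<in> pole_space A d")
        case True then show ?thesis by (intro exI[of _ 0]) simp
      next
        case False
        then have sd: "fls_subdegree a = fls_subdegree b" and "a \<noteq> 0"
          using a b by (auto simp: pole_space_def)
        then obtain k where "a - fls_const k * b = 0 \<or> fls_subdegree (a - fls_const k * b) > fls_subdegree a"
          using fls_cancel_leading[OF \<open>b \<noteq> 0\<close>] by blast
        moreover have "a - fls_const k * b \<in> A" using a b by (auto simp: pole_space_def intro: closed)
        ultimately show ?thesis using sd b by (intro exI[of _ k]) (auto simp: pole_space_def)
      qed
      then obtain k c where c: "a - fls_const k * b = (\<Sum>w\<in>T. fls_const (c w) * w)" using span by blast
      have "(\<Sum>w\<in>insert b T. fls_const ((c(b := k)) w) * w) = fls_const k * b + (\<Sum>w\<in>T. fls_const ((c(b := k)) w) * w)"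
        using T(1) \<open>b \<notin> T\<close> by simp
      also have "(\<Sum>w\<in>T. fls_const ((c(b := k)) w) * w) = (\<Sum>w\<in>T. fls_const (c w) * w)"
        using \<open>b \<notin> T\<close> by (intro sum.cong) auto
      finally have "(\<Sum>w\<in>insert b T. fls_const ((c(b := k)) w) * w) = a" using c by (simp add: algebra_simps)
      then show ?thesis by metis
    qed
    moreover have "insert b T \<subseteq> pole_space A (Suc d)" using T b by (auto simp: pole_space_def)
    ultimately show ?thesis using T(1) by (intro exI[of _ "insert b T"]) auto
  next
    case False
    then have "pole_space A (Suc d) = pole_space A d"
      by (auto simp: pole_space_def)
    then show ?thesis using Suc by simp
  qed
qed

lemma pole_space_spanningE:
  obtains T where "finite T" "T \<subseteq> pole_space A d"
    "\<forall>a\<in>pole_space A d. \<exists>c. a = (\<Sum>w\<in>T. fls_const (c w) * w)"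
proof -
  obtain T where "finite T \<and> T \<subseteq> pole_space A d \<and> (\<forall>a\<in>pole_space A d. \<exists>c. a = (\<Sum>w\<in>T. fls_const (c w) * w))"
    using pole_space_spanning by (rule exE)
  then show thesis by (intro that[of T]) simp_all
qed

text \<open>Beyond \<open>?K\<close> the pole order exceeds that of \<open>a\<close> by more than
  the conductor, so the leading term is that of a multiple of \<open>a\<close>. Hence
  \<open>A\<close> modulo \<open>a A\<close> is finite-dimensional.\<close>

lemma reduce_mod:
  assumes a: "a \<in> A" "a \<noteq> 0"
  shows "\<exists>K. \<forall>f\<in>A. \<exists>b\<in>A. f - a * b \<in> pole_space A K"
proof (intro exI ballI)
  let ?K = "conductor + nat (- fls_subdegree a)"
  fix f assume "f \<in> A"
  then show "\<exists>b\<in>A. f - a * b \<in> pole_space A ?K"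
  proof (induction f rule: pole_descent)
    case zero
    then show ?case by (intro bexI[of _ 0]) auto
  next
    case (reduce f)
    show ?case
    proof (cases "f \<in> pole_space A ?K")
      case True then show ?thesis by (intro bexI[of _ 0]) auto
    next
      case False
      then have big: "- fls_subdegree f > int conductor - fls_subdegree a"
        using reduce subdegree_le_0[OF a(1)] by (auto simp: pole_space_def)
      define n where "n = nat (fls_subdegree a - fls_subdegree f)"
      have n: "int n = fls_subdegree a - fls_subdegree f" using big by (simp add: n_def)
      have "int e dvd int n" unfolding n using e_dvd_subdegree reduce a by (auto intro: dvd_diff)
      then have "e dvd n" by (simp only: int_dvd_int_iff)
      moreover have "n \<ge> conductor" using big n by linarith
      ultimately
      obtain b where b: "b \<in> A" "b \<noteq> 0" "fls_subdegree b = - int n" using conductor(3) by blast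
      have "f \<noteq> 0" using big subdegree_le_0[OF a(1)] by auto
      moreover have "fls_subdegree f = fls_subdegree (a * b)" using a b n by simp
      ultimately obtain c where c: "f - fls_const c * (a * b) = 0 \<or> fls_subdegree (f - fls_const c * (a * b)) > fls_subdegree f"
        using fls_cancel_leading[of "a * b" f] a b by auto
      moreover have "f - fls_const c * (a * b) \<in> A" using reduce a b by (intro closed)
      ultimately obtain b' where b': "b' \<in> A" "f - fls_const c * (a * b) - a * b' \<in> pole_space A ?K"
        using reduce.IH by blast
      then have "f - a * (fls_const c * b + b') \<in> pole_space A ?K" by (simp add: algebra_simps)
      moreover have "fls_const c * b + b' \<in> A" using b b' by (intro closed)
      ultimately show ?thesis by blast
    qed
  qed
qed

text \<open>The powers of \<open>f\<close> become linearly dependent in the finite-dimensional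
  quotient by \<open>a\<close>. This bounds the values of \<open>f\<close> at the zeros of
  \<open>a\<close> and makes residue fields algebraic over \<open>k\<close>.\<close>

lemma algebraic_mod:
  assumes a: "a \<in> A" "a \<noteq> 0" and f: "f \<in> A"
  shows "\<exists>p b. p \<noteq> 0 \<and> b \<in> A \<and> peval p f = a * b"
proof -
  obtain K where K: "\<forall>f\<in>A. \<exists>b\<in>A. f - a * b \<in> pole_space A K" using reduce_mod a by blast
  obtain T where T: "finite T" "T \<subseteq> pole_space A K"
      and span: "\<forall>a\<in>pole_space A K. \<exists>c. a = (\<Sum>w\<in>T. fls_const (c w) * w)"
    by (rule pole_space_spanningE)
  have "\<forall>i. \<exists>b c. b \<in> A \<and> f ^ i - a * b = (\<Sum>w\<in>T. fls_const (c w) * w)"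
  proof
    fix i
    obtain b where b: "b \<in> A" "f ^ i - a * b \<in> pole_space A K" using K power_in[OF f] by blast
    show "\<exists>b c. b \<in> A \<and> f ^ i - a * b = (\<Sum>w\<in>T. fls_const (c w) * w)"
      using b(1) bspec[OF span b(2)] by (intro exI[of _ b]) simp
  qed
  then obtain b where "\<forall>i. \<exists>c. b i \<in> A \<and> f ^ i - a * b i = (\<Sum>w\<in>T. fls_const (c w) * w)"
    by (rule exE[OF choice])
  then obtain c where "\<forall>i. b i \<in> A \<and> f ^ i - a * b i = (\<Sum>w\<in>T. fls_const (c i w) * w)"
    by (rule exE[OF choice])
  then have bc: "\<And>i. b i \<in> A" "\<And>i. f ^ i - a * b i = (\<Sum>w\<in>T. fls_const (c i w) * w)"
    by simp_all
  \<comment> \<open>\<open>{..card T}\<close> has one element more than \<open>T\<close>, so there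
    are more powers of \<open>f\<close> than spanning vectors.\<close>
  let ?I = "{..card T}"
  obtain x where x: "\<exists>i\<in>?I. x i \<noteq> 0" "\<forall>w\<in>T. (\<Sum>i\<in>?I. x i * c i w) = 0"
    using homogeneous_system_nontrivial[OF T(1), of ?I c] by auto
  define p where "p = (\<Sum>i\<in>?I. Polynomial.monom (x i) i)"
  have "Polynomial.coeff p i = x i" if "i \<in> ?I" for i
    using that by (simp add: p_def coeff_sum sum.delta)
  then have "p \<noteq> 0" using x(1) by force
  have "(\<Sum>i\<in>?I. fls_const (x i) * (f ^ i - a * b i)) = (\<Sum>w\<in>T. (\<Sum>i\<in>?I. fls_const (x i * c i w)) * w)"
    unfolding bc(2) sum_distrib_left sum_distrib_right
    by (subst sum.swap) (simp add: mult.assoc flip: fls_const_mult_const)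
  also have "\<dots> = 0"
  proof (rule sum.neutral, safe)
    fix w assume "w \<in> T"
    have "(\<Sum>i\<in>?I. fls_const (x i * c i w)) = fls_const (\<Sum>i\<in>?I. x i * c i w)"
      by (induction rule: finite_induct[OF finite_atMost[of "card T"]]) (simp_all add: fls_plus_const del: fls_const_mult_const)
    then show "(\<Sum>i\<in>?I. fls_const (x i * c i w)) * w = 0" using x(2) \<open>w \<in> T\<close> by simp
  qed
  finally have "peval p f = a * (\<Sum>i\<in>?I. fls_const (x i) * b i)"
    by (simp add: p_def peval_sum peval_monom right_diff_distrib sum_subtractf sum_distrib_left algebra_simps)
  moreover have "(\<Sum>i\<in>?I. fls_const (x i) * b i) \<in> A" using bc by (intro closed)
  ultimately show ?thesis using \<open>p \<noteq> 0\<close> by blast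
qed

section \<open>Ideals and the Nullstellensatz\<close>

definition is_ideal :: "'k fls set \<Rightarrow> bool" where
  "is_ideal J \<longleftrightarrow> J \<subseteq> A \<and> 0 \<in> J \<and> (\<forall>a\<in>J. \<forall>b\<in>J. a + b \<in> J) \<and> (\<forall>a\<in>A. \<forall>b\<in>J. a * b \<in> J)"

lemma is_idealD:
  assumes "is_ideal J"
  shows "j \<in> J \<Longrightarrow> j \<in> A" "0 \<in> J" "i \<in> J \<Longrightarrow> j \<in> J \<Longrightarrow> i + j \<in> J" "a \<in> A \<Longrightarrow> j \<in> J \<Longrightarrow> a * j \<in> J"
  using assms unfolding is_ideal_def by blast+

lemma is_ideal_principal_sum:
  assumes "is_ideal J" "f \<in> A"
  shows "is_ideal {j + f * b | j b. j \<in> J \<and> b \<in> A}" (is "is_ideal ?I")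
  unfolding is_ideal_def
proof (intro conjI ballI)
  show "?I \<subseteq> A" using is_idealD(1)[OF assms(1)] assms(2) by (auto intro!: add_in mult_in)
  have "0 + f * 0 \<in> ?I" using is_idealD(2)[OF assms(1)] zero_in by blast
  then show "0 \<in> ?I" by simp
next
  fix x y assume "x \<in> ?I" "y \<in> ?I"
  then obtain j b j' b' where "x = j + f * b" "y = j' + f * b'" "j \<in> J" "j' \<in> J" "b \<in> A" "b' \<in> A" by blast
  then have "x + y = (j + j') + f * (b + b')" "j + j' \<in> J" "b + b' \<in> A"
    using is_idealD[OF assms(1)] add_in by (auto simp: algebra_simps)
  then show "x + y \<in> ?I" by blast
next
  fix a x assume "a \<in> A" "x \<in> ?I"
  then obtain j b where "x = j + f * b" "j \<in> J" "b \<in> A" by blast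
  then have "a * x = a * j + f * (a * b)" "a * j \<in> J" "a * b \<in> A"
    using is_idealD[OF assms(1)] \<open>a \<in> A\<close> mult_in by (auto simp: algebra_simps)
  then show "a * x \<in> ?I" by blast
qed

lemma maximal_ideal_exists:
  assumes "is_ideal J" "1 \<notin> J"
  shows "\<exists>M. is_ideal M \<and> 1 \<notin> M \<and> J \<subseteq> M \<and> (\<forall>I. is_ideal I \<and> 1 \<notin> I \<and> M \<subseteq> I \<longrightarrow> I = M)"
proof -
  let ?S = "{I. is_ideal I \<and> 1 \<notin> I \<and> J \<subseteq> I}"
  have "\<exists>M\<in>?S. \<forall>X\<in>?S. M \<subseteq> X \<longrightarrow> X = M"
  proof (rule subset_Zorn_nonempty)
    show "?S \<noteq> {}" using assms by auto
    fix C assume C: "C \<noteq> {}" "subset.chain ?S C"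
    then have sub: "C \<subseteq> ?S" and lin: "\<And>X Y. X \<in> C \<Longrightarrow> Y \<in> C \<Longrightarrow> X \<subseteq> Y \<or> Y \<subseteq> X"
      by (auto simp: subset.chain_def subset_chain_def)
    have "is_ideal (\<Union>C)"
      unfolding is_ideal_def
    proof (intro conjI ballI)
      show "\<Union>C \<subseteq> A" "0 \<in> \<Union>C" using sub C(1) by (auto simp: is_ideal_def)
    next
      fix a b assume "a \<in> \<Union>C" "b \<in> \<Union>C"
      then obtain X where "X \<in> C" "a \<in> X" "b \<in> X" using lin by blast
      moreover have "is_ideal X" using sub \<open>X \<in> C\<close> by blast
      ultimately show "a + b \<in> \<Union>C" by (auto simp: is_ideal_def)
    next
      fix a b assume "a \<in> A" "b \<in> \<Union>C"
      then obtain X where "X \<in> C" "b \<in> X" by blast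
      moreover have "is_ideal X" using sub \<open>X \<in> C\<close> by blast
      ultimately show "a * b \<in> \<Union>C" using \<open>a \<in> A\<close> is_idealD(4) by blast
    qed
    then show "\<Union>C \<in> ?S" using sub C(1) by auto
  qed
  then show ?thesis by (auto dest: subset_trans)
qed

text \<open>Algebraic closedness splits off a linear factor. If it is not in \<open>M\<close>, it is
  invertible modulo the maximal ideal, so the cofactor of smaller degree already takes a value in
  \<open>M\<close>.\<close>

lemma peval_root_mod_maximal:
  assumes M: "is_ideal M" "1 \<notin> M" "\<And>I. is_ideal I \<Longrightarrow> 1 \<notin> I \<Longrightarrow> M \<subseteq> I \<Longrightarrow> I = M"
    and f: "f \<in> A" and p: "p \<noteq> 0" "peval p f \<in> M"
  shows "\<exists>r. f - fls_const r \<in> M"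
  using p
proof (induction "degree p" arbitrary: p rule: less_induct)
  case less
  show ?case
  proof (cases "degree p = 0")
    case True
    then obtain c where c: "p = [:c:]" "c \<noteq> 0" using less.prems by (auto elim: degree_eq_zeroE)
    then have "fls_const c \<in> M" using less.prems by simp
    then have "fls_const (inverse c) * fls_const c \<in> M" by (rule is_idealD(4)[OF M(1) const_in])
    then show ?thesis using c M(2) by simp
  next
    case False
    then obtain r where "poly p r = 0" using alg_closed_imp_poly_has_root by blast
    then obtain q where q: "p = [:- r, 1:] * q" by (metis poly_eq_0_iff_dvd dvdE)
    then have "q \<noteq> 0" using less.prems by auto
    then have deg: "degree q < degree p" unfolding q by (subst degree_mult_eq) auto
    let ?g = "f - fls_const r"
    have pq: "peval p f = ?g * peval q f" unfolding q peval_mult by simp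
    show ?thesis
    proof (cases "?g \<in> M")
      case False
      let ?I = "{j + ?g * b | j b. j \<in> M \<and> b \<in> A}"
      have "?g \<in> A" using f by (intro closed)
      have "is_ideal ?I" by (rule is_ideal_principal_sum[OF M(1) \<open>?g \<in> A\<close>])
      moreover have "M \<subseteq> ?I"
      proof
        fix m assume "m \<in> M"
        then have "m + ?g * 0 \<in> ?I" using zero_in by blast
        then show "m \<in> ?I" by simp
      qed
      moreover have "0 + ?g * 1 \<in> ?I" using is_idealD(2)[OF M(1)] one_in by blast
      then have "?g \<in> ?I" by simp
      ultimately have "1 \<in> ?I" using M(3) False by blast
      then obtain j b where jb: "1 = j + ?g * b" "j \<in> M" "b \<in> A" by blast
      have "peval q f = peval q f * (j + ?g * b)" using jb(1) by simp
      also have "\<dots> = peval q f * j + b * peval p f" unfolding pq by (simp add: algebra_simps)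
      also have "\<dots> \<in> M"
        by (intro is_idealD(3)[OF M(1)] is_idealD(4)[OF M(1)] peval_in[OF f] jb less.prems)
      finally show ?thesis using less.hyps deg \<open>q \<noteq> 0\<close> by blast
    qed blast
  qed
qed

text \<open>Every residue class modulo a maximal ideal contains a constant, because by
  \<open>algebraic_mod\<close> the residue field is algebraic over \<open>k\<close>. That argument
  needs a nonzero element in the ideal, so the zero ideal is enlarged first.\<close>

lemma nullstellensatz:
  assumes J: "is_ideal J" "1 \<notin> J"
  shows "\<exists>s. is_point A s \<and> (\<forall>j\<in>J. s j = 0)"
proof -
  obtain a where a: "a \<in> A" "a \<noteq> 0" "\<exists>J'. is_ideal J' \<and> 1 \<notin> J' \<and> J \<subseteq> J' \<and> a \<in> J'"
  proof (cases "J \<subseteq> {0}")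
    case True
    \<comment> \<open>An element with a pole is not a unit: its inverse would have a zero at
      infinity, which no nonzero element of \<open>A\<close> has.\<close>
    obtain a where a: "a \<in> A" "a \<noteq> 0" "fls_subdegree a = - int conductor"
      using conductor by blast
    let ?J = "{j + a * b | j b. j \<in> {0} \<and> b \<in> A}"
    have "is_ideal {0}" by (auto simp: is_ideal_def)
    then have "is_ideal ?J" by (rule is_ideal_principal_sum) (use a in simp)
    moreover have "1 \<notin> ?J"
    proof
      assume "1 \<in> ?J"
      then obtain b where b: "1 = a * b" "b \<in> A" by auto
      then have "b \<noteq> 0" by auto
      then have "fls_subdegree (a * b) = fls_subdegree a + fls_subdegree b" using a by simp
      then show False using a b subdegree_le_0[OF b(2)] conductor(1) by (simp flip: b(1))
    qed
    moreover from calculation(1) have "0 \<in> ?J" by (rule is_idealD(2))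
    then have "J \<subseteq> ?J" using True by blast
    moreover have "0 + a * 1 \<in> ?J" using one_in by blast
    then have "a \<in> ?J" by simp
    ultimately show ?thesis using that a by blast
  next
    case False
    then show ?thesis using that J by (auto simp: is_ideal_def)
  qed
  then obtain J' where J': "is_ideal J'" "1 \<notin> J'" "J \<subseteq> J'" "a \<in> J'" by blast
  obtain M where "is_ideal M \<and> 1 \<notin> M \<and> J' \<subseteq> M \<and> (\<forall>I. is_ideal I \<and> 1 \<notin> I \<and> M \<subseteq> I \<longrightarrow> I = M)"
    using maximal_ideal_exists[OF J'(1,2)] by (rule exE)
  then have M: "is_ideal M" "1 \<notin> M" "J' \<subseteq> M"
      and max: "\<And>I. is_ideal I \<Longrightarrow> 1 \<notin> I \<Longrightarrow> M \<subseteq> I \<Longrightarrow> I = M"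
    by simp_all
  have M': "J \<subseteq> M" "a \<in> M" using J' M(3) by auto
  have "\<exists>r. f - fls_const r \<in> M" if f: "f \<in> A" for f
  proof -
    obtain p b where "p \<noteq> 0" "b \<in> A" "peval p f = a * b" using algebraic_mod a f by blast
    moreover have "b * a \<in> M" using is_idealD(4)[OF M(1)] M'(2) \<open>b \<in> A\<close> by blast
    ultimately have "p \<noteq> 0" "peval p f \<in> M" by (simp_all add: mult.commute)
    then show ?thesis by (rule peval_root_mod_maximal[OF M(1,2) _ f, rotated]) (rule max; assumption)
  qed
  then obtain r where r: "\<And>f. f \<in> A \<Longrightarrow> f - fls_const (r f) \<in> M" by metis
  \<comment> \<open>The constant in a residue class is unique since \<open>M\<close> contains no
    nonzero constant; this is what makes \<open>r\<close> a homomorphism.\<close>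
  have uniq: "r f = c" if "f \<in> A" "f - fls_const c \<in> M" for f c
  proof (rule ccontr)
    let ?d = "c - r f"
    assume "r f \<noteq> c"
    have "- 1 \<in> A" by (intro closed)
    then have "- 1 * (f - fls_const c) \<in> M" using that M(1) unfolding is_ideal_def by blast
    then have "(f - fls_const (r f)) + - 1 * (f - fls_const c) \<in> M"
      using r[OF that(1)] M(1) unfolding is_ideal_def by blast
    also have "(f - fls_const (r f)) + - 1 * (f - fls_const c) = fls_const ?d"
      by (simp add: fls_minus_const algebra_simps)
    finally have "fls_const (inverse ?d) * fls_const ?d \<in> M" using M(1) const_in unfolding is_ideal_def by blast
    then show False using M(2) \<open>r f \<noteq> c\<close> by simp
  qed
  define s where "s f = (if f \<in> A then r f else 0)" for f
  have "is_point A s"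
    unfolding is_point_def
  proof (intro conjI allI ballI impI)
    fix c show "s (fls_const c) = c" using is_idealD(2)[OF M(1)] by (simp add: s_def uniq)
  next
    fix f g assume fg: "f \<in> A" "g \<in> A"
    have "(f - fls_const (r f)) + (g - fls_const (r g)) \<in> M" using r fg is_idealD(3)[OF M(1)] by blast
    then have "r (f + g) = r f + r g" using fg add_in
      by (intro uniq) (auto simp: algebra_simps simp flip: fls_plus_const)
    then show "s (f + g) = s f + s g" using fg by (simp add: s_def add_in)
    have "g * (f - fls_const (r f)) + fls_const (r f) * (g - fls_const (r g)) \<in> M"
      by (intro is_idealD(3)[OF M(1)] is_idealD(4)[OF M(1)] const_in fg r)
    then have "r (f * g) = r f * r g" using fg mult_in
      by (intro uniq) (auto simp: algebra_simps)
    then show "s (f * g) = s f * s g" using fg by (simp add: s_def mult_in)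
  qed (simp add: s_def)
  moreover have "s j = 0" if "j \<in> J" for j
  proof -
    have "j \<in> A" "j - fls_const 0 \<in> M" using that is_idealD(1)[OF J(1)] M'(1) by auto
    then show ?thesis by (simp add: s_def uniq)
  qed
  ultimately show ?thesis by blast
qed

subsection \<open>Points\<close>

context
  fixes s assumes s: "is_point A s"
begin

lemma point_const [simp]: "s (fls_const c) = c"
  and point_add: "a \<in> A \<Longrightarrow> b \<in> A \<Longrightarrow> s (a + b) = s a + s b"
  and point_mult: "a \<in> A \<Longrightarrow> b \<in> A \<Longrightarrow> s (a * b) = s a * s b"
  and point_outside: "a \<notin> A \<Longrightarrow> s a = 0"
  using s by (auto simp: is_point_def)

lemma point_0 [simp]: "s 0 = 0" and point_1 [simp]: "s 1 = 1"
  using point_const[of 0] point_const[of 1] by simp_all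

lemma point_uminus: "a \<in> A \<Longrightarrow> s (- a) = - s a"
  using point_add[of a "- a"] uminus_in[of a] by (simp add: eq_neg_iff_add_eq_0 add.commute)

lemma point_diff: "a \<in> A \<Longrightarrow> b \<in> A \<Longrightarrow> s (a - b) = s a - s b"
  using point_add[of a "- b"] uminus_in[of b] by (simp add: point_uminus)

lemma point_power: "a \<in> A \<Longrightarrow> s (a ^ n) = s a ^ n"
  by (induction n) (auto simp: point_mult power_in)

lemma point_peval: "a \<in> A \<Longrightarrow> s (peval p a) = poly p (s a)"
  by (induction p) (auto simp: point_add point_mult closed)

lemma point_sum: "(\<And>i. i \<in> I \<Longrightarrow> f i \<in> A) \<Longrightarrow> s (sum f I) = (\<Sum>i\<in>I. s (f i))"
  by (induction I rule: infinite_finite_induct) (auto simp: point_add sum_in)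

lemmas point_simps = point_add point_mult point_uminus point_diff point_power point_peval

end

text \<open>Beyond \<open>2 * conductor\<close> a pole order is the sum of the conductor and another
  pole order, so leading terms are those of products. Points are therefore determined on a spanning
  set of one pole space.\<close>

lemma generating_set:
  "\<exists>T. finite T \<and> T \<subseteq> A \<and> (\<forall>s s'. is_point A s \<and> is_point A s' \<and> (\<forall>a\<in>T. s a = s' a) \<longrightarrow> s = s')"
proof -
  let ?M = "2 * conductor"
  obtain T where T: "finite T" "T \<subseteq> pole_space A ?M"
    and span: "\<forall>a\<in>pole_space A ?M. \<exists>c. a = (\<Sum>w\<in>T. fls_const (c w) * w)"
    by (rule pole_space_spanningE)
  have TA: "T \<subseteq> A" using T(2) pole_space_subset by blast
  have "s = s'" if s: "is_point A s" "is_point A s'" and eq: "\<forall>a\<in>T. s a = s' a" for s s'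
  proof
    fix f
    have small: "s a = s' a" if a: "a \<in> pole_space A ?M" for a
    proof -
      obtain c where c: "a = (\<Sum>w\<in>T. fls_const (c w) * w)" using bspec[OF span a] by (rule exE)
      have *: "s'' a = (\<Sum>w\<in>T. c w * s'' w)" if "is_point A s''" for s''
        unfolding c using TA that
        by (subst point_sum) (auto simp: point_mult intro!: mult_in sum.cong)
      show ?thesis using *[OF s(1)] *[OF s(2)] eq by simp
    qed
    show "s f = s' f"
    proof (cases "f \<in> A")
      case False
      then show ?thesis using s point_outside by metis
    next
      case True
      then show ?thesis
      proof (induction f rule: pole_descent)
        case zero
        then show ?case using s by simp
      next
        case (reduce a)
        show ?case
        proof (cases "a \<in> pole_space A ?M")
          case True
          then show ?thesis by (rule small)
        next
          case False
          then have big: "- fls_subdegree a > int ?M" using reduce by (auto simp: pole_space_def)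
          define n where "n = nat (- fls_subdegree a) - conductor"
          have n: "int n = - fls_subdegree a - int conductor" using big by (simp add: n_def)
          have "int e dvd int n" unfolding n using e_dvd_subdegree[OF reduce(1)] conductor(2)
            by (intro dvd_diff) (auto simp: int_dvd_int_iff)
          then have "e dvd n" by (simp only: int_dvd_int_iff)
          moreover have "n \<ge> conductor" using big n by linarith
          ultimately obtain b where b: "b \<in> A" "b \<noteq> 0" "fls_subdegree b = - int n" using conductor(3) by blast
          obtain b' where b': "b' \<in> A" "b' \<noteq> 0" "fls_subdegree b' = - int conductor"
            using conductor(3)[OF _ conductor(2)] by blast
          have "fls_subdegree a = fls_subdegree (b * b')" using b b' n by simp
          then obtain c where c: "a - fls_const c * (b * b') = 0 \<or> fls_subdegree (a - fls_const c * (b * b')) > fls_subdegree a"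
            using fls_cancel_leading[of "b * b'" a] b b' reduce by auto
          let ?r = "a - fls_const c * (b * b')"
          have r: "?r \<in> A" using reduce b b' by (intro closed)
          then have 1: "s ?r = s' ?r" using reduce.IH c by blast
          have "fls_subdegree b > fls_subdegree a" using n b conductor(1) by simp
          then have 2: "s b = s' b" using reduce.IH b by blast
          have 3: "s b' = s' b'" by (rule small) (use b' in \<open>auto simp: pole_space_def\<close>)
          have "s'' a = s'' ?r + c * (s'' b * s'' b')" if "is_point A s''" for s''
          proof -
            have "s'' (?r + fls_const c * (b * b')) = s'' ?r + s'' (fls_const c * (b * b'))"
              using b b' by (intro point_add[OF that r] closed)
            then show ?thesis using b b' that by (simp add: point_mult mult_in)
          qed
          then show ?thesis using s 1 2 3 by metis
        qed
      qed
    qed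
  qed
  then show ?thesis using T(1) TA by blast
qed

text \<open>At a zero of \<open>a\<close>, the value of any \<open>f\<close> is a root of the
  polynomial from \<open>algebraic_mod\<close>. Only finitely many combinations of values are
  possible on a finite set that separates points.\<close>

lemma finite_zeros:
  assumes a: "a \<in> A" "a \<noteq> 0"
  shows "finite {s. is_point A s \<and> s a = 0}"
proof -
  obtain T where T: "finite T" "T \<subseteq> A"
    and sep: "\<And>s s'. is_point A s \<Longrightarrow> is_point A s' \<Longrightarrow> \<forall>a\<in>T. s a = s' a \<Longrightarrow> s = s'"
    using generating_set by blast
  have "\<exists>R. finite R \<and> (\<forall>s. is_point A s \<and> s a = 0 \<longrightarrow> s f \<in> R)" if f: "f \<in> A" for f
  proof -
    obtain p b where p: "p \<noteq> 0" "b \<in> A" "peval p f = a * b" using algebraic_mod a f by blast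
    have "poly p (s f) = 0" if "is_point A s" "s a = 0" for s
      using that a p(2) f by (simp flip: point_peval add: p(3) point_mult)
    then show ?thesis using poly_roots_finite[OF p(1)] by (intro exI[of _ "{x. poly p x = 0}"]) auto
  qed
  then obtain R where R: "\<And>f. f \<in> A \<Longrightarrow> finite (R f)"
      "\<And>f s. f \<in> A \<Longrightarrow> is_point A s \<Longrightarrow> s a = 0 \<Longrightarrow> s f \<in> R f" by metis
  let ?Z = "{s. is_point A s \<and> s a = 0}"
  have "inj_on (\<lambda>s. restrict s T) ?Z"
  proof (rule inj_onI)
    fix s s' assume "s \<in> ?Z" "s' \<in> ?Z" "restrict s T = restrict s' T"
    moreover from this have "\<forall>a\<in>T. s a = s' a" by (metis restrict_apply')
    ultimately show "s = s'" by (intro sep) auto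
  qed
  moreover have "(\<lambda>s. restrict s T) ` ?Z \<subseteq> PiE T R" using R T(2) by auto
  moreover have "finite (PiE T R)" using T R by (intro finite_PiE) auto
  ultimately show ?thesis by (meson finite_subset finite_imageD)
qed

text \<open>A nonconstant \<open>g\<close> takes every value: \<open>g - fls_const c\<close> has a
  pole, hence is not a unit, and the Nullstellensatz gives a zero.\<close>

lemma infinite_points: "infinite {s. is_point A s}"
proof
  assume fin: "finite {s. is_point A s}"
  obtain g where g: "g \<in> A" "g \<noteq> 0" "fls_subdegree g = - int conductor"
    using conductor(3)[OF _ conductor(2)] by blast
  have "\<exists>s. is_point A s \<and> s g = c" for c
  proof -
    let ?h = "g - fls_const c"
    let ?J = "{j + ?h * b | j b. j \<in> {0} \<and> b \<in> A}"
    have h: "?h \<in> A" using g by (intro closed)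
    have "is_ideal {0}" by (auto simp: is_ideal_def)
    then have ideal: "is_ideal ?J" by (rule is_ideal_principal_sum) (use h in simp)
    have "g $$ (- int conductor) \<noteq> 0" using g by (metis nth_fls_subdegree_nonzero)
    then have sh: "fls_subdegree ?h = - int conductor"
      using g(3) conductor(1) by (intro fls_subdegree_eqI) auto
    then have h0: "?h \<noteq> 0" using conductor(1) by (metis fls_zero_subdegree neg_equal_0_iff_equal of_nat_0_eq_iff less_irrefl)
    have "1 \<notin> ?J"
    proof
      assume "1 \<in> ?J"
      then obtain b where b: "1 = ?h * b" "b \<in> A" by auto
      then have "b \<noteq> 0" by auto
      then have "fls_subdegree (?h * b) = fls_subdegree ?h + fls_subdegree b" using h0 by (rule_tac fls_subdegree_mult)
      then show False using sh subdegree_le_0[OF b(2)] conductor(1) by (simp flip: b(1))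
    qed
    then obtain s where s: "is_point A s" "\<forall>j\<in>?J. s j = 0" using nullstellensatz ideal by blast
    moreover have "0 + ?h * 1 \<in> ?J" using one_in by blast
    ultimately have "s ?h = 0" by (metis (no_types, lifting) add_0 mult_1_right)
    then show ?thesis using s g by (auto simp: point_diff)
  qed
  then have "c \<in> (\<lambda>s. s g) ` {s. is_point A s}" for c by (metis (mono_tags, lifting) imageI mem_Collect_eq)
  then have "UNIV \<subseteq> (\<lambda>s. s g) ` {s. is_point A s}" by blast
  then have "finite (UNIV :: 'k set)" using fin finite_surj by blast
  then show False using infinite_UNIV_char_0 by blast
qed

text \<open>A nonzero \<open>f\<close> divides \<open>t ^ j\<close> times a unit at \<open>s\<close>, which bounds the descent \<open>f \<mapsto> f / t\<close>.\<close>

lemma order_exists: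
  assumes s: "is_point A s" and t: "local_generator A s t" and f: "f \<in> A" "f \<noteq> 0"
  shows "\<exists>n. \<exists>u\<in>A. \<exists>g\<in>A. s u \<noteq> 0 \<and> s g \<noteq> 0 \<and> f * u = t ^ n * g"
proof (rule ccontr)
  assume no: "\<not> ?thesis"
  have tA: "t \<in> A" and st: "s t = 0" using t by (auto simp: local_generator_def)
  have desc: "\<exists>u\<in>A. \<exists>g\<in>A. s u \<noteq> 0 \<and> f * u = t ^ n * g" for n
  proof (induction n)
    case 0
    show ?case using f s by (intro bexI[of _ 1] bexI[of _ f]) auto
  next
    case (Suc n)
    then obtain u g where ug: "u \<in> A" "g \<in> A" "s u \<noteq> 0" "f * u = t ^ n * g" by blast
    then have "s g = 0" using no by blast
    then obtain v h where vh: "v \<in> A" "h \<in> A" "s v \<noteq> 0" "g * v = t * h"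
      using t ug(2) by (auto simp: local_generator_def)
    have "f * (u * v) = t ^ Suc n * h" using ug(4) vh(4) by (metis mult.assoc power_Suc2)
    then show ?case using ug vh s by (intro bexI[of _ "u * v"] bexI[of _ h]) (auto simp: point_mult closed)
  qed
  obtain p b where p: "p \<noteq> 0" "b \<in> A" "peval p t = f * b" using algebraic_mod f tA by blast
  obtain j q where q: "\<And>f. peval p f = f ^ j * peval q f" and q0: "poly q 0 \<noteq> 0"
    using peval_split[OF p(1)] by blast
  have eq: "t ^ j * peval q t = f * b" using p(3) q by simp
  \<comment> \<open>Divisibility of \<open>f\<close> by \<open>t ^ Suc j\<close>, one power more
    than was split off from \<open>peval p t\<close>, forces \<open>peval q t\<close> to vanish at
    \<open>s\<close>. Its value there is \<open>q\<close> at 0, which is nonzero.\<close>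
  obtain u g where ug: "u \<in> A" "g \<in> A" "s u \<noteq> 0" "f * u = t ^ Suc j * g" using desc by blast
  have "t \<noteq> 0"
  proof
    assume "t = 0"
    then have "f * u = 0" using ug by simp
    then show False using f ug(3) s by auto
  qed
  have "t ^ j * (peval q t * u) = f * u * b" using eq by (simp add: algebra_simps)
  also have "\<dots> = t ^ j * (t * (g * b))" by (simp add: ug(4))
  finally have "peval q t * u = t * (g * b)" using \<open>t \<noteq> 0\<close> by simp
  then have "s (peval q t * u) = s (t * (g * b))" by simp
  then have "poly q 0 * s u = 0" using s st tA ug p(2) by (simp add: point_mult point_peval closed)
  then show False using q0 ug(3) by simp
qed

section \<open>The field of fractions inside the Laurent series\<close>

lemma fractions_subset: "a \<in> A \<Longrightarrow> a \<in> fractions A"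
  using fractionsI[of a A 1] by simp

lemma fractions_closed:
  assumes "q \<in> fractions A" "r \<in> fractions A"
  shows "q + r \<in> fractions A" "q * r \<in> fractions A" "- q \<in> fractions A" "inverse q \<in> fractions A"
proof -
  obtain a b c d where *: "a \<in> A" "b \<in> A" "b \<noteq> 0" "q = a / b" "c \<in> A" "d \<in> A" "d \<noteq> 0" "r = c / d"
    using assms by (metis fractionsE)
  have eq: "q + r = (a * d + c * b) / (b * d)" "q * r = (a * c) / (b * d)" "- q = (- a) / b"
    using * by (simp_all add: field_simps)
  show "q + r \<in> fractions A" by (subst eq(1)) (use * in \<open>auto intro!: fractionsI closed\<close>)
  show "q * r \<in> fractions A" by (subst eq(2)) (use * in \<open>auto intro!: fractionsI closed\<close>)
  show "- q \<in> fractions A" by (subst eq(3)) (rule fractionsI[OF uminus_in]; use * in simp)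
  show "inverse q \<in> fractions A"
  proof (cases "a = 0")
    case True then show ?thesis using * fractions_subset by simp
  next
    case False
    then have "inverse q = b / a" using * by simp
    then show ?thesis using * False by (auto intro: fractionsI)
  qed
qed

end

section \<open>Cofinite topologies\<close>

text \<open>An infinite set is not the union of two finite ones, which gives irreducibility. Proper
  irreducible closed subsets are finite and hence single points, so a longest chain is a point
  inside the whole space.\<close>

lemma cofinite_topology_curve:
  assumes op: "\<And>U. openin X U \<longleftrightarrow> U = {} \<or> (U \<subseteq> T \<and> finite (T - U))" and inf: "infinite T"
  shows "topspace X = T" "irreducible_space X" "has_dimension X 1"
proof -
  show T: "topspace X = T"
    using op[of T] op[of "topspace X"] by (metis Diff_cancel finite.emptyI openin_subset openin_topspace empty_subsetI subset_antisym subset_refl)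
  have cl: "closedin X C \<longleftrightarrow> C = T \<or> (C \<subseteq> T \<and> finite C)" for C
  proof -
    have "C \<subseteq> T \<Longrightarrow> T - (T - C) = C" by blast
    then show ?thesis unfolding closedin_def T op by auto
  qed
  have T0: "T \<noteq> {}" using inf by auto
  show irr: "irreducible_space X"
    unfolding irreducible_space_def T cl using T0 inf by (metis finite_Un)
  have sub: "topspace (subtopology X C) = C" if "C \<subseteq> T" for C using that T by auto
  have cls: "closedin (subtopology X C) D \<longleftrightarrow> closedin X D \<and> D \<subseteq> C" if "closedin X C" for C D
    using that by (metis closedin_closed_subtopology)
  have irr_proper: "\<exists>p. C = {p}" if C: "closedin X C" "C \<noteq> T" "irreducible_space (subtopology X C)" for C
  proof -
    have fin: "finite C" "C \<subseteq> T" using C(1,2) cl by auto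
    have "C \<noteq> {}" using C(3) sub[OF fin(2)] by (auto simp: irreducible_space_def)
    then obtain p where p: "p \<in> C" by blast
    have "closedin X {p}" "closedin X (C - {p})" using fin p cl by auto
    moreover have "C = {p} \<union> (C - {p})" using p by blast
    ultimately have "{p} = C \<or> C - {p} = C"
      using C(3) p unfolding irreducible_space_def sub[OF fin(2)] cls[OF C(1)] by blast
    then show ?thesis using p by blast
  qed
  obtain p where p: "p \<in> T" using T0 by blast
  have "irreducible_chain X (\<lambda>i. if i = 0 then {p} else T) 1"
    unfolding irreducible_chain_def
  proof (intro conjI allI impI)
    fix i :: nat
    show "closedin X (if i = 0 then {p} else T)" using p cl by auto
    have "irreducible_space (subtopology X {p})"
      using p T by (auto simp: irreducible_space_def cls cl)
    moreover have "subtopology X T = X" using T by (metis subtopology_topspace)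
    ultimately show "irreducible_space (subtopology X (if i = 0 then {p} else T))"
      using irr by auto
  next
    fix i :: nat assume "i < 1"
    have "{p} \<noteq> T" using inf by auto
    then show "(if i = 0 then {p} else T) \<subset> (if Suc i = 0 then {p} else T)" using \<open>i < 1\<close> p by auto
  qed
  moreover have "\<not> irreducible_chain X Z (Suc 1)" for Z
  proof
    assume Z: "irreducible_chain X Z (Suc 1)"
    then have c: "closedin X (Z i)" "irreducible_space (subtopology X (Z i))" if "i \<le> 2" for i
      using that by (auto simp: irreducible_chain_def)
    have "Z 0 \<subset> Z 1" "Z 1 \<subset> Z 2" using Z by (auto simp: irreducible_chain_def numeral_2_eq_2)
    moreover have "Z 2 \<subseteq> T" using c(1)[of 2] cl by auto
    ultimately have "Z 1 \<noteq> T" "Z 0 \<noteq> T" by auto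
    then obtain q r where "Z 1 = {q}" "Z 0 = {r}" using irr_proper c by (metis one_le_numeral zero_le)
    then show False using \<open>Z 0 \<subset> Z 1\<close> by auto
  qed
  ultimately show "has_dimension X 1" by (auto simp: has_dimension_def)
qed

section \<open>Forms\<close>

lemma homogeneous_scale:
  assumes "homogeneous d p"
  shows "mpoly_eval p (\<lambda>i. c * x i) = c ^ d * mpoly_eval p x"
  using assms unfolding homogeneous_def mpoly_eval_def
  by (auto simp: power_mult_distrib prod.distrib sum_distrib_left simp flip: power_sum intro!: sum.cong)

lemma homogeneous_add:
  assumes "homogeneous d p" "homogeneous d q"
  shows "homogeneous d (p + q)"
  using assms Poly_Mapping.keys_add[of p q] unfolding homogeneous_def by blast

lemma homogeneous_zero [simp]: "homogeneous d 0"
  by (simp add: homogeneous_def)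

lemma homogeneous_const: "homogeneous 0 (Poly_Mapping.single 0 c)"
  by (simp add: homogeneous_def)

lemma mpoly_eval_const [simp]: "mpoly_eval (Poly_Mapping.single 0 c) x = c"
  by (simp add: mpoly_eval_single)

lemma homogeneous_variable: "homogeneous 1 (Poly_Mapping.single (Poly_Mapping.single i 1) c)"
  by (cases "c = 0") (auto simp: homogeneous_def)

lemma mpoly_eval_variable: "mpoly_eval (Poly_Mapping.single (Poly_Mapping.single i 1) 1) x = x i"
  by (simp add: mpoly_eval_single)

lemma monomial_split:
  fixes m :: "nat \<Rightarrow>\<^sub>0 nat"
  assumes "m \<noteq> 0"
  obtains i m' where "m = Poly_Mapping.single i 1 + m'"
    "(\<Sum>i\<in>Poly_Mapping.keys m. Poly_Mapping.lookup m i) = Suc (\<Sum>i\<in>Poly_Mapping.keys m'. Poly_Mapping.lookup m' i)"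
proof -
  obtain i where i: "i \<in> Poly_Mapping.keys m" using assms by (metis all_not_in_conv keys_eq_empty)
  define m' where "m' = m - Poly_Mapping.single i 1"
  have lk: "Poly_Mapping.lookup m' j = Poly_Mapping.lookup m j - (if j = i then 1 else 0)" for j
    by (simp add: m'_def lookup_minus lookup_single when_def)
  have pos: "Poly_Mapping.lookup m i > 0" using i by (simp add: in_keys_iff)
  have eq: "m = Poly_Mapping.single i 1 + m'"
    by (rule poly_mapping_eqI) (use pos in \<open>auto simp: lookup_add lookup_single when_def lk\<close>)
  have sub: "Poly_Mapping.keys m' \<subseteq> Poly_Mapping.keys m"
    by (auto simp: in_keys_iff lk)
  have "(\<Sum>i\<in>Poly_Mapping.keys m'. Poly_Mapping.lookup m' i) = (\<Sum>i\<in>Poly_Mapping.keys m. Poly_Mapping.lookup m' i)"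
    by (rule sum.mono_neutral_left) (use sub in \<open>auto simp: in_keys_iff\<close>)
  also have "\<dots> = (Poly_Mapping.lookup m i - 1) + (\<Sum>j\<in>Poly_Mapping.keys m - {i}. Poly_Mapping.lookup m' j)"
    using i by (simp add: sum.remove lk)
  also have "(\<Sum>j\<in>Poly_Mapping.keys m - {i}. Poly_Mapping.lookup m' j) = (\<Sum>j\<in>Poly_Mapping.keys m - {i}. Poly_Mapping.lookup m j)"
    by (rule sum.cong) (auto simp: lk)
  finally have "(\<Sum>i\<in>Poly_Mapping.keys m. Poly_Mapping.lookup m i) = Suc (\<Sum>i\<in>Poly_Mapping.keys m'. Poly_Mapping.lookup m' i)"
    using i pos by (simp add: sum.remove[of "Poly_Mapping.keys m" i])
  then show thesis using eq that by blast
qed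

section \<open>The projective curve of a pole algebra\<close>

text \<open>
  Points are \<open>Some s\<close> for a \<open>k\<close>-algebra homomorphism \<open>s\<close>, and \<open>None\<close> for the point at infinity.
  A form of degree \<open>m\<close> corresponds to an element of \<open>A\<close> with pole order at most \<open>m * N\<close>; at
  infinity it takes the value of its leading coefficient relative to \<open>g ^ m\<close>.
\<close>

definition points :: "'k::field fls set \<Rightarrow> ('k fls \<Rightarrow> 'k) option set" where
  "points A = insert None (Some ` {s. is_point A s})"

definition form_value :: "'k::field fls \<Rightarrow> nat \<Rightarrow> ('k fls \<Rightarrow> 'k) option \<Rightarrow> 'k fls \<Rightarrow> 'k" where
  "form_value g m P a = (case P of None \<Rightarrow> (a / g ^ m) $$ 0 | Some s \<Rightarrow> s a)"

lemma form_value_None [simp]: "form_value g m None a = (a / g ^ m) $$ 0"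
  and form_value_Some [simp]: "form_value g m (Some s) a = s a"
  by (simp_all add: form_value_def)

definition curve_point :: "'k::field fls \<Rightarrow> (nat \<Rightarrow> 'k fls) \<Rightarrow> ('k fls \<Rightarrow> 'k) option \<Rightarrow> 'k ppoint" where
  "curve_point g gs P = ppoint (\<lambda>i. form_value g 1 P (gs i))"

locale smooth_algebra = pole_algebra A e
  for A :: "'k::{alg_closed_field, field_char_0} fls set" and e :: nat +
  assumes smooth: "is_point A s \<Longrightarrow> \<exists>t. local_generator A s t"

text \<open>The bound on \<open>N\<close> leaves room for two things: a large pole order splits into
  two pole orders of prescribed degrees, and \<open>N - e\<close> is still a pole order, so that a
  quotient by \<open>g\<close> is a parameter at infinity. The family \<open>gs\<close> is a
  spanning family rather than a basis, so one curve may be embedded with an extra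
  coordinate.\<close>

locale embedded_curve = smooth_algebra A e
  for A :: "'k::{alg_closed_field, field_char_0} fls set" and e :: nat +
  fixes M N :: nat and g :: "'k fls" and n :: nat and gs :: "nat \<Rightarrow> 'k fls"
  assumes M_pos: "M > 0" and M_dvd: "e dvd M"
    and M_poles: "m \<ge> M \<Longrightarrow> e dvd m \<Longrightarrow> \<exists>a\<in>A. fls_subdegree a = - int m"
    and N_large: "2 * M + e \<le> N" and N_dvd: "e dvd N"
    and g_in: "g \<in> A" and g_subdegree: "fls_subdegree g = - int N"
    and gs_in: "gs i \<in> pole_space A N" and gs_out: "i > n \<Longrightarrow> gs i = 0"
    and gs_span: "a \<in> pole_space A N \<Longrightarrow> \<exists>c. a = (\<Sum>i\<le>n. fls_const (c i) * gs i)"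
begin

abbreviation "L m \<equiv> pole_space A (m * N)"
abbreviation "ev \<equiv> form_value g"
abbreviation "crd P \<equiv> (\<lambda>i. ev 1 P (gs i))"
abbreviation "phi \<equiv> curve_point g gs"
abbreviation "pts \<equiv> points A"

lemma N_pos: "N > 0" using N_large M_pos by simp

lemma g_nonzero [simp]: "g \<noteq> 0" using g_subdegree N_pos by auto

lemma g_pole_space [simp]: "g \<in> L 1" using g_in g_subdegree by (simp add: pole_space_def)

lemma L_in: "a \<in> L m \<Longrightarrow> a \<in> A" by (simp add: pole_space_def)

lemma L_mult: "a \<in> L m \<Longrightarrow> b \<in> L m' \<Longrightarrow> a * b \<in> L (m + m')"
  using mult_pole_space[of a "m * N" b "m' * N"] by (simp add: algebra_simps)

lemma exists_L: "a \<in> A \<Longrightarrow> \<exists>m0. \<forall>m\<ge>m0. a \<in> L m"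
proof -
  assume "a \<in> A"
  then obtain d where d: "\<And>d'. d' \<ge> d \<Longrightarrow> a \<in> pole_space A d'" using in_pole_space by blast
  have "m \<le> m * N" for m using N_pos by simp
  then show ?thesis using d by (intro exI[of _ d]) (meson order_trans)
qed

lemma subdegree_g_power [simp]: "fls_subdegree (g ^ m) = - int (m * N)"
  by (simp add: fls_subdegree_pow g_subdegree)

lemma subdegree_divide_g: "a \<in> L m \<Longrightarrow> fls_subdegree (a / g ^ m) \<ge> 0"
  by (cases "a = 0") (auto simp: pole_space_def fls_divide_subdegree)

lemma ev_const [simp]: "P \<in> pts \<Longrightarrow> ev 0 P (fls_const c) = c"
  by (auto simp: points_def)

lemma ev_add: "P \<in> pts \<Longrightarrow> a \<in> L m \<Longrightarrow> b \<in> L m \<Longrightarrow> ev m P (a + b) = ev m P a + ev m P b"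
  by (auto simp: points_def add_divide_distrib point_add L_in)

lemma ev_zero [simp]: "P \<in> pts \<Longrightarrow> ev m P 0 = 0"
  by (auto simp: points_def)

lemma ev_mult:
  assumes "P \<in> pts" "a \<in> L m" "b \<in> L m'"
  shows "ev (m + m') P (a * b) = ev m P a * ev m' P b"
proof (cases P)
  case None
  have *: "a * b / g ^ (m + m') = (a / g ^ m) * (b / g ^ m')" by (simp add: power_add)
  show ?thesis
    unfolding None form_value_None *
    by (rule fls_nth_0_mult[OF subdegree_divide_g[OF assms(2)] subdegree_divide_g[OF assms(3)]])
next
  case (Some s)
  then show ?thesis using assms by (auto simp: points_def point_mult L_in)
qed

lemma ev_scale: "P \<in> pts \<Longrightarrow> a \<in> L m \<Longrightarrow> ev m P (fls_const c * a) = c * ev m P a"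
  using ev_mult[of P "fls_const c" 0 a m] by simp

lemma ev_diff:
  assumes "P \<in> pts" "a \<in> L m" "b \<in> L m"
  shows "ev m P (a - b) = ev m P a - ev m P b"
  using ev_add[OF assms(1) diff_pole_space[OF assms(2,3)] assms(3)] by simp

lemma ev_power:
  assumes "P \<in> pts" "a \<in> L m"
  shows "ev (j * m) P (a ^ j) = ev m P a ^ j"
proof (induction j)
  case 0
  then show ?case using ev_const[OF assms(1), of 1] by simp
next
  case (Suc j)
  have "a ^ j \<in> L (j * m)" using power_pole_space[OF assms(2), of j] by (simp add: algebra_simps)
  then show ?case using ev_mult[OF assms(1,2), of "a ^ j" "j * m"] Suc by simp
qed

lemma ev_None_nonzero_iff:
  assumes "a \<in> L m"
  shows "ev m None a \<noteq> 0 \<longleftrightarrow> a \<noteq> 0 \<and> fls_subdegree a = - int (m * N)"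
proof (cases "a = 0")
  case False
  let ?q = "a / g ^ m"
  have q: "?q \<noteq> 0" "fls_subdegree ?q \<ge> 0" "fls_subdegree ?q = fls_subdegree a + int (m * N)"
    using False subdegree_divide_g[OF assms] by (auto simp: fls_divide_subdegree)
  have "?q $$ 0 \<noteq> 0 \<longleftrightarrow> fls_subdegree ?q = 0"
    using q(1,2) by (metis fls_eq0_below_subdegree nth_fls_subdegree_nonzero order_le_less)
  then show ?thesis using False q(3) by auto
qed simp

lemma ev_finite:
  assumes "a \<in> L m" "a \<noteq> 0"
  shows "finite {P \<in> pts. ev m P a = 0}"
proof (rule finite_subset)
  show "{P \<in> pts. ev m P a = 0} \<subseteq> insert None (Some ` {s. is_point A s \<and> s a = 0})"
    by (auto simp: points_def)
  show "finite (insert None (Some ` {s. is_point A s \<and> s a = 0}))"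
    using finite_zeros[OF L_in[OF assms(1)] assms(2)] by simp
qed

lemma infinite_pts: "infinite pts"
  using infinite_points by (auto simp: points_def dest: finite_imageD)

text \<open>Infinity is separated from finite points in degree 1: the constant 1 vanishes there as a
  section of degree 1, and \<open>g - fls_const (s g)\<close> does not. Two finite points differ on
  some \<open>f\<close>, from which its value at one of them is subtracted.\<close>

lemma separate:
  assumes "P \<in> pts" "Q \<in> pts" "P \<noteq> Q"
  shows "\<exists>m. \<exists>a\<in>L m. ev m P a = 0 \<and> ev m Q a \<noteq> 0"
proof (cases P)
  case None
  then obtain s where "Q = Some s" "is_point A s" using assms by (auto simp: points_def)
  moreover have "ev 1 None 1 = 0" using ev_None_nonzero_iff[of 1 1] N_pos by auto
  ultimately show ?thesis using None by (intro exI[of _ 1] bexI[of _ 1]) auto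
next
  case P: (Some s)
  then have s: "is_point A s" using assms by (auto simp: points_def)
  show ?thesis
  proof (cases Q)
    case None
    have "s (g - fls_const (s g)) = 0" using s g_in by (simp add: point_diff)
    moreover have mem: "g - fls_const (s g) \<in> L 1" using g_pole_space by (intro diff_pole_space) auto
    moreover have "ev 1 None (fls_const (s g)) = 0"
      using ev_None_nonzero_iff[of "fls_const (s g)" 1] N_pos by auto
    then have "ev 1 None (g - fls_const (s g)) = 1"
      by (subst ev_diff) (use g_pole_space in \<open>auto simp: points_def\<close>)
    ultimately show ?thesis using P None by (intro exI[of _ 1] bexI[OF _ mem]) auto
  next
    case (Some s')
    then have s': "is_point A s'" using assms by (auto simp: points_def)
    have "s \<noteq> s'" using P Some assms(3) by simp
    then obtain f where f: "s f \<noteq> s' f" by blast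
    have fA: "f \<in> A"
    proof (rule ccontr)
      assume "f \<notin> A"
      then show False using f point_outside[OF s] point_outside[OF s'] by simp
    qed
    then obtain m where m: "f \<in> L m" using exists_L by blast
    then have "f - fls_const (s f) \<in> L m" by (intro diff_pole_space) auto
    then show ?thesis using P Some f fA s s'
      by (intro exI[of _ m] bexI[of _ "f - fls_const (s f)"]) (auto simp: point_diff)
  qed
qed

subsection \<open>Forms and elements of the algebra\<close>

text \<open>Forms are compared with elements of \<open>A\<close> on the chosen coordinate vectors
  \<open>crd P\<close>; another vector of the same projective point introduces a power of the
  scalar.\<close>

definition represents :: "nat \<Rightarrow> 'k mpoly \<Rightarrow> 'k fls \<Rightarrow> bool" where
  "represents m F a \<longleftrightarrow> homogeneous m F \<and> a \<in> L m \<and> (\<forall>P\<in>pts. mpoly_eval F (crd P) = ev m P a)"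

lemma represents_add: "represents m F a \<Longrightarrow> represents m G b \<Longrightarrow> represents m (F + G) (a + b)"
  by (auto simp: represents_def homogeneous_add add_pole_space mpoly_eval_add ev_add)

lemma represents_mult: "represents m F a \<Longrightarrow> represents m' G b \<Longrightarrow> represents (m + m') (F * G) (a * b)"
  by (auto simp: represents_def homogeneous_mult L_mult mpoly_eval_mult ev_mult)

lemma represents_const: "represents 0 (Poly_Mapping.single 0 c) (fls_const c)"
  by (auto simp: represents_def homogeneous_const)

lemma represents_scale: "represents m F a \<Longrightarrow> represents m (Poly_Mapping.single 0 c * F) (fls_const c * a)"
  using represents_mult[OF represents_const, of m F a c] by simp

lemma represents_zero: "represents m 0 0"
  by (auto simp: represents_def)

lemma represents_variable: "represents 1 (Poly_Mapping.single (Poly_Mapping.single i 1) 1) (gs i)"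
  unfolding represents_def mpoly_eval_variable using gs_in[of i] by (intro conjI homogeneous_variable) auto

lemma represents_sum:
  "(\<And>i. i \<in> I \<Longrightarrow> represents m (F i) (a i)) \<Longrightarrow> represents m (sum F I) (sum a I)"
  by (induction I rule: infinite_finite_induct) (auto intro: represents_zero represents_add)

lemma monomial_represents:
  "\<exists>a. represents (\<Sum>i\<in>Poly_Mapping.keys m. Poly_Mapping.lookup m i) (Poly_Mapping.single m c) a"
proof (induction "\<Sum>i\<in>Poly_Mapping.keys m. Poly_Mapping.lookup m i" arbitrary: m)
  case 0
  have "m = 0"
  proof (rule ccontr)
    assume "m \<noteq> 0"
    then obtain i m' where "m = Poly_Mapping.single i 1 + m'"
      "(\<Sum>i\<in>Poly_Mapping.keys m. Poly_Mapping.lookup m i) = Suc (\<Sum>i\<in>Poly_Mapping.keys m'. Poly_Mapping.lookup m' i)"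
      by (rule monomial_split)
    then show False using 0 by simp
  qed
  then show ?case using represents_const by auto
next
  case (Suc d)
  then have "m \<noteq> 0" by auto
  then obtain i m' where m: "m = Poly_Mapping.single i 1 + m'"
    "(\<Sum>i\<in>Poly_Mapping.keys m. Poly_Mapping.lookup m i) = Suc (\<Sum>i\<in>Poly_Mapping.keys m'. Poly_Mapping.lookup m' i)"
    by (rule monomial_split)
  then obtain a where "represents d (Poly_Mapping.single m' c) a" using Suc by fastforce
  then have "represents (1 + d) (Poly_Mapping.single (Poly_Mapping.single i 1) 1 * Poly_Mapping.single m' c) (gs i * a)"
    by (intro represents_mult represents_variable)
  then show ?case using Suc(2) m(1) by (auto simp: mult_single)
qed

lemma form_represents:
  assumes "homogeneous m F"
  shows "\<exists>a. represents m F a"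
proof -
  have "\<forall>l\<in>Poly_Mapping.keys F. \<exists>a. represents m (Poly_Mapping.single l (Poly_Mapping.lookup F l)) a"
    using assms monomial_represents unfolding homogeneous_def by metis
  then obtain a where "\<And>l. l \<in> Poly_Mapping.keys F \<Longrightarrow> represents m (Poly_Mapping.single l (Poly_Mapping.lookup F l)) (a l)"
    by metis
  then have "represents m (\<Sum>l\<in>Poly_Mapping.keys F. Poly_Mapping.single l (Poly_Mapping.lookup F l)) (\<Sum>l\<in>Poly_Mapping.keys F. a l)"
    by (rule represents_sum)
  then show ?thesis using mpoly_sum_monomials[of F] by auto
qed

lemma represented_1:
  assumes "a \<in> L 1"
  shows "\<exists>F. represents 1 F a"
proof -
  obtain c where c: "a = (\<Sum>i\<le>n. fls_const (c i) * gs i)" using gs_span assms by auto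
  have "represents 1 (\<Sum>i\<le>n. Poly_Mapping.single 0 (c i) * Poly_Mapping.single (Poly_Mapping.single i 1) 1) a"
    unfolding c by (intro represents_sum represents_scale represents_variable)
  then show ?thesis by blast
qed

lemma represented_0:
  assumes "a \<in> L 0"
  shows "\<exists>F. represents 0 F a"
proof -
  have "fls_subdegree a = 0" "a \<in> A" using assms subdegree_le_0[of a] by (auto simp: pole_space_def)
  then have "a = fls_const (a $$ 0)" by (intro constant_if_no_pole)
  then show ?thesis using represents_const by metis
qed

text \<open>The pole order \<open>h\<close> of \<open>a\<close> is above \<open>m * N\<close> and at
  most \<open>Suc m * N\<close>. It is written as \<open>k + (h - k)\<close>, with \<open>k\<close>
  for degree 1 and \<open>h - k\<close> for degree \<open>m\<close>; both parts are kept at least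
  \<open>M\<close> so that they are pole orders.\<close>

lemma split_pole:
  assumes "a \<in> A" "a \<notin> L m" "a \<in> L (Suc m)" "m > 0"
  obtains b b' where "b \<in> L m" "b' \<in> L 1" "b \<noteq> 0" "b' \<noteq> 0" "fls_subdegree (b * b') = fls_subdegree a"
proof -
  define h where "h = nat (- fls_subdegree a)"
  have h: "int h = - fls_subdegree a" using assms subdegree_le_0[OF assms(1)] by (simp add: h_def)
  have "int (m * N) < int h" "int h \<le> int (Suc m * N)" using assms unfolding h by (auto simp: pole_space_def)
  then have h1: "h > m * N" "h \<le> Suc m * N" by (simp_all only: of_nat_less_iff of_nat_le_iff)
  have mN: "N \<le> m * N" using assms(4) by simp
  have "int e dvd int h" unfolding h using e_dvd_subdegree[OF assms(1)] by simp
  then have he: "e dvd h" by (simp only: int_dvd_int_iff)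
  have ex: "\<exists>b b'. b \<in> L m \<and> b' \<in> L 1 \<and> b \<noteq> 0 \<and> b' \<noteq> 0 \<and> fls_subdegree (b * b') = fls_subdegree a"
    if k: "k \<ge> M" "k \<le> N" "e dvd k" "h - k \<ge> M" "h - k \<le> m * N" "k \<le> h" for k
  proof -
    obtain b' where b': "b' \<in> A" "fls_subdegree b' = - int k" using M_poles k by blast
    obtain b where b: "b \<in> A" "fls_subdegree b = - int (h - k)" using M_poles k he by (meson dvd_diff_nat)
    have "b' \<noteq> 0" "b \<noteq> 0" using b b' k M_pos by auto
    moreover have "int (h - k) \<le> int (m * N)" using k by (simp only: of_nat_le_iff)
    then have "b \<in> L m" using b by (simp add: pole_space_def)
    moreover have "b' \<in> L 1" using b' k by (simp add: pole_space_def)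
    moreover have "int (h - k) = int h - int k" using k by (simp add: of_nat_diff)
    ultimately show ?thesis using b b' h by (intro exI conjI) (assumption+, simp)
  qed
  have "\<exists>b b'. b \<in> L m \<and> b' \<in> L 1 \<and> b \<noteq> 0 \<and> b' \<noteq> 0 \<and> fls_subdegree (b * b') = fls_subdegree a"
  \<comment> \<open>The part for degree 1 is \<open>N\<close> unless less than \<open>M\<close>
    would remain. In that case \<open>k = M\<close> works, because \<open>h\<close> exceeds
    \<open>N\<close> and \<open>N\<close> is at least \<open>2 * M\<close>.\<close>
  proof (cases "h \<ge> N + M")
    case True
    then show ?thesis using h1 N_large N_dvd by (intro ex[of N]) auto
  next
    case False
    then have "h - M \<ge> M" "h - M \<le> m * N" "M \<le> N" "M \<le> h" using h1 N_large mN by linarith+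
    then show ?thesis using M_dvd by (intro ex[of M]) auto
  qed
  then show thesis using that by blast
qed

text \<open>Projective normality by descent: a leading term not yet of degree \<open>m\<close> is
  that of a product of elements of degrees \<open>m\<close> and 1. An element already in
  \<open>L m\<close> is multiplied by a linear form that represents 1.\<close>

lemma represented_Suc:
  assumes IH: "\<And>a. a \<in> L m \<Longrightarrow> \<exists>F. represents m F a" and m: "m > 0" and a: "a \<in> A" "a \<in> L (Suc m)"
  shows "\<exists>F. represents (Suc m) F a"
  using a
proof (induction a rule: pole_descent)
  case zero
  show ?case using represents_zero by blast
next
  case (reduce a)
  show ?case
  proof (cases "a \<in> L m")
    case True
    then obtain F where "represents m F a" using IH by blast
    moreover obtain G where "represents 1 G 1" using represented_1[of 1] by auto
    ultimately have "represents (m + 1) (F * G) (a * 1)" by (rule represents_mult)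
    then show ?thesis by auto
  next
    case False
    then obtain b b' where b: "b \<in> L m" "b' \<in> L 1" "b \<noteq> 0" "b' \<noteq> 0" "fls_subdegree (b * b') = fls_subdegree a"
      using split_pole[OF reduce(1) False reduce.prems m] by blast
    obtain c where c: "a - fls_const c * (b * b') = 0 \<or> fls_subdegree (a - fls_const c * (b * b')) > fls_subdegree a"
      using fls_cancel_leading[of "b * b'" a] b reduce(2) by auto
    let ?r = "a - fls_const c * (b * b')"
    have bb: "b * b' \<in> L (m + 1)" using b L_mult by blast
    then have r: "?r \<in> L (Suc m)" using reduce.prems by (intro diff_pole_space scale_pole_space) auto
    then obtain R where R: "represents (Suc m) R ?r" using reduce.IH[of ?r] c L_in[OF r] by blast
    obtain F G where "represents m F b" "represents 1 G b'" using IH b represented_1 by blast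
    then have "represents (m + 1) (Poly_Mapping.single 0 c * (F * G)) (fls_const c * (b * b'))"
      by (intro represents_scale represents_mult)
    then have "represents (Suc m) (R + Poly_Mapping.single 0 c * (F * G)) (?r + fls_const c * (b * b'))"
      using R by (intro represents_add) auto
    then show ?thesis by auto
  qed
qed

lemma element_represented: "a \<in> L m \<Longrightarrow> \<exists>F. represents m F a"
proof (induction m arbitrary: a)
  case 0
  then show ?case by (rule represented_0)
next
  case (Suc m)
  show ?case
  proof (cases "m = 0")
    case True
    then show ?thesis using represented_1 Suc.prems by simp
  next
    case False
    then show ?thesis using represented_Suc[OF Suc.IH] Suc.prems L_in by blast
  qed
qed

subsection \<open>The image is closed\<close>

lemma phi_members:
  "x \<in> phi P \<longleftrightarrow> (\<exists>c. c \<noteq> 0 \<and> x = (\<lambda>i. c * crd P i))"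
  by (auto simp: curve_point_def ppoint_def)

text \<open>One scalar \<open>c\<close> serves all forms at once, as quotients of forms
  require.\<close>

lemma represents_eval:
  assumes "represents m F a" "P \<in> pts" "x \<in> phi P"
  shows "\<exists>c. c \<noteq> 0 \<and> (\<forall>m F a. represents m F a \<longrightarrow> mpoly_eval F x = c ^ m * ev m P a)"
proof -
  obtain c where "c \<noteq> 0" "x = (\<lambda>i. c * crd P i)" using assms phi_members by blast
  then show ?thesis using assms(2) by (intro exI[of _ c]) (auto simp: represents_def homogeneous_scale)
qed

lemma represents_vanish_iff:
  assumes "represents m F a" "P \<in> pts" "x \<in> phi P"
  shows "mpoly_eval F x = 0 \<longleftrightarrow> ev m P a = 0"
  using represents_eval[OF assms] assms(1) by auto

lemma crd_mem: "crd P \<in> phi P"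
  unfolding phi_members by (intro exI[of _ 1]) simp

lemma ev_1_nonzero:
  assumes "P \<in> pts" shows "\<exists>a\<in>L 1. ev 1 P a \<noteq> 0"
proof (cases P)
  case None
  have "ev 1 None g \<noteq> 0" using ev_None_nonzero_iff[of g 1] g_subdegree by simp
  then show ?thesis using None g_pole_space by blast
next
  case (Some s)
  then show ?thesis using assms by (intro bexI[of _ 1]) (auto simp: points_def)
qed

lemma crd_nonzero: assumes "P \<in> pts" shows "crd P \<noteq> (\<lambda>_. 0)"
proof
  assume 0: "crd P = (\<lambda>_. 0)"
  obtain a where a: "a \<in> L 1" "ev 1 P a \<noteq> 0" using ev_1_nonzero assms by blast
  obtain c where c: "a = (\<Sum>i\<le>n. fls_const (c i) * gs i)" using gs_span a by auto
  have "gs i \<in> L 1" for i using gs_in by simp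
  then have "ev 1 P (\<Sum>i\<in>I. fls_const (c i) * gs i) = 0" for I
  proof (induction I rule: infinite_finite_induct)
    case (insert j I)
    have "(\<Sum>i\<in>I. fls_const (c i) * gs i) \<in> L 1" using insert.prems by (intro sum_pole_space scale_pole_space)
    then show ?case using insert fun_cong[OF 0, of j] assms by (simp add: ev_add scale_pole_space ev_scale)
  qed (use assms in auto)
  then show False using a c by simp
qed

lemma phi_proj_space: "P \<in> pts \<Longrightarrow> phi P \<in> proj_space n"
  using crd_nonzero[of P] gs_out unfolding proj_space_def curve_point_def by (intro imageI) auto

lemma phi_inj: "inj_on phi pts"
proof (rule inj_onI, rule ccontr)
  fix P Q assume PQ: "P \<in> pts" "Q \<in> pts" "phi P = phi Q" "P \<noteq> Q"
  then obtain m a where a: "a \<in> L m" "ev m P a = 0" "ev m Q a \<noteq> 0" using separate by blast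
  obtain F where F: "represents m F a" using element_represented a by blast
  have "crd P \<in> phi Q" using crd_mem PQ by metis
  then show False using represents_vanish_iff[OF F PQ(1) crd_mem] represents_vanish_iff[OF F PQ(2)] a by blast
qed

definition carrier_set :: "'k ppoint set" where
  "carrier_set = phi ` pts"

text \<open>The homogeneous ideal of the curve, spanned by its forms of each degree.\<close>

definition relations :: "'k mpoly set" where
  "relations = {F. \<exists>m. represents m F 0}"

section \<open>Vectors at which all relations vanish\<close>

context
  fixes x :: "nat \<Rightarrow> 'k"
  assumes x0: "x \<noteq> (\<lambda>_. 0)" and xn: "\<And>i. i > n \<Longrightarrow> x i = 0"
    and rel: "\<And>F. F \<in> relations \<Longrightarrow> mpoly_eval F x = 0"
begin

text \<open>Evaluation at \<open>x\<close>, transported from forms to elements of \<open>A\<close>.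
  It is independent of the form, since two forms for one element differ by a relation.\<close>

definition "chi m a = mpoly_eval (SOME F. represents m F a) x"

lemma chi: assumes "represents m F a" shows "mpoly_eval F x = chi m a"
proof -
  let ?G = "SOME F. represents m F a"
  have G: "represents m ?G a" using assms by (rule someI)
  have "represents m (F + Poly_Mapping.single 0 (-1) * ?G) (a + fls_const (-1) * a)"
    using assms G by (intro represents_add represents_scale)
  then have "F + Poly_Mapping.single 0 (-1) * ?G \<in> relations" by (auto simp: relations_def)
  then show ?thesis using rel by (fastforce simp: mpoly_eval_add mpoly_eval_mult chi_def)
qed

lemma chi_add: "a \<in> L m \<Longrightarrow> b \<in> L m \<Longrightarrow> chi m (a + b) = chi m a + chi m b"
  using element_represented chi represents_add mpoly_eval_add by metis

lemma chi_mult: "a \<in> L m \<Longrightarrow> b \<in> L m' \<Longrightarrow> chi (m + m') (a * b) = chi m a * chi m' b"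
  using element_represented chi represents_mult mpoly_eval_mult by metis

lemma chi_const: "chi 0 (fls_const c) = c"
  using chi[OF represents_const] by simp

lemma chi_scale: "a \<in> L m \<Longrightarrow> chi m (fls_const c * a) = c * chi m a"
  using chi_mult[of "fls_const c" 0 a m] chi_const by simp

lemma chi_coordinate: "chi 1 (gs i) = x i"
  using chi[OF represents_variable[of i]] mpoly_eval_variable[of i x] by metis

lemma chi_power: "a \<in> L 1 \<Longrightarrow> chi j (a ^ j) = chi 1 a ^ j"
proof (induction j)
  case 0
  then show ?case using chi_const[of 1] by simp
next
  case (Suc j)
  have "a ^ j \<in> L j" using power_pole_space[of a N j] Suc.prems by simp
  then show ?case using chi_mult[of a 1 "a ^ j" j] Suc by simp
qed

text \<open>\<open>chi 1 1\<close> is the coordinate whose zeros are the hyperplane at infinity. Off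
  it, the quotient of \<open>chi m a\<close> by its \<open>m\<close>-th power is independent of
  \<open>m\<close> and defines the homomorphism \<open>s\<close> that is mapped to
  \<open>x\<close>.\<close>

lemma affine_case:
  assumes w: "chi 1 1 \<noteq> 0"
  shows "\<exists>P\<in>pts. ppoint x = phi P"
proof -
  let ?w = "chi 1 1"
  have shift: "chi (m + j) a = chi m a * ?w ^ j" if "a \<in> L m" for a m j
    using chi_mult[OF that, of 1 j] chi_power[of 1 j] by simp
  define s where "s a = (if a \<in> A then (let m = SOME m. a \<in> L m in chi m a / ?w ^ m) else 0)" for a
  have s: "s a = chi m a / ?w ^ m" if "a \<in> L m" for a m
  proof -
    let ?m = "SOME m. a \<in> L m"
    have "a \<in> L ?m" using that by (rule someI)
    then have "chi ?m a * ?w ^ m = chi m a * ?w ^ ?m"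
      using shift[of a ?m m] shift[OF that, of ?m] by (simp add: add.commute)
    then show ?thesis using L_in[OF that] w by (simp add: s_def Let_def frac_eq_eq)
  qed
  have "is_point A s"
    unfolding is_point_def
  proof (intro conjI allI ballI impI)
    fix c show "s (fls_const c) = c" using s[of "fls_const c" 0] chi_const by simp
  next
    fix a b assume ab: "a \<in> A" "b \<in> A"
    then obtain m1 m2 where "\<forall>m\<ge>m1. a \<in> L m" "\<forall>m\<ge>m2. b \<in> L m" using exists_L by meson
    then have m: "a \<in> L (max m1 m2)" "b \<in> L (max m1 m2)" by auto
    let ?m = "max m1 m2"
    show "s (a + b) = s a + s b"
      using m s[OF m(1)] s[OF m(2)] s[OF add_pole_space[OF m]] by (simp add: chi_add add_divide_distrib)
    show "s (a * b) = s a * s b"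
      using s[OF m(1)] s[OF m(2)] s[OF L_mult[OF m]] chi_mult[OF m] by (simp add: power_add)
  qed (simp add: s_def)
  moreover have "x i = ?w * s (gs i)" for i
    using s[of "gs i" 1] gs_in[of i] w chi_coordinate[of i] by simp
  then have "ppoint x = phi (Some s)"
  proof -
    assume x: "\<And>i. x i = ?w * s (gs i)"
    have "y \<in> ppoint x \<longleftrightarrow> y \<in> phi (Some s)" for y
    proof
      assume "y \<in> ppoint x"
      then obtain c where "c \<noteq> 0" "y = (\<lambda>i. c * x i)" by (auto simp: ppoint_def)
      then show "y \<in> phi (Some s)" unfolding phi_members
        using w by (intro exI[of _ "c * ?w"]) (auto simp: x algebra_simps)
    next
      assume "y \<in> phi (Some s)"
      then obtain c where "c \<noteq> 0" "y = (\<lambda>i. c * s (gs i))" by (auto simp: phi_members)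
      then show "y \<in> ppoint x" unfolding ppoint_def mem_Collect_eq
        using w by (intro exI[of _ "c / ?w"]) (auto simp: x fun_eq_iff)
    qed
    then show ?thesis by blast
  qed
  ultimately show ?thesis by (intro bexI[of _ "Some s"]) (auto simp: points_def)
qed

text \<open>On the hyperplane at infinity, an \<open>a\<close> of pole order below \<open>N\<close>
  has value 0 in degree 1: \<open>a ^ N\<close> already lies in \<open>L (N - 1)\<close>, so in
  degree \<open>N\<close> it carries a factor \<open>chi 1 1\<close>. Only the coefficient relative
  to \<open>g\<close> survives, and \<open>x\<close> is proportional to the vector of these
  coefficients.\<close>

lemma infinite_case:
  assumes w: "chi 1 1 = 0"
  shows "\<exists>P\<in>pts. ppoint x = phi P"
proof -
  have low: "chi 1 a = 0" if a: "a \<in> A" "a = 0 \<or> - fls_subdegree a < int N" for a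
  proof -
    have aL: "a \<in> L 1" using a by (auto simp: pole_space_def)
    have "- fls_subdegree a \<le> int (N - 1)" using a N_pos by auto
    then have "a ^ N \<in> pole_space A (N * (N - 1))" using a by (intro power_pole_space) (auto simp: pole_space_def)
    then have aN: "a ^ N \<in> L (N - 1)" by (simp add: mult.commute)
    have "chi 1 a ^ N = chi N (a ^ N)" using chi_power[OF aL] by simp
    also have "\<dots> = chi ((N - 1) + 1) (a ^ N * 1)" using N_pos by simp
    also have "\<dots> = chi (N - 1) (a ^ N) * chi 1 1" by (rule chi_mult[OF aN one_pole_space])
    also have "\<dots> = 0" by (simp only: w mult_zero_right)
    finally show ?thesis using N_pos by simp
  qed
  have x: "x i = chi 1 g * crd None i" for i
  proof -
    let ?c = "crd None i"
    have gi: "gs i \<in> L 1" using gs_in by simp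
    have r: "gs i - fls_const ?c * g \<in> L 1" using gi g_pole_space by (intro diff_pole_space scale_pole_space)
    have N: "None \<in> pts" by (simp add: points_def)
    have "ev 1 None (gs i - fls_const ?c * g) = 0"
      by (subst ev_diff[OF N gi scale_pole_space[OF g_pole_space]], subst ev_scale[OF N g_pole_space]) simp
    then have "gs i - fls_const ?c * g = 0 \<or> - fls_subdegree (gs i - fls_const ?c * g) < int N"
      using ev_None_nonzero_iff[OF r] r by (auto simp: pole_space_def)
    then have 0: "chi 1 (gs i - fls_const ?c * g) = 0" using low L_in[OF r] by blast
    have "chi 1 ((gs i - fls_const ?c * g) + fls_const ?c * g) = 0 + ?c * chi 1 g"
      by (subst chi_add[OF r scale_pole_space[OF g_pole_space]], subst chi_scale[OF g_pole_space]) (simp only: 0)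
    then show ?thesis using chi_coordinate[of i] by (simp add: mult.commute)
  qed
  have w': "chi 1 g \<noteq> 0" using x x0 by auto
  have "y \<in> ppoint x \<longleftrightarrow> y \<in> phi None" for y
  proof
    assume "y \<in> ppoint x"
    then obtain c where "c \<noteq> 0" "y = (\<lambda>i. c * x i)" by (auto simp: ppoint_def)
    then show "y \<in> phi None" unfolding phi_members
      using w' by (intro exI[of _ "c * chi 1 g"]) (auto simp: x algebra_simps)
  next
    assume "y \<in> phi None"
    then obtain c where "c \<noteq> 0" "y = (\<lambda>i. c * crd None i)" unfolding phi_members by blast
    then show "y \<in> ppoint x" unfolding ppoint_def mem_Collect_eq
      using w' by (intro exI[of _ "c / chi 1 g"]) (simp only: x, auto simp: fun_eq_iff)
  qed
  then show ?thesis by (intro bexI[of _ None]) (auto simp: points_def)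
qed

end

lemma zero_locus_relations: "zero_locus n relations = carrier_set"
proof
  show "carrier_set \<subseteq> zero_locus n relations"
  proof
    fix Q assume "Q \<in> carrier_set"
    then obtain P where P: "P \<in> pts" "Q = phi P" by (auto simp: carrier_set_def)
    then show "Q \<in> zero_locus n relations"
      using phi_proj_space represents_vanish_iff unfolding zero_locus_def relations_def
      by (auto simp: represents_vanish_iff)
  qed
  show "zero_locus n relations \<subseteq> carrier_set"
  proof
    fix Q assume Q: "Q \<in> zero_locus n relations"
    then obtain x where x: "x \<noteq> (\<lambda>_. 0)" "\<And>i. i > n \<Longrightarrow> x i = 0" "Q = ppoint x"
      by (auto simp: zero_locus_def proj_space_def)
    have "x \<in> ppoint x" by (auto simp: ppoint_def intro!: exI[of _ 1])
    then have rel: "\<And>F. F \<in> relations \<Longrightarrow> mpoly_eval F x = 0" using Q x(3) by (auto simp: zero_locus_def)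
    have "\<exists>P\<in>pts. ppoint x = phi P"
      using affine_case[OF x(1,2) rel] infinite_case[OF x(1,2) rel] by blast
    then show "Q \<in> carrier_set" using x(3) by (auto simp: carrier_set_def)
  qed
qed

section \<open>The cofinite Zariski topology of the embedded curve\<close>

definition X :: "'k ppoint topology" where
  "X = subtopology (zariski n) carrier_set"

lemma carrier_set_subset: "carrier_set \<subseteq> proj_space n"
  using phi_proj_space by (auto simp: carrier_set_def)

lemma closedin_carrier_set: "closedin (zariski n) carrier_set"
proof -
  have "zariski_open n (proj_space n - carrier_set)"
    unfolding zariski_open_def
  proof (intro exI[of _ relations] conjI)
    show "\<forall>p\<in>relations. \<exists>d. homogeneous d p" by (auto simp: relations_def represents_def)
  qed (simp only: zero_locus_relations)
  then show ?thesis using carrier_set_subset by (simp add: closedin_def)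
qed

text \<open>A form that represents a nonzero element has finitely many zeros on the curve, so
  nonempty open sets are cofinite. Conversely, points are closed because forms separate
  them.\<close>

lemma openin_X_iff:
  "openin X U \<longleftrightarrow> U = {} \<or> (U \<subseteq> carrier_set \<and> finite (carrier_set - U))"
proof
  assume "openin X U"
  then obtain T where T: "\<forall>F\<in>T. \<exists>d. homogeneous d F" "U = (proj_space n - zero_locus n T) \<inter> carrier_set"
    unfolding X_def openin_subtopology openin_zariski zariski_open_def by auto
  show "U = {} \<or> (U \<subseteq> carrier_set \<and> finite (carrier_set - U))"
  proof (cases "U = {}")
    case False
    then obtain P where P: "P \<in> pts" "phi P \<in> U" using T by (auto simp: carrier_set_def)
    then obtain F x where F: "F \<in> T" "x \<in> phi P" "mpoly_eval F x \<noteq> 0" using T(2) by (auto simp: zero_locus_def)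
    then obtain m a where a: "represents m F a" using T(1) form_represents by blast
    then have "ev m P a \<noteq> 0" using represents_vanish_iff F P by blast
    then have "a \<noteq> 0" using P by auto
    moreover have "a \<in> L m" using a by (simp add: represents_def)
    ultimately have fin: "finite {P \<in> pts. ev m P a = 0}" using ev_finite by blast
    have "carrier_set - U \<subseteq> phi ` {P \<in> pts. ev m P a = 0}"
    proof
      fix Q assume Q: "Q \<in> carrier_set - U"
      then obtain P' where P': "P' \<in> pts" "Q = phi P'" by (auto simp: carrier_set_def)
      have "Q \<in> zero_locus n T" using Q T(2) carrier_set_subset by blast
      then have "mpoly_eval F (crd P') = 0" using F(1) P' crd_mem by (auto simp: zero_locus_def)
      then have "ev m P' a = 0" using represents_vanish_iff[OF a P'(1) crd_mem] by blast
      then show "Q \<in> phi ` {P \<in> pts. ev m P a = 0}" using P' by blast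
    qed
    then have "finite (carrier_set - U)" using fin finite_subset by blast
    then show ?thesis using T(2) by blast
  qed simp
next
  assume "U = {} \<or> (U \<subseteq> carrier_set \<and> finite (carrier_set - U))"
  moreover have "openin X U" if U: "U \<subseteq> carrier_set" "finite (carrier_set - U)"
  proof -
    have top: "topspace X = carrier_set" by (simp add: X_def Int_absorb1 carrier_set_subset)
    have "closedin X {phi P}" if P: "P \<in> pts" for P
    proof -
      let ?T = "{F. \<exists>m a. represents m F a \<and> ev m P a = 0}"
      have "zariski_open n (proj_space n - zero_locus n ?T)"
        unfolding zariski_open_def by (intro exI[of _ ?T]) (auto simp: represents_def)
      moreover have "carrier_set - {phi P} = (proj_space n - zero_locus n ?T) \<inter> carrier_set"
      proof (rule equalityI; rule subsetI)
        fix Q assume Q: "Q \<in> carrier_set - {phi P}"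
        then obtain P' where P': "P' \<in> pts" "Q = phi P'" "P \<noteq> P'" by (auto simp: carrier_set_def)
        then obtain m a where a: "a \<in> L m" "ev m P a = 0" "ev m P' a \<noteq> 0" using separate P by blast
        obtain F where F: "represents m F a" using element_represented a by blast
        then have "mpoly_eval F (crd P') \<noteq> 0" using represents_vanish_iff[OF F P'(1) crd_mem] a by blast
        moreover have "F \<in> ?T" using F a by blast
        ultimately have "Q \<notin> zero_locus n ?T" using crd_mem[of P'] P'(2) unfolding zero_locus_def by blast
        then show "Q \<in> (proj_space n - zero_locus n ?T) \<inter> carrier_set" using Q carrier_set_subset by blast
      next
        fix Q assume Q: "Q \<in> (proj_space n - zero_locus n ?T) \<inter> carrier_set"
        have "phi P \<in> zero_locus n ?T"
          unfolding zero_locus_def using phi_proj_space[OF P] represents_vanish_iff[OF _ P] by blast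
        then show "Q \<in> carrier_set - {phi P}" using Q by blast
      qed
      ultimately have "openin X (carrier_set - {phi P})"
        unfolding X_def openin_subtopology by auto
      then show ?thesis using P top by (auto simp: closedin_def carrier_set_def)
    qed
    then have "closedin X (\<Union>((\<lambda>Q. {Q}) ` (carrier_set - U)))"
      using U(2) by (intro closedin_Union) (auto simp: carrier_set_def)
    then have "closedin X (carrier_set - U)" by simp
    moreover have "carrier_set - (carrier_set - U) = U" using U(1) by blast
    ultimately show ?thesis using top by (metis closedin_def)
  qed
  ultimately show "openin X U" by auto
qed

lemma infinite_carrier_set: "infinite carrier_set"
  using infinite_pts phi_inj by (auto simp: carrier_set_def dest: finite_imageD)

lemmas X_topology = cofinite_topology_curve[OF openin_X_iff infinite_carrier_set]

end

context embedded_curve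
begin

section \<open>Local rings and valuations\<close>

text \<open>Membership in the local ring at \<open>P\<close> and the value there are recorded
  together. Numerator and denominator have the same degree \<open>m\<close>, so finite points and
  infinity are treated alike.\<close>

definition local_quotient :: "('k fls \<Rightarrow> 'k) option \<Rightarrow> 'k fls \<Rightarrow> 'k \<Rightarrow> bool" where
  "local_quotient P q c \<longleftrightarrow> (\<exists>m a b. a \<in> L m \<and> b \<in> L m \<and> ev m P b \<noteq> 0 \<and> q = a / b \<and> c = ev m P a / ev m P b)"

definition place_ring :: "('k fls \<Rightarrow> 'k) option \<Rightarrow> 'k fls set" where
  "place_ring P = {q. \<exists>c. local_quotient P q c}"

definition val :: "('k fls \<Rightarrow> 'k) option \<Rightarrow> 'k fls \<Rightarrow> 'k" where
  "val P q = (THE c. local_quotient P q c)"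

abbreviation "O\<^sub>v \<equiv> place_ring"
abbreviation "K \<equiv> fractions A"

lemma local_quotient_unique:
  assumes P: "P \<in> pts" and "local_quotient P q c" "local_quotient P q d"
  shows "c = d"
proof -
  obtain m a b where 1: "a \<in> L m" "b \<in> L m" "ev m P b \<noteq> 0" "q = a / b" "c = ev m P a / ev m P b"
    using assms by (auto simp: local_quotient_def)
  obtain m' a' b' where 2: "a' \<in> L m'" "b' \<in> L m'" "ev m' P b' \<noteq> 0" "q = a' / b'" "d = ev m' P a' / ev m' P b'"
    using assms by (auto simp: local_quotient_def)
  have "b \<noteq> 0" "b' \<noteq> 0" using 1 2 P by auto
  then have "a * b' = b * a'" using 1(4) 2(4) by (simp add: field_simps)
  then have "ev m P a * ev m' P b' = ev m P b * ev m' P a'"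
    using ev_mult[OF P 1(1) 2(2)] ev_mult[OF P 1(2) 2(1)] by simp
  then have "ev m P a / ev m P b = ev m' P a' / ev m' P b'" using 1(3) 2(3) by (simp add: frac_eq_eq mult.commute)
  then show ?thesis using 1(5) 2(5) by simp
qed

lemma val_eq: "P \<in> pts \<Longrightarrow> local_quotient P q c \<Longrightarrow> val P q = c"
  unfolding val_def using local_quotient_unique by blast

lemma place_ring_val: "P \<in> pts \<Longrightarrow> q \<in> O\<^sub>v P \<Longrightarrow> local_quotient P q (val P q)"
  using val_eq by (auto simp: place_ring_def)

lemma local_quotient_in: "local_quotient P q c \<Longrightarrow> q \<in> O\<^sub>v P"
  by (auto simp: place_ring_def)

lemma local_quotientI:
  "a \<in> L m \<Longrightarrow> b \<in> L m \<Longrightarrow> ev m P b \<noteq> 0 \<Longrightarrow> local_quotient P (a / b) (ev m P a / ev m P b)"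
  unfolding local_quotient_def by blast

lemma local_quotient_add:
  assumes P: "P \<in> pts" and "local_quotient P q c" "local_quotient P r d"
  shows "local_quotient P (q + r) (c + d)" "local_quotient P (q * r) (c * d)"
proof -
  obtain m a b where 1: "a \<in> L m" "b \<in> L m" "ev m P b \<noteq> 0" "q = a / b" "c = ev m P a / ev m P b"
    using assms by (auto simp: local_quotient_def)
  obtain m' a' b' where 2: "a' \<in> L m'" "b' \<in> L m'" "ev m' P b' \<noteq> 0" "r = a' / b'" "d = ev m' P a' / ev m' P b'"
    using assms by (auto simp: local_quotient_def)
  have "b \<noteq> 0" "b' \<noteq> 0" using 1 2 P by auto
  then have eq: "q + r = (a * b' + b * a') / (b * b')"
    using 1(4) 2(4) by (simp add: field_simps)
  have eq': "q * r = (a * a') / (b * b')" using 1(4) 2(4) by simp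
  note L = L_mult[OF 1(1) 2(2)] L_mult[OF 1(2) 2(1)] L_mult[OF 1(2) 2(2)] L_mult[OF 1(1) 2(1)]
  have nz: "ev (m + m') P (b * b') \<noteq> 0" using ev_mult[OF P 1(2) 2(2)] 1(3) 2(3) by simp
  have "ev (m + m') P (a * b' + b * a') / ev (m + m') P (b * b') = c + d"
    unfolding ev_add[OF P L(1,2)] ev_mult[OF P 1(1) 2(2)] ev_mult[OF P 1(2) 2(1)] ev_mult[OF P 1(2) 2(2)]
    using 1(3) 2(3) unfolding 1(5) 2(5) by (simp add: add_frac_eq mult.commute)
  then show "local_quotient P (q + r) (c + d)"
    unfolding eq using local_quotientI[OF add_pole_space[OF L(1,2)] L(3) nz] by simp
  have "ev (m + m') P (a * a') / ev (m + m') P (b * b') = c * d"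
    unfolding ev_mult[OF P 1(1) 2(1)] ev_mult[OF P 1(2) 2(2)] using 1(5) 2(5) by simp
  then show "local_quotient P (q * r) (c * d)"
    unfolding eq' using local_quotientI[OF L(4) L(3) nz] by simp
qed

lemma local_quotient_const: "P \<in> pts \<Longrightarrow> local_quotient P (fls_const c) c"
  using local_quotientI[of "fls_const c" 0 1 P] ev_const[of P 1] ev_const[of P c] by simp

lemma local_quotient_inverse:
  assumes "P \<in> pts" "local_quotient P q c" "c \<noteq> 0"
  shows "local_quotient P (inverse q) (inverse c)"
proof -
  obtain m a b where 1: "a \<in> L m" "b \<in> L m" "ev m P b \<noteq> 0" "q = a / b" "c = ev m P a / ev m P b"
    using assms by (auto simp: local_quotient_def)
  then have "local_quotient P (b / a) (ev m P b / ev m P a)" using assms(3) by (intro local_quotientI) auto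
  then show ?thesis using 1 by simp
qed

context
  fixes P assumes P: "P \<in> pts"
begin

lemma place_const [simp]: "fls_const c \<in> O\<^sub>v P" and val_const [simp]: "val P (fls_const c) = c"
  using local_quotient_const[OF P] local_quotient_in val_eq[OF P] by blast+

lemma place_0 [simp]: "0 \<in> O\<^sub>v P" and val_0 [simp]: "val P 0 = 0"
  and place_1 [simp]: "1 \<in> O\<^sub>v P" and val_1 [simp]: "val P 1 = 1"
  using place_const[of 0] val_const[of 0] place_const[of 1] val_const[of 1] by simp_all

lemma place_add: "q \<in> O\<^sub>v P \<Longrightarrow> r \<in> O\<^sub>v P \<Longrightarrow> q + r \<in> O\<^sub>v P"
  and val_add: "q \<in> O\<^sub>v P \<Longrightarrow> r \<in> O\<^sub>v P \<Longrightarrow> val P (q + r) = val P q + val P r"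
  and place_mult: "q \<in> O\<^sub>v P \<Longrightarrow> r \<in> O\<^sub>v P \<Longrightarrow> q * r \<in> O\<^sub>v P"
  and val_mult: "q \<in> O\<^sub>v P \<Longrightarrow> r \<in> O\<^sub>v P \<Longrightarrow> val P (q * r) = val P q * val P r"
  using local_quotient_add[OF P place_ring_val[OF P] place_ring_val[OF P]] local_quotient_in val_eq[OF P] by blast+

lemma place_inverse: "q \<in> O\<^sub>v P \<Longrightarrow> val P q \<noteq> 0 \<Longrightarrow> inverse q \<in> O\<^sub>v P"
  and val_inverse: "q \<in> O\<^sub>v P \<Longrightarrow> val P q \<noteq> 0 \<Longrightarrow> val P (inverse q) = inverse (val P q)"
  using local_quotient_inverse[OF P place_ring_val[OF P]] local_quotient_in val_eq[OF P] by blast+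

lemma place_power: "q \<in> O\<^sub>v P \<Longrightarrow> q ^ j \<in> O\<^sub>v P" and val_power: "q \<in> O\<^sub>v P \<Longrightarrow> val P (q ^ j) = val P q ^ j"
proof -
  assume q: "q \<in> O\<^sub>v P"
  show *: "q ^ j \<in> O\<^sub>v P" for j by (induction j) (auto intro: place_mult q)
  show "val P (q ^ j) = val P q ^ j" by (induction j) (auto simp: val_mult q *)
qed

lemma place_powi:
  assumes "q \<in> O\<^sub>v P" "val P q \<noteq> 0"
  shows "q powi k \<in> O\<^sub>v P" "val P (q powi k) \<noteq> 0"
proof -
  have "q powi k \<in> O\<^sub>v P \<and> val P (q powi k) \<noteq> 0"
  proof (cases "k \<ge> 0")
    case True
    then show ?thesis using assms by (simp add: power_int_def place_power val_power)
  next
    case False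
    then show ?thesis using place_inverse[OF assms] val_inverse[OF assms] assms
      by (simp add: power_int_def place_power val_power)
  qed
  then show "q powi k \<in> O\<^sub>v P" "val P (q powi k) \<noteq> 0" by blast+
qed

lemma place_fractions: "q \<in> O\<^sub>v P \<Longrightarrow> q \<in> K"
  using P by (auto simp: place_ring_def local_quotient_def intro!: fractionsI L_in)

end

lemma fraction_common_degree:
  assumes "q \<in> K"
  obtains m a b where "a \<in> L m" "b \<in> L m" "b \<noteq> 0" "q = a / b"
proof -
  obtain a b where ab: "a \<in> A" "b \<in> A" "b \<noteq> 0" "q = a / b" using assms by (rule fractionsE)
  obtain m1 m2 where "\<forall>m\<ge>m1. a \<in> L m" "\<forall>m\<ge>m2. b \<in> L m" using exists_L[OF ab(1)] exists_L[OF ab(2)] by blast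
  then have "a \<in> L (max m1 m2)" "b \<in> L (max m1 m2)" by auto
  then show thesis using that ab by blast
qed

lemma finite_poles:
  assumes "q \<in> K" shows "finite {P \<in> pts. q \<notin> O\<^sub>v P}"
proof -
  obtain m a b where ab: "a \<in> L m" "b \<in> L m" "b \<noteq> 0" "q = a / b" using assms by (rule fraction_common_degree)
  have "{P \<in> pts. q \<notin> O\<^sub>v P} \<subseteq> {P \<in> pts. ev m P b = 0}"
    using local_quotientI[OF ab(1,2)] local_quotient_in ab(4) by blast
  then show ?thesis using ev_finite[OF ab(2,3)] finite_subset by blast
qed

lemma finite_val_zeros:
  assumes "q \<in> K" "q \<noteq> 0" shows "finite {P \<in> pts. val P q = 0}"
proof -
  obtain m a b where ab: "a \<in> L m" "b \<in> L m" "b \<noteq> 0" "q = a / b" using assms(1) by (rule fraction_common_degree)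
  have "a \<noteq> 0" using ab assms by auto
  have "{P \<in> pts. val P q = 0} \<subseteq> {P \<in> pts. ev m P a = 0} \<union> {P \<in> pts. ev m P b = 0}"
  proof
    fix P assume P: "P \<in> {P \<in> pts. val P q = 0}"
    show "P \<in> {P \<in> pts. ev m P a = 0} \<union> {P \<in> pts. ev m P b = 0}"
    proof (cases "ev m P b = 0")
      case False
      then have "val P q = ev m P a / ev m P b"
        using val_eq local_quotientI[OF ab(1,2)] ab(4) P by blast
      then show ?thesis using P False by auto
    qed (use P in auto)
  qed
  then show ?thesis using ev_finite[OF ab(1) \<open>a \<noteq> 0\<close>] ev_finite[OF ab(2,3)] finite_subset by blast
qed

lemma affine_place:
  assumes "is_point A s" "a \<in> A"
  shows "a \<in> O\<^sub>v (Some s)" "val (Some s) a = s a"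
proof -
  obtain m where "a \<in> L m" using exists_L assms by blast
  then have "local_quotient (Some s) (a / 1) (ev m (Some s) a / ev m (Some s) 1)"
    using assms by (intro local_quotientI) auto
  then have *: "local_quotient (Some s) a (s a)" using assms by simp
  have "Some s \<in> pts" using assms by (simp add: points_def)
  then show "a \<in> O\<^sub>v (Some s)" "val (Some s) a = s a" using * local_quotient_in val_eq by blast+
qed

lemma affine_place_quotient:
  assumes "is_point A s" "a \<in> A" "b \<in> A" "s b \<noteq> 0"
  shows "a / b \<in> O\<^sub>v (Some s)" "val (Some s) (a / b) = s a / s b"
proof -
  have P: "Some s \<in> pts" using assms by (simp add: points_def)
  note * = affine_place[OF assms(1,2)] affine_place[OF assms(1,3)]
  have "inverse b \<in> O\<^sub>v (Some s)" "val (Some s) (inverse b) = inverse (s b)"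
    using place_inverse[OF P *(3)] val_inverse[OF P *(3)] * assms(4) by simp_all
  then show "a / b \<in> O\<^sub>v (Some s)" "val (Some s) (a / b) = s a / s b"
    using place_mult[OF P *(1)] val_mult[OF P *(1)] * by (simp_all add: divide_inverse)
qed

lemma None_pts [simp]: "None \<in> pts" by (simp add: points_def)

text \<open>Both parts of a fraction are multiplied by some \<open>c\<close> that brings the pole
  order of the denominator to exactly \<open>m * N\<close>, where the value at infinity is nonzero.
  For a series without pole, the numerator then fits into \<open>L m\<close>.\<close>

lemma place_None_iff:
  assumes "q \<in> K"
  shows "q \<in> O\<^sub>v None \<longleftrightarrow> fls_subdegree q \<ge> 0"
proof
  assume "q \<in> O\<^sub>v None"
  then obtain m a b where ab: "a \<in> L m" "b \<in> L m" "ev m None b \<noteq> 0" "q = a / b"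
    by (auto simp: place_ring_def local_quotient_def)
  have b: "b \<noteq> 0" "fls_subdegree b = - int (m * N)" using ev_None_nonzero_iff[OF ab(2)] ab(3) by auto
  show "fls_subdegree q \<ge> 0"
  proof (cases "a = 0")
    case False
    then have "fls_subdegree q = fls_subdegree a - fls_subdegree b" using ab b by (simp add: fls_divide_subdegree)
    then show ?thesis using b ab(1) by (simp add: pole_space_def)
  qed (use ab in simp)
next
  assume q: "fls_subdegree q \<ge> 0"
  obtain a b where ab: "a \<in> A" "b \<in> A" "b \<noteq> 0" "q = a / b" using assms by (rule fractionsE)
  let ?d = "nat (- fls_subdegree b)"
  have d: "int ?d = - fls_subdegree b" using subdegree_le_0[OF ab(2)] by simp
  \<comment> \<open>With this \<open>m\<close>, \<open>m * N\<close> exceeds the pole order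
    \<open>?d\<close> of \<open>b\<close> by at least \<open>M\<close>, so the difference is a pole
    order.\<close>
  define m where "m = M + ?d"
  have "m * N \<ge> m * 1" using N_pos by (intro mult_le_mono) auto
  then have mN: "m * N \<ge> M + ?d" by (simp add: m_def)
  have "int e dvd int ?d" unfolding d using e_dvd_subdegree[OF ab(2)] by simp
  then have "e dvd ?d" by (simp only: int_dvd_int_iff)
  then have "e dvd m * N - ?d" using N_dvd by (intro dvd_diff_nat) auto
  moreover have "m * N - ?d \<ge> M" using mN by linarith
  ultimately obtain c where c: "c \<in> A" "fls_subdegree c = - int (m * N - ?d)" using M_poles by blast
  have c': "fls_subdegree c = - int (m * N) - fls_subdegree b" using c(2) mN d by (simp add: of_nat_diff)
  have "m * N - ?d > 0" using mN M_pos by simp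
  then have "fls_subdegree c \<noteq> 0" unfolding c(2) by linarith
  then have "c \<noteq> 0" by auto
  have bc: "b * c \<in> L m" "ev m None (b * c) \<noteq> 0"
  proof -
    show *: "b * c \<in> L m" using ab c c' \<open>c \<noteq> 0\<close> by (auto simp: pole_space_def intro: mult_in)
    show "ev m None (b * c) \<noteq> 0" using ev_None_nonzero_iff[OF *] ab c' \<open>c \<noteq> 0\<close> by simp
  qed
  have ac: "a * c \<in> L m"
  proof (cases "a = 0")
    case False
    then have "fls_subdegree a - fls_subdegree b \<ge> 0" using q ab by (simp add: fls_divide_subdegree)
    then show ?thesis using False ab c c' \<open>c \<noteq> 0\<close> by (auto simp: pole_space_def intro: mult_in)
  qed simp
  have "q = (a * c) / (b * c)" using ab \<open>c \<noteq> 0\<close> by simp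
  then show "q \<in> O\<^sub>v None" using local_quotientI[OF ac bc] local_quotient_in by metis
qed

lemma val_None:
  assumes "q \<in> O\<^sub>v None"
  shows "val None q = q $$ 0"
proof -
  obtain m a b where ab: "a \<in> L m" "b \<in> L m" "ev m None b \<noteq> 0" "q = a / b"
    "val None q = ev m None a / ev m None b"
    using place_ring_val[OF None_pts assms] by (auto simp: local_quotient_def)
  have b0: "b \<noteq> 0" using ab by auto
  have "q \<in> K" using place_fractions[OF None_pts assms] .
  then have "fls_subdegree q \<ge> 0" using place_None_iff assms by blast
  then have "(q * (b / g ^ m)) $$ 0 = q $$ 0 * (b / g ^ m) $$ 0"
    by (intro fls_nth_0_mult subdegree_divide_g[OF ab(2)])
  moreover have "q * (b / g ^ m) = a / g ^ m" using ab(4) b0 by simp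
  ultimately have "(a / g ^ m) $$ 0 = q $$ 0 * (b / g ^ m) $$ 0" by simp
  then show ?thesis using ab(3,5) by (simp add: field_simps)
qed

text \<open>Stated through the factorisation of all nonzero fractions, which provides the discrete
  valuation at once; the description by ideals is derived in \<open>max_ideal_eq\<close>.\<close>

definition uniformizer :: "('k fls \<Rightarrow> 'k) option \<Rightarrow> 'k fls \<Rightarrow> bool" where
  "uniformizer P t \<longleftrightarrow> t \<in> O\<^sub>v P \<and> t \<noteq> 0 \<and> val P t = 0 \<and>
     (\<forall>q\<in>K. q \<noteq> 0 \<longrightarrow> (\<exists>k. \<exists>u\<in>O\<^sub>v P. val P u \<noteq> 0 \<and> q = t powi k * u))"

lemma fractions_powi: "q \<in> K \<Longrightarrow> q powi k \<in> K"
proof -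
  assume q: "q \<in> K"
  have "r \<in> K \<Longrightarrow> r ^ j \<in> K" for r j
    by (induction j) (use fractions_subset[of 1] in \<open>auto intro: fractions_closed\<close>)
  then show ?thesis using q fractions_closed(4)[OF q q] by (simp add: power_int_def)
qed

lemma uniformizer_None:
  assumes "t \<in> K" "fls_subdegree t = int e"
  shows "uniformizer None t"
  unfolding uniformizer_def
proof (intro conjI ballI impI)
  show t: "t \<in> O\<^sub>v None" using place_None_iff assms by simp
  show t0: "t \<noteq> 0" using assms e_pos by auto
  show "val None t = 0" using val_None[OF t] assms e_pos by simp
  fix q assume q: "q \<in> K" "q \<noteq> 0"
  then obtain a b where ab: "a \<in> A" "b \<in> A" "b \<noteq> 0" "q = a / b" by (metis fractionsE)
  then have "a \<noteq> 0" using q by auto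
  then have "fls_subdegree q = fls_subdegree a - fls_subdegree b" using ab by (simp add: fls_divide_subdegree)
  then have "int e dvd fls_subdegree q" using ab e_dvd_subdegree by (auto intro: dvd_diff)
  then obtain k where k: "fls_subdegree q = int e * k" by (rule dvdE)
  let ?u = "q * t powi (- k)"
  have u: "?u \<noteq> 0" "fls_subdegree ?u = 0" "?u \<in> K"
    using q t0 k assms fractions_powi by (auto intro: fractions_closed)
  then have uO: "?u \<in> O\<^sub>v None" using place_None_iff by simp
  have "val None ?u \<noteq> 0" using val_None[OF uO] u by (metis nth_fls_subdegree_nonzero)
  moreover have "q = t powi k * ?u" using t0 by (simp add: power_int_minus field_simps)
  ultimately show "\<exists>k. \<exists>u\<in>O\<^sub>v None. val None u \<noteq> 0 \<and> q = t powi k * u" using uO by blast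
qed

text \<open>A quotient of elements of pole orders \<open>N - e\<close> and \<open>N\<close>; the
  bound on \<open>N\<close> keeps \<open>N - e\<close> at least \<open>M\<close>.\<close>

lemma exists_uniformizer_None: "\<exists>t. t \<in> K \<and> fls_subdegree t = int e"
proof -
  have "e dvd N - e" using N_dvd by (intro dvd_diff_nat) auto
  moreover have "N - e \<ge> M" using N_large by linarith
  ultimately obtain a where a: "a \<in> A" "fls_subdegree a = - int (N - e)" using M_poles by blast
  have "N - e > 0" using N_large M_pos by simp
  then have "a \<noteq> 0" using a by auto
  then have "fls_subdegree (a / g) = int e"
    using a N_large by (simp add: fls_divide_subdegree g_subdegree of_nat_diff)
  moreover have "a / g \<in> K" using a g_in by (intro fractionsI) auto
  ultimately show ?thesis by blast
qed

text \<open>\<open>order_exists\<close> factors numerator and denominator separately, and the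
  auxiliary units combine to \<open>?u\<close>.\<close>

lemma uniformizer_Some:
  assumes s: "is_point A s" and t: "local_generator A s t"
  shows "uniformizer (Some s) t"
  unfolding uniformizer_def
proof (intro conjI ballI impI)
  have tA: "t \<in> A" "s t = 0" using t by (auto simp: local_generator_def)
  show "t \<in> O\<^sub>v (Some s)" "val (Some s) t = 0" using affine_place[OF s tA(1)] tA by auto
  show t0: "t \<noteq> 0"
  proof
    assume "t = 0"
    let ?f = "g - fls_const (s g)"
    have "?f \<in> A" "s ?f = 0" using g_in s by (auto simp: point_diff intro: closed)
    then obtain u h where "u \<in> A" "s u \<noteq> 0" "?f * u = t * h" using t unfolding local_generator_def by meson
    then have "?f * u = 0" "u \<noteq> 0" using \<open>t = 0\<close> s by auto
    then have "g = fls_const (s g)" by simp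
    then have "fls_subdegree g = 0" by (metis fls_const_subdegree)
    then show False using g_subdegree N_pos by simp
  qed
  fix q assume q: "q \<in> K" "q \<noteq> 0"
  then obtain a b where ab: "a \<in> A" "b \<in> A" "b \<noteq> 0" "q = a / b" by (metis fractionsE)
  then have "a \<noteq> 0" using q by auto
  obtain n1 u1 g1 where 1: "u1 \<in> A" "g1 \<in> A" "s u1 \<noteq> 0" "s g1 \<noteq> 0" "a * u1 = t ^ n1 * g1"
    using order_exists[OF s t ab(1) \<open>a \<noteq> 0\<close>] by blast
  obtain n2 u2 g2 where 2: "u2 \<in> A" "g2 \<in> A" "s u2 \<noteq> 0" "s g2 \<noteq> 0" "b * u2 = t ^ n2 * g2"
    using order_exists[OF s t ab(2,3)] by blast
  let ?u = "(g1 * u2) / (u1 * g2)"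
  have nz: "u1 \<noteq> 0" "u2 \<noteq> 0" "g2 \<noteq> 0" using 1 2 s by auto
  have ab': "a = t ^ n1 * g1 / u1" "b = t ^ n2 * g2 / u2" using 1 2 nz by (simp_all add: field_simps)
  have "q = (t ^ n1 * g1 / u1) / (t ^ n2 * g2 / u2)" by (simp only: ab(4) flip: ab')
  also have "\<dots> = t powi (int n1 - int n2) * ?u"
    using t0 nz by (simp add: power_int_diff field_simps)
  finally have "q = t powi (int n1 - int n2) * ?u" .
  moreover have "?u \<in> O\<^sub>v (Some s)" "val (Some s) ?u \<noteq> 0"
    using affine_place_quotient[OF s mult_in[OF 1(2) 2(1)] mult_in[OF 1(1) 2(2)]] 1 2 s by (auto simp: point_mult)
  ultimately show "\<exists>k. \<exists>u\<in>O\<^sub>v (Some s). val (Some s) u \<noteq> 0 \<and> q = t powi k * u" by blast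
qed

lemma uniformizer_exists: "P \<in> pts \<Longrightarrow> \<exists>t. uniformizer P t"
proof (cases P)
  case None
  then show ?thesis using uniformizer_None exists_uniformizer_None by blast
next
  case (Some s)
  assume "P \<in> pts"
  then have "is_point A s" using Some by (auto simp: points_def)
  then show ?thesis using uniformizer_Some smooth Some by blast
qed

context
  fixes P t assumes P: "P \<in> pts" and t: "uniformizer P t"
begin

lemma unif: "t \<in> O\<^sub>v P" "t \<noteq> 0" "val P t = 0"
  using t by (auto simp: uniformizer_def)

lemma uniformizerE:
  assumes "q \<in> K" "q \<noteq> 0"
  obtains k u where "u \<in> O\<^sub>v P" "val P u \<noteq> 0" "q = t powi k * u"
  using t assms unfolding uniformizer_def by blast

lemma positive_power:
  assumes "k > 0" "u \<in> O\<^sub>v P"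
  shows "t powi k * u \<in> O\<^sub>v P" "val P (t powi k * u) = 0"
  using assms unif P by (auto simp: power_int_def place_mult place_power val_mult val_power)

lemma in_place_iff:
  assumes u: "u \<in> O\<^sub>v P" "val P u \<noteq> 0"
  shows "t powi k * u \<in> O\<^sub>v P \<longleftrightarrow> k \<ge> 0"
proof
  assume "k \<ge> 0"
  then show "t powi k * u \<in> O\<^sub>v P"
    using positive_power u by (cases "k = 0") auto
next
  assume q: "t powi k * u \<in> O\<^sub>v P"
  show "k \<ge> 0"
  proof (rule ccontr)
    assume "\<not> k \<ge> 0"
    then have "val P (t powi (- k) * (t powi k * u)) = 0" using positive_power[OF _ q, of "- k"] by simp
    moreover have "t powi (- k) * (t powi k * u) = u" using unif(2) by (simp add: power_int_minus)
    ultimately show False using u by simp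
  qed
qed

lemma power_unique:
  assumes "u \<in> O\<^sub>v P" "val P u \<noteq> 0" "v \<in> O\<^sub>v P" "val P v \<noteq> 0" "t powi k * u = t powi l * v"
  shows "k = l"
proof -
  have *: "\<not> k < l" if "u \<in> O\<^sub>v P" "val P u \<noteq> 0" "v \<in> O\<^sub>v P" "t powi k * u = t powi l * v" for u v and k l :: int
  proof
    assume "k < l"
    have "t powi (- k) * (t powi k * u) = t powi (- k) * (t powi l * v)" using that by simp
    then have "u = t powi (l - k) * v" using unif(2) by (simp add: power_int_minus power_int_diff field_simps)
    then show False using positive_power(2)[of "l - k" v] \<open>k < l\<close> that by simp
  qed
  show ?thesis using *[of u v k l] *[of v u l k] assms by auto
qed

lemma max_ideal_eq: "{q \<in> O\<^sub>v P. val P q = 0} = {x * t | x. x \<in> O\<^sub>v P}"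
proof (rule equalityI; rule subsetI)
  fix q assume q: "q \<in> {q \<in> O\<^sub>v P. val P q = 0}"
  show "q \<in> {x * t | x. x \<in> O\<^sub>v P}"
  proof (cases "q = 0")
    case True
    then have "q = 0 * t" by simp
    then show ?thesis using place_0[OF P] by blast
  next
    case False
    then obtain k u where ku: "u \<in> O\<^sub>v P" "val P u \<noteq> 0" "q = t powi k * u"
      using uniformizerE place_fractions[OF P] q by blast
    then have "k \<ge> 0" "k \<noteq> 0" using in_place_iff q by auto
    then have "q = (t powi (k - 1) * u) * t" using ku unif(2) by (simp add: power_int_diff)
    moreover have "t powi (k - 1) * u \<in> O\<^sub>v P" using in_place_iff[OF ku(1,2)] \<open>k \<ge> 0\<close> \<open>k \<noteq> 0\<close> by simp
    ultimately show ?thesis by blast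
  qed
next
  fix q assume "q \<in> {x * t | x. x \<in> O\<^sub>v P}"
  then show "q \<in> {q \<in> O\<^sub>v P. val P q = 0}" using unif P by (auto simp: place_mult val_mult)
qed

text \<open>Two generators of the maximal ideal divide each other, and the two quotients are inverse
  units.\<close>

lemma generator_associated:
  assumes "t' \<in> O\<^sub>v P" "{q \<in> O\<^sub>v P. val P q = 0} = {x * t' | x. x \<in> O\<^sub>v P}"
  obtains y where "y \<in> O\<^sub>v P" "val P y \<noteq> 0" "t' = t * y"
proof -
  have "1 * t' \<in> {x * t' | x. x \<in> O\<^sub>v P}" using place_1[OF P] by blast
  then have "t' \<in> {x * t | x. x \<in> O\<^sub>v P}" using assms(2) max_ideal_eq by simp
  then obtain y where y: "y \<in> O\<^sub>v P" "t' = y * t" by blast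
  have "t \<in> {q \<in> O\<^sub>v P. val P q = 0}" using unif by simp
  then have "t \<in> {x * t' | x. x \<in> O\<^sub>v P}" unfolding assms(2) .
  then obtain x where x: "x \<in> O\<^sub>v P" "t = x * t'" by blast
  then have "x * y = 1" using y unif(2) by simp
  then have "val P x * val P y = 1" using val_mult[OF P x(1) y(1)] val_1[OF P] by simp
  then have "val P y \<noteq> 0" by auto
  then show thesis using that y by (simp add: mult.commute)
qed

end

text \<open>The denominators of \<open>q\<close>, up to powers of \<open>h\<close>, form an ideal
  without common zero, so it contains 1. Where \<open>h\<close> is nonzero, a denominator comes from
  regularity; zeros of \<open>h\<close> need a separate argument.\<close>

lemma regular_away_from_zeros:
  assumes h: "h \<in> A" "h \<noteq> 0" and q: "q \<in> K"
    and reg: "\<And>s. is_point A s \<Longrightarrow> s h \<noteq> 0 \<Longrightarrow> q \<in> O\<^sub>v (Some s)"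
  shows "\<exists>m. q * h ^ m \<in> A"
proof -
  let ?J = "{b \<in> A. \<exists>m. q * b * h ^ m \<in> A}"
  have ideal: "is_ideal ?J"
    unfolding is_ideal_def
  proof (intro conjI ballI)
    show "?J \<subseteq> A" "0 \<in> ?J" by auto
  next
    fix a b assume "a \<in> ?J" "b \<in> ?J"
    then obtain i j where ij: "a \<in> A" "b \<in> A" "q * a * h ^ i \<in> A" "q * b * h ^ j \<in> A" by blast
    have "q * (a + b) * h ^ (i + j) = q * a * h ^ i * h ^ j + q * b * h ^ j * h ^ i"
      by (simp add: algebra_simps power_add)
    also have "\<dots> \<in> A"
      by (rule add_in[OF mult_in[OF ij(3) power_in[OF h(1)]] mult_in[OF ij(4) power_in[OF h(1)]]])
    finally show "a + b \<in> ?J" using ij add_in by blast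
  next
    fix a b assume "a \<in> A" "b \<in> ?J"
    then obtain j where j: "b \<in> A" "q * b * h ^ j \<in> A" by blast
    have "q * (a * b) * h ^ j = a * (q * b * h ^ j)" by (simp add: algebra_simps)
    also have "\<dots> \<in> A" by (rule mult_in[OF \<open>a \<in> A\<close> j(2)])
    finally show "a * b \<in> ?J" using j \<open>a \<in> A\<close> mult_in by blast
  qed
  have no_zero: False if s: "is_point A s" "\<forall>j\<in>?J. s j = 0" for s
  proof (cases "s h = 0")
    case False
    then obtain m a b where ab: "a \<in> L m" "b \<in> L m" "ev m (Some s) b \<noteq> 0" "q = a / b"
      using reg[OF s(1)] by (auto simp: place_ring_def local_quotient_def)
    then have "b \<noteq> 0" using s by auto
    then have "q * b * h ^ 0 \<in> A" using ab L_in by simp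
    then have "b \<in> ?J" using L_in[OF ab(2)] by blast
    then show False using s ab(3) by auto
  next
    case True
    \<comment> \<open>Modulo the denominator \<open>b\<close>, \<open>h\<close> satisfies a
      polynomial equation. After a power of \<open>h\<close> is split off, \<open>peval r h\<close>
      is a denominator up to powers of \<open>h\<close>, and at a zero of \<open>h\<close> its value
      is \<open>r\<close> at 0, which is nonzero.\<close>
    obtain a b where ab: "a \<in> A" "b \<in> A" "b \<noteq> 0" "q = a / b" using q by (rule fractionsE)
    obtain p c where p: "p \<noteq> 0" "c \<in> A" "peval p h = b * c" using algebraic_mod[OF ab(2,3) h(1)] by blast
    obtain j r where r: "\<And>f. peval p f = f ^ j * peval r f" and r0: "poly r 0 \<noteq> 0" using peval_split[OF p(1)] by blast
    have "q * peval r h * h ^ j = q * peval p h" using r[of h] by (simp add: algebra_simps)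
    also have "\<dots> = a * c" using p(3) ab by simp
    finally have "q * peval r h * h ^ j \<in> A" using ab p by (simp add: mult_in)
    then have "peval r h \<in> ?J" using peval_in[OF h(1)] by blast
    then show False using s r0 True h by (auto simp: point_peval)
  qed
  have "1 \<in> ?J"
  proof (rule ccontr)
    assume "1 \<notin> ?J"
    then obtain s where "is_point A s \<and> (\<forall>j\<in>?J. s j = 0)" using nullstellensatz[OF ideal] by (auto elim: exE)
    then show False using no_zero[of s] by simp
  qed
  then show ?thesis by simp
qed

lemma regular_everywhere_affine:
  assumes "q \<in> K" "\<And>s. is_point A s \<Longrightarrow> q \<in> O\<^sub>v (Some s)"
  shows "q \<in> A"
  using regular_away_from_zeros[of 1 q] assms by auto

section \<open>Regular functions and the function field\<close>

abbreviation "point_of Q \<equiv> the_inv_into pts phi Q"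

definition value_function :: "'k fls \<Rightarrow> 'k ppoint \<Rightarrow> 'k" where
  "value_function q Q = val (point_of Q) q"

lemma value_function [simp]: "P \<in> pts \<Longrightarrow> value_function q (phi P) = val P q"
  by (simp add: value_function_def the_inv_into_f_f[OF phi_inj])

text \<open>As nonempty open sets are cofinite, this is equality of \<open>f\<close> and
  \<open>q\<close> as rational functions.\<close>

definition agrees :: "('k ppoint \<Rightarrow> 'k) \<Rightarrow> 'k fls \<Rightarrow> bool" where
  "agrees f q \<longleftrightarrow> finite {P \<in> pts. \<not> (q \<in> O\<^sub>v P \<and> f (phi P) = val P q)}"

lemma cofinite_nonempty: "finite (pts - S) \<Longrightarrow> S \<noteq> {}"
  using infinite_pts by auto

lemma openin_X_image:
  assumes "S \<subseteq> pts" "finite (pts - S)"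
  shows "openin X (phi ` S)"
proof -
  have "carrier_set - phi ` S \<subseteq> phi ` (pts - S)" by (auto simp: carrier_set_def)
  then have "finite (carrier_set - phi ` S)" using assms finite_subset by blast
  moreover have "phi ` S \<subseteq> carrier_set" using assms(1) by (auto simp: carrier_set_def)
  ultimately show ?thesis using openin_X_iff by blast
qed

lemma openin_X_cofinite:
  assumes "openin X V" "V \<noteq> {}"
  shows "finite {P \<in> pts. phi P \<notin> V}"
proof -
  have "finite (carrier_set - V)" using assms openin_X_iff by blast
  moreover have "phi ` {P \<in> pts. phi P \<notin> V} \<subseteq> carrier_set - V" by (auto simp: carrier_set_def)
  ultimately have "finite (phi ` {P \<in> pts. phi P \<notin> V})" using finite_subset by blast
  moreover have "inj_on phi {P \<in> pts. phi P \<notin> V}" by (rule inj_on_subset[OF phi_inj]) auto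
  ultimately show ?thesis using finite_imageD by blast
qed

lemma openin_X_subset: "openin X V \<Longrightarrow> V \<subseteq> phi ` pts"
  using openin_X_iff[of V] by (auto simp: carrier_set_def)

text \<open>Forms of equal degree correspond to elements of one \<open>L d\<close> and back. A
  neighbourhood may omit the finitely many points where the denominator vanishes or \<open>f\<close>
  differs from the fraction.\<close>

lemma regular_at_iff:
  assumes P: "P \<in> pts"
  shows "regular_at X f (phi P) \<longleftrightarrow> (\<exists>q\<in>O\<^sub>v P. f (phi P) = val P q \<and> agrees f q)"
proof
  assume "regular_at X f (phi P)"
  then obtain V G H d where V: "openin X V" "phi P \<in> V" and GH: "homogeneous d G" "homogeneous d H"
    and f: "\<And>Q x. Q \<in> V \<Longrightarrow> x \<in> Q \<Longrightarrow> mpoly_eval H x \<noteq> 0 \<and> f Q = mpoly_eval G x / mpoly_eval H x"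
    unfolding regular_at_def by blast
  obtain a b where a: "represents d G a" and b: "represents d H b" using form_represents GH by blast
  have ab: "a \<in> L d" "b \<in> L d" using a b by (auto simp: represents_def)
  have *: "local_quotient P' (a / b) (f (phi P'))" if P': "P' \<in> pts" "phi P' \<in> V" for P'
  proof -
    have "mpoly_eval G (crd P') = ev d P' a" "mpoly_eval H (crd P') = ev d P' b"
      using a b P' by (auto simp: represents_def)
    then have "ev d P' b \<noteq> 0" "f (phi P') = ev d P' a / ev d P' b"
      using f[OF P'(2) crd_mem] by auto
    then show ?thesis using local_quotientI[OF ab] by simp
  qed
  have "a / b \<in> O\<^sub>v P \<and> f (phi P) = val P (a / b)"
    using *[OF P V(2)] local_quotient_in val_eq[OF P] by simp
  moreover have "agrees f (a / b)"
  proof -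
    have "{P' \<in> pts. \<not> (a / b \<in> O\<^sub>v P' \<and> f (phi P') = val P' (a / b))} \<subseteq> {P' \<in> pts. phi P' \<notin> V}"
      using * local_quotient_in val_eq by fastforce
    moreover have "finite {P' \<in> pts. phi P' \<notin> V}" using openin_X_cofinite V by blast
    ultimately show ?thesis unfolding agrees_def using finite_subset by blast
  qed
  ultimately show "\<exists>q\<in>O\<^sub>v P. f (phi P) = val P q \<and> agrees f q" by blast
next
  assume "\<exists>q\<in>O\<^sub>v P. f (phi P) = val P q \<and> agrees f q"
  then obtain q where q: "q \<in> O\<^sub>v P" "f (phi P) = val P q" "agrees f q" by blast
  obtain m a b where ab: "a \<in> L m" "b \<in> L m" "ev m P b \<noteq> 0" "q = a / b"
    using q(1) by (auto simp: place_ring_def local_quotient_def)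
  have "b \<noteq> 0" using ab(3) P by auto
  obtain G H where G: "represents m G a" and H: "represents m H b" using element_represented ab by blast
  let ?S = "{P' \<in> pts. ev m P' b \<noteq> 0 \<and> f (phi P') = val P' q}"
  have "pts - ?S \<subseteq> {P' \<in> pts. ev m P' b = 0} \<union> {P' \<in> pts. \<not> (q \<in> O\<^sub>v P' \<and> f (phi P') = val P' q)}" by blast
  moreover have "finite ({P' \<in> pts. ev m P' b = 0} \<union> {P' \<in> pts. \<not> (q \<in> O\<^sub>v P' \<and> f (phi P') = val P' q)})"
    using ev_finite[OF ab(2) \<open>b \<noteq> 0\<close>] q(3) by (simp add: agrees_def)
  ultimately have "openin X (phi ` ?S)" by (intro openin_X_image) (auto intro: finite_subset)
  moreover have "phi P \<in> phi ` ?S" using P ab q by blast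
  moreover have "mpoly_eval H x \<noteq> 0 \<and> f Q = mpoly_eval G x / mpoly_eval H x" if Q: "Q \<in> phi ` ?S" "x \<in> Q" for Q x
  proof -
    obtain P' where P': "P' \<in> pts" "ev m P' b \<noteq> 0" "f (phi P') = val P' q" "Q = phi P'" using Q by blast
    have xP: "x \<in> phi P'" using Q(2) P'(4) by simp
    obtain c where "c \<noteq> 0 \<and> (\<forall>m F a. represents m F a \<longrightarrow> mpoly_eval F x = c ^ m * ev m P' a)"
      using represents_eval[OF G P'(1) xP] by (rule exE)
    then have c: "c \<noteq> 0" "mpoly_eval G x = c ^ m * ev m P' a" "mpoly_eval H x = c ^ m * ev m P' b"
      using G H by simp_all
    have "val P' q = ev m P' a / ev m P' b"
      using val_eq[OF P'(1)] local_quotientI[OF ab(1,2) P'(2)] ab(4) by simp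
    then show ?thesis using P' c by simp
  qed
  ultimately show "regular_at X f (phi P)"
    unfolding regular_at_def using G H unfolding represents_def by blast
qed

lemma agrees_unique:
  assumes "agrees f q" "agrees f r" "q \<in> K" "r \<in> K"
  shows "q = r"
proof (rule ccontr)
  assume "q \<noteq> r"
  have "q + - r \<in> K" by (rule fractions_closed(1)[OF assms(3) fractions_closed(3)[OF assms(4) assms(4)]])
  then have "finite {P \<in> pts. val P (q + - r) = 0}" using finite_val_zeros \<open>q \<noteq> r\<close> by simp
  then have "finite ({P \<in> pts. \<not> (q \<in> O\<^sub>v P \<and> f (phi P) = val P q)} \<union>
    {P \<in> pts. \<not> (r \<in> O\<^sub>v P \<and> f (phi P) = val P r)} \<union> {P \<in> pts. val P (q + - r) = 0})"
    using assms(1,2) by (simp add: agrees_def)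
  moreover have "pts \<subseteq> {P \<in> pts. \<not> (q \<in> O\<^sub>v P \<and> f (phi P) = val P q)} \<union>
    {P \<in> pts. \<not> (r \<in> O\<^sub>v P \<and> f (phi P) = val P r)} \<union> {P \<in> pts. val P (q + - r) = 0}"
  proof
    fix P assume P: "P \<in> pts"
    have "val P (q + - r) = 0" if "q \<in> O\<^sub>v P" "r \<in> O\<^sub>v P" "val P q = val P r"
    proof -
      have "fls_const (-1) * r \<in> O\<^sub>v P" "val P (fls_const (-1) * r) = - val P r"
        using that P by (simp_all add: place_mult val_mult del: fls_const_uminus)
      then show ?thesis using that P val_add[OF P, of q "fls_const (-1) * r"] by simp
    qed
    then show "P \<in> {P \<in> pts. \<not> (q \<in> O\<^sub>v P \<and> f (phi P) = val P q)} \<union>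
      {P \<in> pts. \<not> (r \<in> O\<^sub>v P \<and> f (phi P) = val P r)} \<union> {P \<in> pts. val P (q + - r) = 0}" using P by auto
  qed
  ultimately have "finite pts" by (rule finite_subset[rotated])
  then show False using infinite_pts by simp
qed

lemma agrees_value_function: "q \<in> K \<Longrightarrow> agrees (value_function q) q"
  using finite_poles[of q] unfolding agrees_def by (rule rev_finite_subset) auto

lemma regular_value_function: "P \<in> pts \<Longrightarrow> q \<in> O\<^sub>v P \<Longrightarrow> regular_at X (value_function q) (phi P)"
  using regular_at_iff agrees_value_function place_fractions by auto

lemma rat_class_iff: "h \<in> rat_class X f \<longleftrightarrow> finite {P \<in> pts. h (phi P) \<noteq> f (phi P)}"
proof
  assume "h \<in> rat_class X f"
  then obtain U where U: "openin X U" "U \<noteq> {}" "\<forall>Q\<in>U. h Q = f Q" by (auto simp: rat_class_def)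
  have "{P \<in> pts. h (phi P) \<noteq> f (phi P)} \<subseteq> {P \<in> pts. phi P \<notin> U}" using U by auto
  then show "finite {P \<in> pts. h (phi P) \<noteq> f (phi P)}" using openin_X_cofinite U finite_subset by blast
next
  assume fin: "finite {P \<in> pts. h (phi P) \<noteq> f (phi P)}"
  let ?S = "{P \<in> pts. h (phi P) = f (phi P)}"
  have "pts - ?S = {P \<in> pts. h (phi P) \<noteq> f (phi P)}" by auto
  then have f: "finite (pts - ?S)" using fin by simp
  then have "openin X (phi ` ?S)" by (intro openin_X_image) auto
  moreover have "?S \<noteq> {}" using f by (rule cofinite_nonempty)
  ultimately show "h \<in> rat_class X f" unfolding rat_class_def by blast
qed

lemma rat_class_self: "f \<in> rat_class X f" by (simp add: rat_class_iff)

lemma rat_class_eqI: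
  assumes "finite {P \<in> pts. h (phi P) \<noteq> f (phi P)}"
  shows "rat_class X h = rat_class X f"
proof (rule Set.set_eqI)
  fix k
  have "finite {P \<in> pts. k (phi P) \<noteq> f (phi P)}" if "finite {P \<in> pts. k (phi P) \<noteq> h (phi P)}"
    by (rule finite_subset[OF _ finite_UnI[OF assms that]]) auto
  moreover have "finite {P \<in> pts. k (phi P) \<noteq> h (phi P)}" if "finite {P \<in> pts. k (phi P) \<noteq> f (phi P)}"
    by (rule finite_subset[OF _ finite_UnI[OF assms that]]) auto
  ultimately show "k \<in> rat_class X h \<longleftrightarrow> k \<in> rat_class X f" unfolding rat_class_iff by blast
qed

text \<open>The isomorphism from the fractions among Laurent series onto the function field; facts
  about \<open>function_field X\<close> are transported through it.\<close>

definition Phi :: "'k fls \<Rightarrow> ('k ppoint \<Rightarrow> 'k) set" where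
  "Phi q = rat_class X (value_function q)"

lemma rat_class_agrees:
  assumes "agrees f q" shows "rat_class X f = Phi q"
  unfolding Phi_def
  by (rule rat_class_eqI) (rule finite_subset[OF _ assms[unfolded agrees_def]], auto)

lemma Phi_agrees:
  assumes "f \<in> Phi q" "q \<in> K" shows "agrees f q"
proof -
  have "finite {P \<in> pts. f (phi P) \<noteq> value_function q (phi P)}" using assms by (simp add: Phi_def rat_class_iff)
  then show ?thesis
    unfolding agrees_def by (rule finite_subset[OF _ finite_UnI[OF _ finite_poles[OF assms(2)]], rotated]) auto
qed

lemma Phi_inj: "q \<in> K \<Longrightarrow> r \<in> K \<Longrightarrow> Phi q = Phi r \<Longrightarrow> q = r"
  using agrees_unique Phi_agrees rat_class_self unfolding Phi_def by metis

lemma Phi_nonempty: "value_function q \<in> Phi q" by (simp add: Phi_def rat_class_self)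

section \<open>The function field and the local rings, read as fractions\<close>

abbreviation "FF \<equiv> function_field X"

lemma carrier_FF: "carrier FF = Phi ` K"
proof -
  have "{rat_class X f | f. \<exists>U. openin X U \<and> U \<noteq> {} \<and> regular_on X U f} = Phi ` K"
  proof (rule equalityI; rule subsetI)
    fix a assume "a \<in> {rat_class X f | f. \<exists>U. openin X U \<and> U \<noteq> {} \<and> regular_on X U f}"
    then obtain f U where f: "a = rat_class X f" "openin X U" "U \<noteq> {}" "regular_on X U f" by blast
    then obtain P where P: "P \<in> pts" "phi P \<in> U" using openin_X_subset by blast
    then have "regular_at X f (phi P)" using f(4) by (simp add: regular_on_def)
    then obtain q where "q \<in> O\<^sub>v P" "agrees f q" using regular_at_iff[OF P(1)] by blast
    then show "a \<in> Phi ` K" using f(1) rat_class_agrees place_fractions P by blast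
  next
    fix a assume "a \<in> Phi ` K"
    then obtain q where q: "q \<in> K" "a = Phi q" by blast
    let ?S = "{P \<in> pts. q \<in> O\<^sub>v P}"
    have "pts - ?S = {P \<in> pts. q \<notin> O\<^sub>v P}" by auto
    then have fin: "finite (pts - ?S)" using finite_poles q by simp
    then have "openin X (phi ` ?S)" by (intro openin_X_image) auto
    moreover have "?S \<noteq> {}" using fin by (rule cofinite_nonempty)
    moreover have "regular_on X (phi ` ?S) (value_function q)"
      unfolding regular_on_def using regular_value_function by blast
    ultimately show "a \<in> {rat_class X f | f. \<exists>U. openin X U \<and> U \<noteq> {} \<and> regular_on X U f}"
      using q unfolding Phi_def by blast
  qed
  then show ?thesis by (simp add: function_field_def)
qed

lemma agrees_add: assumes "agrees f q" "agrees h r" shows "agrees (\<lambda>Q. f Q + h Q) (q + r)"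
  unfolding agrees_def
  by (rule finite_subset[OF _ finite_UnI[OF assms[unfolded agrees_def]]]) (auto simp: place_add val_add)

lemma agrees_mult: assumes "agrees f q" "agrees h r" shows "agrees (\<lambda>Q. f Q * h Q) (q * r)"
  unfolding agrees_def
  by (rule finite_subset[OF _ finite_UnI[OF assms[unfolded agrees_def]]]) (auto simp: place_mult val_mult)

lemma Phi_mult:
  assumes "q \<in> K" "r \<in> K" shows "Phi q \<otimes>\<^bsub>FF\<^esub> Phi r = Phi (q * r)"
proof -
  have "rat_class X (\<lambda>Q. f Q * h Q) = Phi (q * r)" if "f \<in> Phi q" "h \<in> Phi r" for f h
    using that assms by (intro rat_class_agrees agrees_mult Phi_agrees)
  then have "(\<Union>f\<in>Phi q. \<Union>h\<in>Phi r. rat_class X (\<lambda>Q. f Q * h Q)) = Phi (q * r)"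
    using Phi_nonempty[of q] Phi_nonempty[of r] by auto
  then show ?thesis by (simp add: function_field_def)
qed

lemma Phi_add:
  assumes "q \<in> K" "r \<in> K" shows "Phi q \<oplus>\<^bsub>FF\<^esub> Phi r = Phi (q + r)"
proof -
  have "rat_class X (\<lambda>Q. f Q + h Q) = Phi (q + r)" if "f \<in> Phi q" "h \<in> Phi r" for f h
    using that assms by (intro rat_class_agrees agrees_add Phi_agrees)
  then have "(\<Union>f\<in>Phi q. \<Union>h\<in>Phi r. rat_class X (\<lambda>Q. f Q + h Q)) = Phi (q + r)"
    using Phi_nonempty[of q] Phi_nonempty[of r] by auto
  then show ?thesis by (simp add: function_field_def)
qed

lemma Phi_one: "\<one>\<^bsub>FF\<^esub> = Phi 1" and Phi_zero: "\<zero>\<^bsub>FF\<^esub> = Phi 0"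
proof -
  have "agrees (\<lambda>_. 1) 1" "agrees (\<lambda>_. 0) 0"
    unfolding agrees_def by (rule finite_subset[of _ "{}"]; auto)+
  then show "\<one>\<^bsub>FF\<^esub> = Phi 1" "\<zero>\<^bsub>FF\<^esub> = Phi 0" by (simp_all add: function_field_def rat_class_agrees)
qed

lemma K_0 [simp]: "0 \<in> K" and K_1 [simp]: "1 \<in> K"
  by (auto intro: fractions_subset)

lemma ring_FF: "ring FF"
proof (rule ringI)
  show "abelian_group FF"
  proof (rule abelian_groupI)
    fix x assume "x \<in> carrier FF"
    then obtain q where "q \<in> K" "x = Phi q" by (auto simp: carrier_FF)
    moreover have "- q \<in> K" using fractions_closed \<open>q \<in> K\<close> by blast
    ultimately show "\<exists>y\<in>carrier FF. y \<oplus>\<^bsub>FF\<^esub> x = \<zero>\<^bsub>FF\<^esub>"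
      by (intro bexI[of _ "Phi (- q)"]) (auto simp: carrier_FF Phi_add Phi_zero)
  qed (auto simp: carrier_FF Phi_add Phi_zero fractions_closed algebra_simps)
  show "Group.monoid FF"
    by (rule monoidI) (auto simp: carrier_FF Phi_mult Phi_one fractions_closed algebra_simps)
qed (auto simp: carrier_FF Phi_add Phi_mult fractions_closed algebra_simps)

lemma Phi_power: "q \<in> K \<Longrightarrow> Phi q [^]\<^bsub>FF\<^esub> (j::nat) = Phi (q ^ j)"
proof (induction j)
  case (Suc j)
  have "q ^ j \<in> K" using fractions_powi[OF Suc.prems, of "int j"] by simp
  then show ?case using Suc by (simp add: Phi_mult mult.commute)
qed (simp add: Phi_one)

lemma Phi_inverse:
  assumes "q \<in> K" "q \<noteq> 0" shows "inv\<^bsub>FF\<^esub> Phi q = Phi (inverse q)"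
  unfolding m_inv_def
proof (rule the_equality)
  have i: "inverse q \<in> K" using fractions_closed assms by blast
  then show "Phi (inverse q) \<in> carrier FF \<and> Phi q \<otimes>\<^bsub>FF\<^esub> Phi (inverse q) = \<one>\<^bsub>FF\<^esub> \<and> Phi (inverse q) \<otimes>\<^bsub>FF\<^esub> Phi q = \<one>\<^bsub>FF\<^esub>"
    using assms by (auto simp: carrier_FF Phi_mult Phi_one)
  fix y assume y: "y \<in> carrier FF \<and> Phi q \<otimes>\<^bsub>FF\<^esub> y = \<one>\<^bsub>FF\<^esub> \<and> y \<otimes>\<^bsub>FF\<^esub> Phi q = \<one>\<^bsub>FF\<^esub>"
  then obtain r where r: "r \<in> K" "y = Phi r" by (auto simp: carrier_FF)
  then have "q * r = 1" using y assms Phi_inj[of "q * r" 1] by (auto simp: Phi_mult Phi_one fractions_closed)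
  then have "r = inverse q" using assms(2) by (simp add: field_simps)
  then show "y = Phi (inverse q)" using r by simp
qed

lemma Phi_powi:
  assumes "q \<in> K" "q \<noteq> 0" shows "Phi q [^]\<^bsub>FF\<^esub> (k::int) = Phi (q powi k)"
proof (cases "k < 0")
  case False
  then obtain j where "k = int j" by (metis nonneg_int_cases not_less)
  then show ?thesis using assms by (simp add: int_pow_int Phi_power)
next
  case True
  have qk: "q ^ nat (- k) \<in> K" using fractions_powi[OF assms(1), of "- k"] True by (simp add: power_int_def)
  have "Phi q [^]\<^bsub>FF\<^esub> k = inv\<^bsub>FF\<^esub> (Phi q [^]\<^bsub>FF\<^esub> (nat (- k)))"
    unfolding int_pow_def nat_pow_def using True by simp
  also have "\<dots> = Phi (inverse (q ^ nat (- k)))"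
    unfolding Phi_power[OF assms(1)] by (rule Phi_inverse[OF qk]) (use assms(2) in simp)
  also have "inverse (q ^ nat (- k)) = q powi k" using True by (simp add: power_int_def power_inverse)
  finally show ?thesis .
qed

lemma local_ring_simps [simp]:
  "mult (local_ring X Q) = mult FF" "one (local_ring X Q) = one FF"
  by (simp_all add: local_ring_def)

text \<open>The predicate \<open>R\<close> on the value treats the local ring and its maximal ideal
  together.\<close>

lemma regular_classes:
  assumes P: "P \<in> pts"
  shows "{rat_class X f | f. regular_at X f (phi P) \<and> R (f (phi P))} = Phi ` {q \<in> O\<^sub>v P. R (val P q)}"
proof (rule equalityI; rule subsetI)
  fix a assume "a \<in> {rat_class X f | f. regular_at X f (phi P) \<and> R (f (phi P))}"
  then obtain f where f: "a = rat_class X f" "regular_at X f (phi P)" "R (f (phi P))" by blast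
  then obtain q where q: "q \<in> O\<^sub>v P" "f (phi P) = val P q" "agrees f q" using regular_at_iff[OF P] by blast
  then show "a \<in> Phi ` {q \<in> O\<^sub>v P. R (val P q)}" using f rat_class_agrees by auto
next
  fix a assume "a \<in> Phi ` {q \<in> O\<^sub>v P. R (val P q)}"
  then obtain q where q: "q \<in> O\<^sub>v P" "R (val P q)" "a = Phi q" by blast
  then show "a \<in> {rat_class X f | f. regular_at X f (phi P) \<and> R (f (phi P))}"
    using regular_value_function[OF P q(1)] P unfolding Phi_def by fastforce
qed

lemma carrier_local_ring: "P \<in> pts \<Longrightarrow> carrier (local_ring X (phi P)) = Phi ` O\<^sub>v P"
  using regular_classes[of P "\<lambda>_. True"] by (simp add: local_ring_def)

lemma local_max_ideal_eq: "P \<in> pts \<Longrightarrow> local_max_ideal X (phi P) = Phi ` {q \<in> O\<^sub>v P. val P q = 0}"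
  using regular_classes[of P "\<lambda>c. c = 0"] by (simp add: local_max_ideal_def)

lemma local_parameter_iff:
  assumes P: "P \<in> pts"
  shows "local_parameter X (phi P) a \<longleftrightarrow>
    (\<exists>t\<in>O\<^sub>v P. a = Phi t \<and> {q \<in> O\<^sub>v P. val P q = 0} = {x * t | x. x \<in> O\<^sub>v P})"
proof -
  have 1: "PIdl\<^bsub>local_ring X (phi P)\<^esub> (Phi t) = Phi ` {x * t | x. x \<in> O\<^sub>v P}" if "t \<in> O\<^sub>v P" for t
  proof -
    have "PIdl\<^bsub>local_ring X (phi P)\<^esub> (Phi t) = {Phi x \<otimes>\<^bsub>FF\<^esub> Phi t | x. x \<in> O\<^sub>v P}"
      unfolding cgenideal_def carrier_local_ring[OF P] by auto
    also have "\<dots> = {Phi (x * t) | x. x \<in> O\<^sub>v P}"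
      using Phi_mult[OF place_fractions[OF P] place_fractions[OF P that]] by force
    finally show ?thesis by blast
  qed
  have 2: "(Phi ` S = Phi ` T) \<longleftrightarrow> S = T" if "S \<subseteq> K" "T \<subseteq> K" for S T
    using inj_on_image_eq_iff[of Phi K S T] that Phi_inj by (auto simp: inj_on_def)
  have 3: "{q \<in> O\<^sub>v P. val P q = 0} \<subseteq> K" "\<And>t. t \<in> O\<^sub>v P \<Longrightarrow> {x * t | x. x \<in> O\<^sub>v P} \<subseteq> K"
    using place_fractions[OF P] place_mult[OF P] by auto
  have 4: "PIdl\<^bsub>local_ring X (phi P)\<^esub> (Phi t) = Phi ` {q \<in> O\<^sub>v P. val P q = 0} \<longleftrightarrow>
      {q \<in> O\<^sub>v P. val P q = 0} = {x * t | x. x \<in> O\<^sub>v P}" if t: "t \<in> O\<^sub>v P" for t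
    unfolding 1[OF t] 2[OF 3(2)[OF t] 3(1)] by (rule eq_commute)
  show ?thesis
  proof
    assume "local_parameter X (phi P) a"
    then obtain t where t: "t \<in> O\<^sub>v P" "a = Phi t"
      and "PIdl\<^bsub>local_ring X (phi P)\<^esub> (Phi t) = Phi ` {q \<in> O\<^sub>v P. val P q = 0}"
      unfolding local_parameter_def carrier_local_ring[OF P] local_max_ideal_eq[OF P] by blast
    then have "{q \<in> O\<^sub>v P. val P q = 0} = {x * t | x. x \<in> O\<^sub>v P}" using 4[OF t(1)] by simp
    then show "\<exists>t\<in>O\<^sub>v P. a = Phi t \<and> {q \<in> O\<^sub>v P. val P q = 0} = {x * t | x. x \<in> O\<^sub>v P}" using t by blast
  next
    assume "\<exists>t\<in>O\<^sub>v P. a = Phi t \<and> {q \<in> O\<^sub>v P. val P q = 0} = {x * t | x. x \<in> O\<^sub>v P}"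
    then obtain t where t: "t \<in> O\<^sub>v P" "a = Phi t" "{q \<in> O\<^sub>v P. val P q = 0} = {x * t | x. x \<in> O\<^sub>v P}" by blast
    then show "local_parameter X (phi P) a"
      unfolding local_parameter_def carrier_local_ring[OF P] local_max_ideal_eq[OF P] using 4[OF t(1)] by simp
  qed
qed

lemma uniformizer_local_parameter:
  assumes P: "P \<in> pts" and t: "uniformizer P t"
  shows "local_parameter X (phi P) (Phi t)"
  unfolding local_parameter_iff[OF P] using max_ideal_eq[OF P t] by (intro bexI[OF _ unif(1)[OF P t]]) simp

lemma Units_local_ring:
  assumes P: "P \<in> pts"
  shows "Units (local_ring X (phi P)) = Phi ` {u \<in> O\<^sub>v P. val P u \<noteq> 0}"
proof (rule equalityI; rule subsetI)
  fix a assume "a \<in> Units (local_ring X (phi P))"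
  then obtain u v where uv: "u \<in> O\<^sub>v P" "v \<in> O\<^sub>v P" "a = Phi u" "Phi v \<otimes>\<^bsub>FF\<^esub> Phi u = \<one>\<^bsub>FF\<^esub>"
    by (auto simp: Units_def carrier_local_ring[OF P])
  have uvK: "u \<in> K" "v \<in> K" using place_fractions[OF P] uv by auto
  then have "v * u = 1" using uv(4) Phi_inj[of "v * u" 1] by (auto simp: Phi_mult Phi_one fractions_closed)
  then have "val P v * val P u = 1" using val_mult[OF P uv(2,1)] val_1[OF P] by simp
  then show "a \<in> Phi ` {u \<in> O\<^sub>v P. val P u \<noteq> 0}" using uv by auto
next
  fix a assume "a \<in> Phi ` {u \<in> O\<^sub>v P. val P u \<noteq> 0}"
  then obtain u where u: "u \<in> O\<^sub>v P" "val P u \<noteq> 0" "a = Phi u" by blast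
  have i: "inverse u \<in> O\<^sub>v P" using place_inverse[OF P u(1,2)] .
  have "u \<noteq> 0" using u(2) P by auto
  then show "a \<in> Units (local_ring X (phi P))"
    using u i place_fractions[OF P] unfolding Units_def
    by (auto simp: carrier_local_ring[OF P] Phi_mult Phi_one intro!: bexI[of _ "inverse u"])
qed

text \<open>For uniqueness, another local parameter is \<open>t\<close> times a unit
  \<open>y\<close>; the factor \<open>y powi l\<close> from its power is absorbed into the
  unit.\<close>

lemma order_at_Phi:
  assumes P: "P \<in> pts" and t: "uniformizer P t" and u: "u \<in> O\<^sub>v P" "val P u \<noteq> 0"
  shows "order_at X (phi P) (Phi (t powi k * u)) = k"
  unfolding order_at_def
proof (rule the_equality)
  have tK: "t \<in> K" "t \<noteq> 0" "t powi k \<in> K" using place_fractions[OF P] unif[OF P t] fractions_powi by auto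
  have uK: "u \<in> K" using place_fractions[OF P] u by simp
  show "\<exists>t' v. local_parameter X (phi P) t' \<and> v \<in> Units (local_ring X (phi P)) \<and>
      Phi (t powi k * u) = t' [^]\<^bsub>FF\<^esub> k \<otimes>\<^bsub>FF\<^esub> v"
    using uniformizer_local_parameter[OF P t] u Units_local_ring[OF P] tK uK
    by (intro exI[of _ "Phi t"] exI[of _ "Phi u"]) (auto simp: Phi_powi Phi_mult)
  fix l :: int assume "\<exists>t' v. local_parameter X (phi P) t' \<and> v \<in> Units (local_ring X (phi P)) \<and>
      Phi (t powi k * u) = t' [^]\<^bsub>FF\<^esub> l \<otimes>\<^bsub>FF\<^esub> v"
  then obtain t' v where t': "t' \<in> O\<^sub>v P" "{q \<in> O\<^sub>v P. val P q = 0} = {x * t' | x. x \<in> O\<^sub>v P}"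
    and v: "v \<in> O\<^sub>v P" "val P v \<noteq> 0" and eq: "Phi (t powi k * u) = Phi t' [^]\<^bsub>FF\<^esub> l \<otimes>\<^bsub>FF\<^esub> Phi v"
    unfolding local_parameter_iff[OF P] Units_local_ring[OF P] by auto
  obtain y where y: "y \<in> O\<^sub>v P" "val P y \<noteq> 0" "t' = t * y" using generator_associated[OF P t t'] by blast
  have "y \<noteq> 0" using y(2) P by auto
  then have t'0: "t' \<noteq> 0" "t' \<in> K" using y tK place_fractions[OF P t'(1)] by auto
  have vK: "v \<in> K" using place_fractions[OF P] v by simp
  have "t' powi l \<in> K" using fractions_powi t'0 by simp
  then have "Phi (t powi k * u) = Phi (t' powi l * v)" using eq t'0 vK by (simp add: Phi_powi Phi_mult)
  then have "t powi k * u = t' powi l * v"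
    by (rule Phi_inj[OF fractions_closed(2)[OF tK(3) uK] fractions_closed(2)[OF \<open>t' powi l \<in> K\<close> vK]])
  also have "\<dots> = t powi l * (y powi l * v)" by (simp add: y(3) power_int_mult_distrib)
  finally have eq': "t powi k * u = t powi l * (y powi l * v)" .
  have "y powi l * v \<in> O\<^sub>v P" "val P (y powi l * v) \<noteq> 0"
    using place_powi[OF P y(1,2)] v by (auto simp: place_mult[OF P] val_mult[OF P])
  then show "l = k" using power_unique[OF P t u _ _ eq'] by simp
qed

lemma order_nonneg_iff:
  assumes P: "P \<in> pts" and q: "q \<in> K" "q \<noteq> 0"
  shows "order_at X (phi P) (Phi q) \<ge> 0 \<longleftrightarrow> q \<in> O\<^sub>v P"
proof -
  obtain t where t: "uniformizer P t" using uniformizer_exists P by blast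
  obtain k u where ku: "u \<in> O\<^sub>v P" "val P u \<noteq> 0" "q = t powi k * u" using uniformizerE[OF P t q] by blast
  then show ?thesis using order_at_Phi[OF P t ku(1,2)] in_place_iff[OF P t ku(1,2)] by simp
qed

text \<open>A uniformizer at infinity has subdegree \<open>e\<close>, so subdegrees are
  \<open>e\<close> times orders on the curve.\<close>

lemma order_at_infinity:
  assumes q: "q \<in> K" "q \<noteq> 0"
  shows "int e * order_at X (phi None) (Phi q) = fls_subdegree q"
proof -
  obtain t where t: "t \<in> K" "fls_subdegree t = int e" using exists_uniformizer_None by blast
  then have u: "uniformizer None t" by (rule uniformizer_None)
  obtain k v where kv: "v \<in> O\<^sub>v None" "val None v \<noteq> 0" "q = t powi k * v" using uniformizerE[OF None_pts u q] by blast
  have "t \<noteq> 0" "v \<noteq> 0" using q kv unif[OF None_pts u] by auto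
  have "fls_subdegree v \<ge> 0" using place_None_iff place_fractions[OF None_pts kv(1)] kv(1) by blast
  moreover have "v $$ 0 \<noteq> 0" using val_None kv by simp
  ultimately have "fls_subdegree v = 0" using fls_subdegree_leI by fastforce
  then have "fls_subdegree q = k * int e" using kv(3) \<open>t \<noteq> 0\<close> \<open>v \<noteq> 0\<close> t by simp
  then show ?thesis using order_at_Phi[OF None_pts u kv(1,2)] kv(3) by simp
qed

lemma topspace_X: "topspace X = phi ` pts"
  using X_topology(1) by (simp add: carrier_set_def)

theorem curve_X: "curve X"
  unfolding curve_def
proof (intro conjI)
  show "\<exists>n C. closedin (zariski n) C \<and> X = subtopology (zariski n) C"
    using closedin_carrier_set X_def by blast
  show "irreducible_space X" "has_dimension X 1" by (rule X_topology)+
  show "\<forall>Q\<in>topspace X. \<exists>t. local_parameter X Q t"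
    unfolding topspace_X using uniformizer_exists uniformizer_local_parameter by blast
qed

text \<open>A rational function without poles at finite points lies in \<open>A\<close> by
  \<open>regular_everywhere_affine\<close>, and \<open>order_at_infinity\<close> converts its pole
  order there.\<close>

theorem weierstrass_semigroup_infinity:
  "weierstrass_semigroup X (phi None) = {d. \<exists>a\<in>A. a \<noteq> 0 \<and> fls_subdegree a = - int (e * d)}"
proof -
  have polar: "polar_divisor X (Phi q) = (\<lambda>Q. if Q = phi None then d else 0) \<longleftrightarrow>
      q \<in> A \<and> fls_subdegree q = - int (e * d)" if q: "q \<in> K" "q \<noteq> 0" for q d
  proof
    assume pd: "polar_divisor X (Phi q) = (\<lambda>Q. if Q = phi None then d else 0)"
    have "q \<in> O\<^sub>v (Some s)" if "is_point A s" for s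
    proof -
      have P: "Some s \<in> pts" using that by (simp add: points_def)
      then have "phi (Some s) \<noteq> phi None" using phi_inj by (metis None_pts inj_onD option.distinct(1))
      then have "nat (- order_at X (phi (Some s)) (Phi q)) = 0"
        using fun_cong[OF pd, of "phi (Some s)"] P by (simp add: polar_divisor_def topspace_X)
      then show ?thesis using order_nonneg_iff[OF P q] by simp
    qed
    then have qA: "q \<in> A" using regular_everywhere_affine q by blast
    have "nat (- order_at X (phi None) (Phi q)) = d"
      using fun_cong[OF pd, of "phi None"] by (simp add: polar_divisor_def topspace_X)
    moreover have "int e * order_at X (phi None) (Phi q) \<le> 0"
      using order_at_infinity[OF q] subdegree_le_0[OF qA] by simp
    then have "order_at X (phi None) (Phi q) \<le> 0" using e_pos by (simp add: mult_le_0_iff)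
    ultimately have "order_at X (phi None) (Phi q) = - int d" by linarith
    then show "q \<in> A \<and> fls_subdegree q = - int (e * d)" using qA order_at_infinity[OF q] by simp
  next
    assume qA: "q \<in> A \<and> fls_subdegree q = - int (e * d)"
    have "int e * order_at X (phi None) (Phi q) = int e * - int d" using order_at_infinity[OF q] qA by simp
    moreover have "int e \<noteq> 0" using e_pos by simp
    ultimately have "order_at X (phi None) (Phi q) = - int d" by (metis mult_left_cancel)
    moreover have "order_at X (phi P) (Phi q) \<ge> 0" if "P \<in> pts" "P \<noteq> None" for P
      using that affine_place(1) qA order_nonneg_iff[OF that(1) q] by (auto simp: points_def)
    ultimately show "polar_divisor X (Phi q) = (\<lambda>Q. if Q = phi None then d else 0)"
      unfolding polar_divisor_def topspace_X fun_eq_iff by (auto simp: points_def)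
  qed
  have "weierstrass_semigroup X (phi None) =
      {d. \<exists>q\<in>K. q \<noteq> 0 \<and> polar_divisor X (Phi q) = (\<lambda>Q. if Q = phi None then d else 0)}"
    unfolding weierstrass_semigroup_def carrier_FF Phi_zero using Phi_inj by force
  also have "\<dots> = {d. \<exists>a\<in>A. a \<noteq> 0 \<and> fls_subdegree a = - int (e * d)}"
    using polar fractions_subset by blast
  finally show ?thesis .
qed

end

section \<open>Morphisms between projective curves\<close>

lemma regular_at_open_subtopology:
  assumes U: "openin X U" "P \<in> U"
  shows "regular_at (subtopology X U) f P \<longleftrightarrow> regular_at X f P"
proof
  assume "regular_at (subtopology X U) f P"
  then show "regular_at X f P"
    unfolding regular_at_def openin_open_subtopology[OF U(1)] by blast
next
  assume "regular_at X f P"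
  then obtain V g h d where V: "openin X V" "P \<in> V" "homogeneous d g" "homogeneous d h"
    "\<forall>Q\<in>V. \<forall>x\<in>Q. mpoly_eval h x \<noteq> 0 \<and> f Q = mpoly_eval g x / mpoly_eval h x"
    unfolding regular_at_def by blast
  then have "openin X (V \<inter> U)" using U(1) by blast
  then show "regular_at (subtopology X U) f P"
    unfolding regular_at_def openin_open_subtopology[OF U(1)]
    using V U(2) by (intro exI[of _ "V \<inter> U"] exI[of _ g] exI[of _ h] exI[of _ d]) auto
qed

context embedded_curve
begin

section \<open>Charts and the module structure over polynomials in \<open>g\<close>\<close>

definition chart :: "'k fls \<Rightarrow> 'k ppoint set" where
  "chart h = phi ` {P \<in> pts. ev 1 P h \<noteq> 0}"

lemma openin_chart:
  assumes "h \<in> L 1" "h \<noteq> 0"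
  shows "openin X (chart h)"
  unfolding chart_def
proof (rule openin_X_image)
  have "pts - {P \<in> pts. ev 1 P h \<noteq> 0} = {P \<in> pts. ev 1 P h = 0}" by auto
  then show "finite (pts - {P \<in> pts. ev 1 P h \<noteq> 0})" using ev_finite[OF assms] by simp
qed auto

lemma chart_nonempty:
  assumes "h \<in> L 1" "h \<noteq> 0" shows "{P \<in> pts. ev 1 P h \<noteq> 0} \<noteq> {}"
proof (rule cofinite_nonempty)
  have "pts - {P \<in> pts. ev 1 P h \<noteq> 0} = {P \<in> pts. ev 1 P h = 0}" by auto
  then show "finite (pts - {P \<in> pts. ev 1 P h \<noteq> 0})" using ev_finite[OF assms] by simp
qed

definition chart_ring :: "'k fls \<Rightarrow> 'k fls set" where
  "chart_ring h = {q \<in> K. \<forall>P\<in>pts. ev 1 P h \<noteq> 0 \<longrightarrow> q \<in> O\<^sub>v P}"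

text \<open>The local fractions agree with \<open>f\<close> on cofinite sets and hence coincide, so
  one fraction represents \<open>f\<close> on the entire chart.\<close>

lemma regular_on_chart:
  assumes h: "h \<in> L 1" "h \<noteq> 0" and f: "regular_on X (chart h) f"
  obtains q where "q \<in> chart_ring h" "\<And>P. P \<in> pts \<Longrightarrow> ev 1 P h \<noteq> 0 \<Longrightarrow> f (phi P) = val P q"
proof -
  have loc: "\<exists>q\<in>O\<^sub>v P. f (phi P) = val P q \<and> agrees f q" if "P \<in> pts" "ev 1 P h \<noteq> 0" for P
    using f that regular_at_iff[OF that(1)] unfolding regular_on_def chart_def by blast
  obtain P0 where P0: "P0 \<in> pts" "ev 1 P0 h \<noteq> 0" using chart_nonempty[OF h] by blast
  obtain q where q: "q \<in> O\<^sub>v P0" "agrees f q" using loc[OF P0] by blast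
  have qK: "q \<in> K" using place_fractions[OF P0(1) q(1)] .
  have all: "q \<in> O\<^sub>v P \<and> f (phi P) = val P q" if P: "P \<in> pts" "ev 1 P h \<noteq> 0" for P
  proof -
    obtain r where r: "r \<in> O\<^sub>v P" "f (phi P) = val P r" "agrees f r" using loc[OF P] by blast
    have "r = q" by (rule agrees_unique[OF r(3) q(2) place_fractions[OF P(1) r(1)] qK])
    then show ?thesis using r by simp
  qed
  have "q \<in> chart_ring h" unfolding chart_ring_def using qK all by blast
  then show thesis using that all by blast
qed

lemma chart_ring_regular: "q \<in> chart_ring h \<Longrightarrow> regular_on X (chart h) (value_function q)"
  unfolding regular_on_def chart_def chart_ring_def using regular_value_function by blast

lemma val_sum:
  assumes P: "P \<in> pts" and "\<And>i. i \<in> I \<Longrightarrow> f i \<in> O\<^sub>v P"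
  shows "sum f I \<in> O\<^sub>v P \<and> val P (sum f I) = (\<Sum>i\<in>I. val P (f i))"
  using assms(2)
  by (induction I rule: infinite_finite_induct) (auto simp: P place_add[OF P] val_add[OF P])

text \<open>For \<open>m \<ge> 2\<close>, a pole order above \<open>m * N\<close> is still at least
  \<open>M\<close> after \<open>N\<close> is subtracted, so the leading term is that of
  \<open>g\<close> times an element of \<open>L m\<close>.\<close>

lemma L_step:
  assumes "a \<in> A" "a \<in> L (Suc m)" "m \<ge> 2"
  shows "\<exists>b\<in>L m. a - g * b \<in> L m"
  using assms(1,2)
proof (induction a rule: pole_descent)
  case zero
  show ?case by (intro bexI[of _ 0]) auto
next
  case (reduce a)
  show ?case
  proof (cases "a \<in> L m")
    case True
    then show ?thesis by (intro bexI[of _ 0]) auto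
  next
    case False
    define k where "k = nat (- fls_subdegree a) - N"
    have "N \<le> m * N" using assms(3) by simp
    have big: "- fls_subdegree a > int (m * N)" using False reduce by (auto simp: pole_space_def)
    have "2 * N \<le> m * N" using assms(3) by (intro mult_right_mono) auto
    then have "int (2 * N) \<le> int (m * N)" by (simp only: of_nat_le_iff)
    then have big': "- fls_subdegree a > 2 * int N" using big by simp
    then have k: "int k = - fls_subdegree a - int N" "k \<ge> M" using N_large unfolding k_def by linarith+
    have "int e dvd int k" unfolding k(1) using e_dvd_subdegree[OF reduce(1)] N_dvd by (auto intro!: dvd_diff)
    then have "e dvd k" by (simp only: int_dvd_int_iff)
    then obtain b where b: "b \<in> A" "fls_subdegree b = - int k" using M_poles k by blast
    have "b \<noteq> 0" using b k M_pos by auto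
    have bL: "b \<in> L m" using b k reduce.prems by (simp add: pole_space_def algebra_simps)
    have "fls_subdegree a = fls_subdegree (g * b)" using b \<open>b \<noteq> 0\<close> k by (simp add: g_subdegree)
    then obtain c where c: "a - fls_const c * (g * b) = 0 \<or> fls_subdegree (a - fls_const c * (g * b)) > fls_subdegree a"
      using fls_cancel_leading[of "g * b" a] \<open>b \<noteq> 0\<close> reduce(2) by auto
    let ?r = "a - fls_const c * (g * b)"
    have gb: "g * b \<in> L (1 + m)" by (rule L_mult[OF g_pole_space bL])
    have r: "?r \<in> L (Suc m)" using gb by (intro diff_pole_space[OF reduce.prems] scale_pole_space) simp
    then obtain b' where b': "b' \<in> L m" "?r - g * b' \<in> L m" using reduce.IH[OF L_in[OF r] c] by blast
    have "a - g * (fls_const c * b + b') = ?r - g * b'" by (simp add: algebra_simps)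
    then have "a - g * (fls_const c * b + b') \<in> L m" using b'(2) by (simp only:)
    moreover have "fls_const c * b + b' \<in> L m" by (rule add_pole_space[OF scale_pole_space[OF bL] b'(1)])
    ultimately show ?thesis by blast
  qed
qed

text \<open>A spanning set of \<open>L 2\<close> generates everything over the polynomials in
  \<open>g\<close>. The degree bound keeps the coefficients regular at infinity after division by
  \<open>g ^ j\<close>.\<close>

lemma L_finite_module:
  assumes span: "\<forall>a\<in>L 2. \<exists>c. a = (\<Sum>w\<in>T. fls_const (c w) * w)" and T: "finite T"
    and a: "a \<in> L (2 + j)"
  shows "\<exists>p. (\<forall>w. degree (p w) \<le> j) \<and> a = (\<Sum>w\<in>T. peval (p w) g * w)"
  using a
proof (induction j arbitrary: a)
  case 0
  then obtain c where "a = (\<Sum>w\<in>T. fls_const (c w) * w)" using span by auto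
  then show ?case by (intro exI[of _ "\<lambda>w. [:c w:]"]) simp
next
  case (Suc j)
  have aL: "a \<in> L (Suc (2 + j))" using Suc.prems by simp
  obtain b where b: "b \<in> L (2 + j)" "a - g * b \<in> L (2 + j)" using L_step[OF L_in[OF aL] aL] by auto
  obtain p where p: "\<forall>w. degree (p w) \<le> j" "b = (\<Sum>w\<in>T. peval (p w) g * w)" using Suc.IH[OF b(1)] by (elim exE conjE)
  obtain p' where p': "\<forall>w. degree (p' w) \<le> j" "a - g * b = (\<Sum>w\<in>T. peval (p' w) g * w)" using Suc.IH[OF b(2)] by (elim exE conjE)
  let ?r = "\<lambda>w. pCons 0 (p w) + p' w"
  have "degree (?r w) \<le> Suc j" for w
    using p(1) p'(1) by (intro degree_add_le) (auto intro: order_trans[OF degree_pCons_le] le_SucI)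
  moreover have "a = (\<Sum>w\<in>T. peval (?r w) g * w)"
  proof -
    have "(\<Sum>w\<in>T. peval (?r w) g * w) = g * (\<Sum>w\<in>T. peval (p w) g * w) + (\<Sum>w\<in>T. peval (p' w) g * w)"
      by (simp add: peval_add distrib_right sum.distrib sum_distrib_left mult.assoc)
    also have "\<dots> = g * b + (a - g * b)" unfolding p(2)[symmetric] p'(2)[symmetric] ..
    finally show ?thesis by simp
  qed
  ultimately show ?case by (intro exI[of _ ?r]) blast
qed

lemma peval_g_L: "degree p \<le> j \<Longrightarrow> peval p g \<in> L j"
proof (induction p arbitrary: j)
  case (pCons c p)
  show ?case
  proof (cases "p = 0")
    case False
    then obtain i where i: "j = Suc i" "degree p \<le> i" using pCons.prems by (cases j) auto
    have "g * peval p g \<in> L (1 + i)" by (rule L_mult[OF g_pole_space pCons.IH[OF i(2)]])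
    then show ?thesis using i(1) by (auto intro!: add_pole_space)
  qed simp
qed simp

lemma chart_ring_1: "chart_ring 1 = A"
proof (rule equalityI; rule subsetI)
  fix q assume q: "q \<in> chart_ring 1"
  have "q \<in> O\<^sub>v (Some s)" if "is_point A s" for s
  proof -
    have "Some s \<in> pts" "ev 1 (Some s) 1 \<noteq> 0" using that by (auto simp: points_def)
    then show ?thesis using q by (auto simp: chart_ring_def)
  qed
  then show "q \<in> A" using regular_everywhere_affine q by (auto simp: chart_ring_def)
next
  fix q assume q: "q \<in> A"
  have "ev 1 None 1 = 0" using ev_None_nonzero_iff[of 1 1] N_pos by auto
  then show "q \<in> chart_ring 1"
    using q affine_place(1) fractions_subset by (auto simp: chart_ring_def points_def)
qed

text \<open>Regularity off the zeros of \<open>g\<close> makes the denominator a power of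
  \<open>g\<close>; regularity at infinity bounds the pole order of the numerator.\<close>

lemma chart_ring_g: "q \<in> chart_ring g \<longleftrightarrow> (\<exists>m. \<exists>a\<in>L m. q = a / g ^ m)"
proof
  assume q: "q \<in> chart_ring g"
  then have qK: "q \<in> K" by (simp add: chart_ring_def)
  have "q \<in> O\<^sub>v (Some s)" if "is_point A s" "s g \<noteq> 0" for s
    using q that by (auto simp: chart_ring_def points_def)
  then obtain m where m: "q * g ^ m \<in> A" using regular_away_from_zeros[OF g_in g_nonzero qK] by blast
  have "ev 1 None g \<noteq> 0" using ev_None_nonzero_iff[OF g_pole_space] g_subdegree by simp
  then have "q \<in> O\<^sub>v None" using q None_pts unfolding chart_ring_def by blast
  then have "fls_subdegree q \<ge> 0" using place_None_iff[OF qK] by simp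
  then have "q * g ^ m \<in> L m" using m by (cases "q = 0") (auto simp: pole_space_def)
  then show "\<exists>m. \<exists>a\<in>L m. q = a / g ^ m" by (intro exI bexI[of _ "q * g ^ m"]) auto
next
  assume "\<exists>m. \<exists>a\<in>L m. q = a / g ^ m"
  then obtain m a where a: "a \<in> L m" "q = a / g ^ m" by blast
  have gm: "g ^ m \<in> L m" using power_pole_space[OF g_pole_space, of m] by simp
  have "q \<in> O\<^sub>v P" if P: "P \<in> pts" "ev 1 P g \<noteq> 0" for P
  proof -
    have "ev m P (g ^ m) \<noteq> 0" using ev_power[OF P(1) g_pole_space, of m] P(2) by simp
    then show ?thesis using local_quotientI[OF a(1) gm] local_quotient_in a(2) by blast
  qed
  moreover have "q \<in> K" unfolding a(2) by (intro fractionsI L_in[OF a(1)] L_in[OF gm]) simp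
  ultimately show "q \<in> chart_ring g" by (simp add: chart_ring_def)
qed

end

text \<open>Both curves share \<open>N\<close> and \<open>g\<close>, with \<open>g\<close> in the
  smaller algebra. Degrees then match, and an element of \<open>B\<close> has the same value at a
  point and at its restriction, also at infinity.\<close>

locale curve_pair =
  A: embedded_curve A e M N g n gs + B: embedded_curve B e' M' N g n' gs'
  for A :: "'k::{alg_closed_field, field_char_0} fls set" and e M N g n gs B e' M' n' gs' +
  assumes B_subset: "B \<subseteq> A"
begin

definition restriction :: "('k fls \<Rightarrow> 'k) option \<Rightarrow> ('k fls \<Rightarrow> 'k) option" where
  "restriction P = map_option (\<lambda>s a. if a \<in> B then s a else 0) P"

definition projection :: "'k ppoint \<Rightarrow> 'k ppoint" where
  "projection Q = B.phi (restriction (the_inv_into A.pts A.phi Q))"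

lemma restriction_None [simp]: "restriction None = None"
  and restriction_eq_None [simp]: "restriction P = None \<longleftrightarrow> P = None"
  by (auto simp: restriction_def)

lemma restriction_pts: "P \<in> A.pts \<Longrightarrow> restriction P \<in> B.pts"
proof (cases P)
  case None
  then show ?thesis by (simp add: points_def)
next
  case (Some s)
  assume "P \<in> A.pts"
  then have s: "is_point A s" using Some by (auto simp: points_def)
  have "is_point B (\<lambda>a. if a \<in> B then s a else 0)"
    unfolding is_point_def
    using A.point_add[OF s] A.point_mult[OF s] A.point_const[OF s] B.add_in B.mult_in subsetD[OF B_subset] by simp
  then show ?thesis using Some by (simp add: restriction_def points_def)
qed

lemma projection_phi [simp]: "P \<in> A.pts \<Longrightarrow> projection (A.phi P) = B.phi (restriction P)"
  by (simp add: projection_def the_inv_into_f_f[OF A.phi_inj])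

lemma B_L_subset: "a \<in> B.L m \<Longrightarrow> a \<in> A.L m"
  using B_subset by (auto simp: pole_space_def)

lemma ev_restriction: "a \<in> B \<Longrightarrow> form_value g m (restriction P) a = form_value g m P a"
  by (cases P) (auto simp: restriction_def)

lemma local_quotient_restriction:
  "B.local_quotient (restriction P) q c \<Longrightarrow> A.local_quotient P q c"
proof -
  assume "B.local_quotient (restriction P) q c"
  then obtain m a b where ab: "a \<in> B.L m" "b \<in> B.L m" "form_value g m (restriction P) b \<noteq> 0" "q = a / b"
    "c = form_value g m (restriction P) a / form_value g m (restriction P) b"
    unfolding B.local_quotient_def by blast
  note ev = ev_restriction[OF B.L_in[OF ab(1)]] ev_restriction[OF B.L_in[OF ab(2)]]
  show ?thesis
    using A.local_quotientI[OF B_L_subset[OF ab(1)] B_L_subset[OF ab(2)], of P] ab(3-5) unfolding ev by simp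
qed

lemma place_restriction:
  assumes "P \<in> A.pts" "q \<in> B.place_ring (restriction P)"
  shows "q \<in> A.place_ring P" "A.val P q = B.val (restriction P) q"
proof -
  have "A.local_quotient P q (B.val (restriction P) q)"
    using local_quotient_restriction B.place_ring_val[OF restriction_pts[OF assms(1)] assms(2)] by blast
  then show "q \<in> A.place_ring P" "A.val P q = B.val (restriction P) q"
    using A.local_quotient_in A.val_eq[OF assms(1)] by blast+
qed

text \<open>Points over \<open>s\<close> are zeros of \<open>g - fls_const (s g)\<close>, which is
  nonzero because \<open>g\<close> has a pole.\<close>

lemma finite_fibre:
  assumes "Q \<in> B.pts"
  shows "finite {P \<in> A.pts. restriction P = Q}"
proof (cases Q)
  case None
  then have "{P \<in> A.pts. restriction P = Q} \<subseteq> {None}" by auto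
  then show ?thesis using finite_subset by blast
next
  case (Some s)
  then have s: "is_point B s" using assms by (auto simp: points_def)
  let ?b = "g - fls_const (s g)"
  have b: "?b \<in> B.L 1" using B.g_pole_space by (intro B.diff_pole_space) auto
  have "?b \<noteq> 0"
  proof
    assume "?b = 0"
    then have "g = fls_const (s g)" by simp
    then have "fls_subdegree g = 0" by (metis fls_const_subdegree)
    then show False using B.g_subdegree B.N_pos by simp
  qed
  have "{P \<in> A.pts. restriction P = Q} \<subseteq> {P \<in> A.pts. form_value g 1 P ?b = 0}"
  proof
    fix P assume P: "P \<in> {P \<in> A.pts. restriction P = Q}"
    have "form_value g 1 P ?b = form_value g 1 Q ?b" using ev_restriction[OF B.L_in[OF b]] P by auto
    also have "\<dots> = 0" using Some s B.g_in by (simp add: B.point_diff)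
    finally show "P \<in> {P \<in> A.pts. form_value g 1 P ?b = 0}" using P by simp
  qed
  then show ?thesis using A.ev_finite[OF B_L_subset[OF b] \<open>?b \<noteq> 0\<close>] finite_subset by blast
qed

lemma finite_preimage:
  assumes "finite S" "S \<subseteq> B.pts"
  shows "finite {P \<in> A.pts. restriction P \<in> S}"
proof -
  have "{P \<in> A.pts. restriction P \<in> S} = (\<Union>Q\<in>S. {P \<in> A.pts. restriction P = Q})" by auto
  moreover have "finite (\<Union>Q\<in>S. {P \<in> A.pts. restriction P = Q})"
    using assms finite_fibre by (intro finite_UN_I) auto
  ultimately show ?thesis by simp
qed

lemma preimage_eq: "{Q \<in> topspace A.X. projection Q \<in> V} = A.phi ` {P \<in> A.pts. B.phi (restriction P) \<in> V}"
  by (auto simp: A.topspace_X)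

lemma openin_preimage:
  assumes "openin B.X V"
  shows "openin A.X {Q \<in> topspace A.X. projection Q \<in> V}"
proof (cases "V = {}")
  case False
  have "finite {P \<in> A.pts. restriction P \<in> {Q \<in> B.pts. B.phi Q \<notin> V}}"
    by (rule finite_preimage[OF B.openin_X_cofinite[OF assms False]]) auto
  moreover have "A.pts - {P \<in> A.pts. B.phi (restriction P) \<in> V} =
      {P \<in> A.pts. restriction P \<in> {Q \<in> B.pts. B.phi Q \<notin> V}}"
    using restriction_pts by auto
  ultimately have "openin A.X (A.phi ` {P \<in> A.pts. B.phi (restriction P) \<in> V})"
    by (intro A.openin_X_image) auto
  then show ?thesis unfolding preimage_eq .
qed simp

lemma agrees_pullback:
  assumes "B.agrees f q" shows "A.agrees (f \<circ> projection) q"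
  unfolding A.agrees_def
proof (rule finite_subset)
  let ?S = "{Q \<in> B.pts. \<not> (q \<in> B.place_ring Q \<and> f (B.phi Q) = B.val Q q)}"
  show "{P \<in> A.pts. \<not> (q \<in> A.place_ring P \<and> (f \<circ> projection) (A.phi P) = A.val P q)} \<subseteq> {P \<in> A.pts. restriction P \<in> ?S}"
    using place_restriction restriction_pts by auto
  show "finite {P \<in> A.pts. restriction P \<in> ?S}"
    using assms by (intro finite_preimage) (auto simp: B.agrees_def)
qed

lemma regular_pullback:
  assumes P: "P \<in> A.pts" and "regular_at B.X f (B.phi (restriction P))"
  shows "regular_at A.X (f \<circ> projection) (A.phi P)"
proof -
  obtain q where q: "q \<in> B.place_ring (restriction P)" "f (B.phi (restriction P)) = B.val (restriction P) q" "B.agrees f q"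
    using B.regular_at_iff[OF restriction_pts[OF P]] assms(2) by blast
  show ?thesis
    unfolding A.regular_at_iff[OF P]
    using agrees_pullback[OF q(3)] place_restriction[OF P q(1)] q(2) P by (intro bexI[of _ q]) simp_all
qed

lemma morphism_open:
  assumes V: "openin B.X V"
  defines "U \<equiv> {Q \<in> topspace A.X. projection Q \<in> V}"
  shows "morphism (subtopology A.X U) (subtopology B.X V) projection"
  unfolding morphism_def
proof (intro conjI allI impI)
  have U: "openin A.X U" unfolding U_def by (rule openin_preimage[OF V])
  have topU: "topspace (subtopology A.X U) = U" using openin_subset[OF U] by auto
  have topV: "topspace (subtopology B.X V) = V" using openin_subset[OF V] by auto
  show "continuous_map (subtopology A.X U) (subtopology B.X V) projection"
    unfolding continuous_map_def topU topV
  proof (intro conjI allI impI)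
    show "projection \<in> U \<rightarrow> V" by (auto simp: U_def)
    fix W assume "openin (subtopology B.X V) W"
    then have W: "openin B.X W" "W \<subseteq> V" using openin_open_subtopology[OF V] by auto
    have "{x \<in> U. projection x \<in> W} = {Q \<in> topspace A.X. projection Q \<in> W}" using W by (auto simp: U_def)
    then show "openin (subtopology A.X U) {x \<in> U. projection x \<in> W}"
      using openin_preimage[OF W(1)] openin_open_subtopology[OF U] by auto
  qed
  fix W f assume W: "openin (subtopology B.X V) W \<and> regular_on (subtopology B.X V) W f"
  then have WV: "W \<subseteq> V" using openin_open_subtopology[OF V] by auto
  show "regular_on (subtopology A.X U) {P \<in> topspace (subtopology A.X U). projection P \<in> W} (f \<circ> projection)"
    unfolding regular_on_def topU
  proof
    fix Q assume Q: "Q \<in> {P \<in> U. projection P \<in> W}"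
    then obtain P where P: "P \<in> A.pts" "Q = A.phi P" unfolding U_def preimage_eq by auto
    have "regular_at (subtopology B.X V) f (projection Q)" using W Q by (simp add: regular_on_def)
    then have "regular_at B.X f (projection Q)" using regular_at_open_subtopology[OF V] Q WV by blast
    then have "regular_at A.X (f \<circ> projection) Q" using regular_pullback P by simp
    then show "regular_at (subtopology A.X U) (f \<circ> projection) Q" using regular_at_open_subtopology[OF U] Q by blast
  qed
qed

lemma morphism_projection: "morphism A.X B.X projection"
proof -
  have "projection Q \<in> topspace B.X" if "Q \<in> topspace A.X" for Q
    using that restriction_pts by (auto simp: A.topspace_X B.topspace_X)
  then have "{Q \<in> topspace A.X. projection Q \<in> topspace B.X} = topspace A.X" by auto
  then show ?thesis using morphism_open[of "topspace B.X"] by simp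
qed

lemma preimage_chart:
  assumes "h \<in> B.L 1"
  shows "{Q \<in> topspace A.X. projection Q \<in> B.chart h} = A.chart h"
proof -
  have "B.phi (restriction P) \<in> B.chart h \<longleftrightarrow> form_value g 1 P h \<noteq> 0" if P: "P \<in> A.pts" for P
  proof -
    have "B.phi (restriction P) \<in> B.chart h \<longleftrightarrow> form_value g 1 (restriction P) h \<noteq> 0"
      unfolding B.chart_def using restriction_pts[OF P] B.phi_inj by (auto simp: inj_on_def)
    then show ?thesis using ev_restriction[OF B.L_in[OF assms]] by simp
  qed
  then show ?thesis unfolding preimage_eq A.chart_def by (intro arg_cong[of _ _ "image A.phi"]) auto
qed

end

text \<open>Re-embedding with \<open>h\<close> as first coordinate turns the chart of \<open>h\<close> into an affine piece.\<close>

lemma (in embedded_curve) affine_chart: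
  assumes h: "h \<in> L 1" "h \<noteq> 0"
  shows "affine_variety (subtopology X (chart h))"
proof -
  define gs2 where "gs2 i = (if i = 0 then h else gs (i - 1))" for i
  interpret E: embedded_curve A e M N g "Suc n" gs2
  proof unfold_locales
    show "gs2 i \<in> pole_space A N" for i using h gs_in by (simp add: gs2_def)
    show "gs2 i = 0" if "i > Suc n" for i using that gs_out by (simp add: gs2_def)
    fix a assume "a \<in> pole_space A N"
    then obtain c where c: "a = (\<Sum>i\<le>n. fls_const (c i) * gs i)" using gs_span by blast
    have "(\<Sum>i\<le>Suc n. fls_const (if i = 0 then 0 else c (i - 1)) * gs2 i) = a"
      unfolding sum.atMost_Suc_shift c by (simp add: gs2_def)
    then show "\<exists>c. a = (\<Sum>i\<le>Suc n. fls_const (c i) * gs2 i)" by (intro exI[of _ "\<lambda>i. if i = 0 then 0 else c (i - 1)"]) simp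
  qed (use M_pos M_dvd M_poles N_large N_dvd g_in g_subdegree in auto)
  \<comment> \<open>For equal algebras the restriction of points is the identity, so the projections
    of \<open>F\<close> and \<open>G\<close> between the two embeddings are mutually
    inverse.\<close>
  interpret F: curve_pair A e M N g n gs A e M "Suc n" gs2 by unfold_locales simp
  interpret G: curve_pair A e M N g "Suc n" gs2 A e M n gs by unfold_locales simp
  have id: "F.restriction P = P" if "P \<in> pts" for P
    using that point_outside by (cases P) (auto simp: F.restriction_def points_def fun_eq_iff)
  have rest: "G.restriction P = F.restriction P" for P by (simp add: F.restriction_def G.restriction_def)
  have inv1: "G.projection (F.projection Q) = Q" if "Q \<in> topspace X" for Q
    using that id rest by (auto simp: topspace_X)
  have inv2: "F.projection (G.projection Q) = Q" if "Q \<in> topspace E.X" for Q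
    using that id rest by (auto simp: E.topspace_X)
  have eqF: "{Q \<in> topspace X. F.projection Q \<in> E.chart h} = chart h" by (rule F.preimage_chart[OF h(1)])
  have eqG: "{Q \<in> topspace E.X. G.projection Q \<in> chart h} = E.chart h" by (rule G.preimage_chart[OF h(1)])
  have chartE: "{P \<in> E.carrier_set. \<forall>x\<in>P. x 0 \<noteq> 0} = E.chart h"
  proof -
    have "(\<forall>x\<in>E.phi P. x 0 \<noteq> 0) \<longleftrightarrow> ev 1 P h \<noteq> 0" for P
    proof -
      have "(\<forall>x\<in>E.phi P. x 0 \<noteq> 0) \<longleftrightarrow> ev 1 P (gs2 0) \<noteq> 0"
        using E.crd_mem[of P] E.phi_members[of _ P] by fastforce
      then show ?thesis by (simp add: gs2_def)
    qed
    then show ?thesis by (auto simp: E.carrier_set_def E.chart_def)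
  qed
  have sub: "E.chart h \<subseteq> E.carrier_set" by (auto simp: E.carrier_set_def E.chart_def)
  have top: "subtopology (zariski (Suc n)) {P \<in> E.carrier_set. \<forall>x\<in>P. x 0 \<noteq> 0} = subtopology E.X (E.chart h)"
    unfolding chartE E.X_def subtopology_subtopology using sub by (simp add: Int_absorb1)
  have mF: "morphism (subtopology X (chart h)) (subtopology E.X (E.chart h)) F.projection"
    using F.morphism_open[OF E.openin_chart[OF h]] unfolding eqF .
  have mG: "morphism (subtopology E.X (E.chart h)) (subtopology X (chart h)) G.projection"
    using G.morphism_open[OF openin_chart[OF h]] unfolding eqG .
  show ?thesis
    unfolding affine_variety_def
  proof (intro exI conjI)
    show "closedin (zariski (Suc n)) E.carrier_set" by (rule E.closedin_carrier_set)
    show "let A = subtopology (zariski (Suc n)) {P \<in> E.carrier_set. \<forall>x\<in>P. x 0 \<noteq> 0} in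
        morphism (subtopology X (chart h)) A F.projection \<and> morphism A (subtopology X (chart h)) G.projection \<and>
        (\<forall>P\<in>topspace (subtopology X (chart h)). G.projection (F.projection P) = P) \<and>
        (\<forall>Q\<in>topspace A. F.projection (G.projection Q) = Q)"
      unfolding top Let_def using mF mG inv1 inv2 by auto
  qed
qed

context curve_pair
begin

text \<open>A finite morphism has its coefficients indexed by the generating functions themselves.
  Generators are therefore passed as an injective family \<open>w\<close>, and the index is
  recovered by \<open>the_inv_into\<close>.\<close>

lemma finite_chart:
  assumes h: "h \<in> B.L 1" and T: "finite T" and w: "\<And>t. t \<in> T \<Longrightarrow> w t \<in> A.chart_ring h" "inj_on w T"
    and gen: "\<And>q. q \<in> A.chart_ring h \<Longrightarrow> \<exists>c. (\<forall>t\<in>T. c t \<in> B.chart_ring h) \<and> q = (\<Sum>t\<in>T. c t * w t)"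
    and h0: "h \<noteq> 0"
  shows "\<exists>S. finite S \<and> (\<forall>b\<in>S. regular_on A.X (A.chart h) b) \<and>
     (\<forall>f. regular_on A.X (A.chart h) f \<longrightarrow>
        (\<exists>c. (\<forall>b\<in>S. regular_on B.X (B.chart h) (c b)) \<and>
             (\<forall>P\<in>A.chart h. f P = (\<Sum>b\<in>S. c b (projection P) * b P))))"
proof (intro exI[of _ "(\<lambda>t. A.value_function (w t)) ` T"] conjI ballI allI impI)
  let ?b = "\<lambda>t. A.value_function (w t)"
  have wK: "w t \<in> A.K" if "t \<in> T" for t using w(1)[OF that] by (simp add: A.chart_ring_def)
  have inj: "inj_on ?b T"
  proof (rule inj_onI)
    fix t t' assume t: "t \<in> T" "t' \<in> T" "?b t = ?b t'"
    then have "A.Phi (w t) = A.Phi (w t')" by (simp add: A.Phi_def)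
    then have "w t = w t'" using A.Phi_inj wK t by blast
    then show "t = t'" using w(2) t by (auto dest: inj_onD)
  qed
  show "finite (?b ` T)" using T by simp
  show "regular_on A.X (A.chart h) b" if "b \<in> ?b ` T" for b
    using that w(1) A.chart_ring_regular by auto
  fix f assume "regular_on A.X (A.chart h) f"
  then obtain q where q: "q \<in> A.chart_ring h" "\<And>P. P \<in> A.pts \<Longrightarrow> form_value g 1 P h \<noteq> 0 \<Longrightarrow> f (A.phi P) = A.val P q"
    by (rule A.regular_on_chart[OF B_L_subset[OF h] h0]) blast
  obtain c where c: "\<forall>t\<in>T. c t \<in> B.chart_ring h" "q = (\<Sum>t\<in>T. c t * w t)" using gen[OF q(1)] by blast
  show "\<exists>c. (\<forall>b\<in>?b ` T. regular_on B.X (B.chart h) (c b)) \<and>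
      (\<forall>P\<in>A.chart h. f P = (\<Sum>b\<in>?b ` T. c b (projection P) * b P))"
  proof (intro exI[of _ "\<lambda>b. B.value_function (c (the_inv_into T ?b b))"] conjI ballI)
    fix b assume "b \<in> ?b ` T"
    then show "regular_on B.X (B.chart h) (B.value_function (c (the_inv_into T ?b b)))"
      using c(1) by (auto simp: the_inv_into_f_f[OF inj] intro!: B.chart_ring_regular)
  next
    fix Q assume "Q \<in> A.chart h"
    then obtain P where P: "P \<in> A.pts" "form_value g 1 P h \<noteq> 0" "Q = A.phi P" by (auto simp: A.chart_def)
    have rP: "restriction P \<in> B.pts" "form_value g 1 (restriction P) h \<noteq> 0"
      using restriction_pts[OF P(1)] ev_restriction[OF B.L_in[OF h]] P(2) by auto
    have cO: "c t \<in> A.place_ring P" "A.val P (c t) = B.val (restriction P) (c t)" if "t \<in> T" for t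
    proof -
      have "c t \<in> B.place_ring (restriction P)" using c(1) that rP by (auto simp: B.chart_ring_def)
      then show "c t \<in> A.place_ring P" "A.val P (c t) = B.val (restriction P) (c t)"
        using place_restriction[OF P(1)] by auto
    qed
    have wO: "w t \<in> A.place_ring P" if "t \<in> T" for t using w(1)[OF that] P by (auto simp: A.chart_ring_def)
    have "f Q = A.val P q" using q(2) P by simp
    also have "\<dots> = (\<Sum>t\<in>T. A.val P (c t * w t))"
      unfolding c(2) using A.val_sum[OF P(1), of T "\<lambda>t. c t * w t"] cO(1) wO A.place_mult[OF P(1)] by blast
    also have "\<dots> = (\<Sum>t\<in>T. B.value_function (c t) (projection Q) * ?b t Q)"
      using cO wO P rP by (intro sum.cong refl) (simp add: A.val_mult)
    also have "\<dots> = (\<Sum>b\<in>?b ` T. B.value_function (c (the_inv_into T ?b b)) (projection Q) * b Q)"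
      by (subst sum.reindex[OF inj]) (auto intro!: sum.cong simp: the_inv_into_f_f[OF inj])
    finally show "f Q = (\<Sum>b\<in>?b ` T. B.value_function (c (the_inv_into T ?b b)) (projection Q) * b Q)" .
  qed
qed

text \<open>A spanning set of \<open>L 2\<close> generates the affine part directly. Near infinity
  its elements are divided by \<open>g ^ 2\<close>, and coefficients of degree at most
  \<open>j\<close> by \<open>g ^ j\<close>, which makes them regular on the chart of
  \<open>g\<close>.\<close>

lemma finite_charts:
  assumes "h = 1 \<or> h = g"
  shows "\<exists>(T :: 'k fls set) w. finite T \<and> (\<forall>t\<in>T. w t \<in> A.chart_ring h) \<and> inj_on w T \<and>
    (\<forall>q\<in>A.chart_ring h. \<exists>c. (\<forall>t\<in>T. c t \<in> B.chart_ring h) \<and> q = (\<Sum>t\<in>T. c t * w t))"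
proof -
  obtain T where T: "finite T" "T \<subseteq> A.L 2" and span: "\<forall>a\<in>A.L 2. \<exists>c. a = (\<Sum>w\<in>T. fls_const (c w) * w)"
    by (rule A.pole_space_spanningE)
  from assms show ?thesis
  proof
    assume h: "h = 1"
    show ?thesis
      unfolding h A.chart_ring_1 B.chart_ring_1
    proof (rule exI[of _ T], rule exI[of _ "\<lambda>t. t"], intro conjI ballI)
      fix q assume "q \<in> A"
      then obtain m0 where "\<forall>m\<ge>m0. q \<in> A.L m" using A.exists_L by blast
      then have "q \<in> A.L (2 + m0)" using le_add2[of m0 2] by blast
      then obtain p where p: "(\<forall>w. degree (p w) \<le> m0) \<and> q = (\<Sum>w\<in>T. peval (p w) g * w)"
        using A.L_finite_module[OF span T(1)] by blast
      then show "\<exists>c. (\<forall>t\<in>T. c t \<in> B) \<and> q = (\<Sum>t\<in>T. c t * t)"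
        using B.peval_in[OF B.g_in] by (intro exI[of _ "\<lambda>w. peval (p w) g"]) blast
    qed (use T A.L_in in auto)
  next
    assume h: "h = g"
    show ?thesis
      unfolding h
    proof (rule exI[of _ T], rule exI[of _ "\<lambda>t. t / g ^ 2"], intro conjI ballI)
      show "inj_on (\<lambda>t. t / g ^ 2) T" by (auto simp: inj_on_def)
      show "t / g ^ 2 \<in> A.chart_ring g" if "t \<in> T" for t
        using that T(2) unfolding A.chart_ring_g by blast
      fix q assume "q \<in> A.chart_ring g"
      then obtain j a where a: "a \<in> A.L j" "q = a / g ^ j" unfolding A.chart_ring_g by blast
      have "g ^ 2 \<in> A.L 2" using A.power_pole_space[OF A.g_pole_space, of 2] by simp
      then have ga: "g ^ 2 * a \<in> A.L (2 + j)" by (rule A.L_mult[OF _ a(1)])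
      obtain p where p: "\<forall>w. degree (p w) \<le> j" "g ^ 2 * a = (\<Sum>w\<in>T. peval (p w) g * w)"
        using A.L_finite_module[OF span T(1) ga] by blast
      have "q = (g ^ 2 * a) / (g ^ j * g ^ 2)" using a(2) by simp
      also have "\<dots> = (\<Sum>w\<in>T. (peval (p w) g / g ^ j) * (w / g ^ 2))"
        unfolding p(2) sum_divide_distrib by simp
      finally have "q = (\<Sum>w\<in>T. (peval (p w) g / g ^ j) * (w / g ^ 2))" .
      moreover have "peval (p w) g / g ^ j \<in> B.chart_ring g" for w
        unfolding B.chart_ring_g using B.peval_g_L p(1) by blast
      ultimately show "\<exists>c. (\<forall>t\<in>T. c t \<in> B.chart_ring g) \<and> q = (\<Sum>t\<in>T. c t * (t / g ^ 2))"
        by (intro exI[of _ "\<lambda>w. peval (p w) g / g ^ j"]) blast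
    qed (use T in auto)
  qed
qed

theorem finite_morphism_projection: "finite_morphism A.X B.X projection"
  unfolding finite_morphism_def
proof (intro conjI ballI)
  show "morphism A.X B.X projection" by (rule morphism_projection)
  fix Q assume "Q \<in> topspace B.X"
  then obtain P where P: "P \<in> B.pts" "Q = B.phi P" by (auto simp: B.topspace_X)
  \<comment> \<open>Two charts cover the target: \<open>g\<close> is nonzero at infinity as a
    section of degree 1, and 1 vanishes at no finite point.\<close>
  define h where "h = (if P = None then g else 1)"
  have h: "h \<in> B.L 1" "h \<noteq> 0" "h = 1 \<or> h = g" using B.g_pole_space by (auto simp: h_def)
  have "form_value g 1 P h \<noteq> 0"
  proof (cases P)
    case None
    then show ?thesis using B.ev_None_nonzero_iff[OF B.g_pole_space] B.g_subdegree by (simp add: h_def)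
  next
    case (Some s)
    then show ?thesis using P by (auto simp: h_def points_def)
  qed
  then have Q: "Q \<in> B.chart h" using P by (auto simp: B.chart_def)
  obtain T :: "'k fls set" and w where "finite T \<and> (\<forall>t\<in>T. w t \<in> A.chart_ring h) \<and> inj_on w T \<and>
    (\<forall>q\<in>A.chart_ring h. \<exists>c. (\<forall>t\<in>T. c t \<in> B.chart_ring h) \<and> q = (\<Sum>t\<in>T. c t * w t))"
    using finite_charts[OF h(3)] by (elim exE)
  then have T: "finite T" "\<And>t. t \<in> T \<Longrightarrow> w t \<in> A.chart_ring h" "inj_on w T"
    "\<And>q. q \<in> A.chart_ring h \<Longrightarrow> \<exists>c. (\<forall>t\<in>T. c t \<in> B.chart_ring h) \<and> q = (\<Sum>t\<in>T. c t * w t)"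
    by simp_all
  note fin = finite_chart[OF h(1) T(1,2,3,4) h(2)]
  show "\<exists>V U. openin B.X V \<and> Q \<in> V \<and> U = {P \<in> topspace A.X. projection P \<in> V} \<and>
      affine_variety (subtopology B.X V) \<and> affine_variety (subtopology A.X U) \<and>
      (\<exists>S. finite S \<and> (\<forall>b\<in>S. regular_on A.X U b) \<and>
         (\<forall>f. regular_on A.X U f \<longrightarrow>
            (\<exists>c. (\<forall>b\<in>S. regular_on B.X V (c b)) \<and>
                 (\<forall>P\<in>U. f P = (\<Sum>b\<in>S. c b (projection P) * b P)))))"
    by (intro exI[of _ "B.chart h"] exI[of _ "A.chart h"] conjI B.openin_chart[OF h(1,2)] Q
        preimage_chart[OF h(1), symmetric] B.affine_chart[OF h(1,2)] A.affine_chart[OF B_L_subset[OF h(1)] h(2)] fin)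
qed

text \<open>Finite fibres make the image infinite, while proper closed sets are finite.\<close>

lemma dominant_projection: "dominant A.X B.X projection"
  unfolding dominant_def
proof -
  let ?I = "projection ` topspace A.X" and ?C = "B.X closure_of (projection ` topspace A.X)"
  have sub: "?I \<subseteq> topspace B.X" using restriction_pts by (auto simp: A.topspace_X B.topspace_X)
  have "infinite (restriction ` A.pts)"
  proof
    assume "finite (restriction ` A.pts)"
    then have "finite {P \<in> A.pts. restriction P \<in> restriction ` A.pts}"
      using restriction_pts by (intro finite_preimage) auto
    moreover have "{P \<in> A.pts. restriction P \<in> restriction ` A.pts} = A.pts" by auto
    ultimately show False using A.infinite_pts by simp
  qed
  moreover have "?I = B.phi ` (restriction ` A.pts)" by (auto simp: A.topspace_X image_image)
  moreover have "inj_on B.phi (restriction ` A.pts)"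
    by (rule inj_on_subset[OF B.phi_inj]) (use restriction_pts in auto)
  ultimately have inf: "infinite ?I" by (metis finite_imageD)
  have "openin B.X (topspace B.X - ?C)" by (intro openin_diff openin_topspace closedin_closure_of)
  then have cases: "topspace B.X - ?C = {} \<or>
      (topspace B.X - ?C \<subseteq> B.carrier_set \<and> finite (B.carrier_set - (topspace B.X - ?C)))"
    unfolding B.openin_X_iff .
  have I: "?I \<subseteq> B.carrier_set - (topspace B.X - ?C)"
    using closure_of_subset[OF sub] sub unfolding B.X_topology(1) by blast
  have "topspace B.X - ?C = {}"
  proof (rule ccontr)
    assume "topspace B.X - ?C \<noteq> {}"
    then have "finite (B.carrier_set - (topspace B.X - ?C))" using cases by simp
    then have "finite ?I" by (rule finite_subset[OF I])
    then show False using inf by simp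
  qed
  then show "?C = topspace B.X" using closure_of_subset_topspace[of B.X ?I] by blast
qed

section \<open>Degree and ramification of the projection\<close>

lemma K_subset: "B.K \<subseteq> A.K"
  using B_subset by (auto simp: fractions_def)

lemma pullback_Phi:
  assumes "q \<in> B.K" shows "pullback A.X projection (B.Phi q) = A.Phi q"
proof -
  have "rat_class A.X (f \<circ> projection) = A.Phi q" if "f \<in> B.Phi q" for f
    by (intro A.rat_class_agrees agrees_pullback B.Phi_agrees[OF that assms])
  then show ?thesis using B.Phi_nonempty[of q] unfolding pullback_def by auto
qed

lemma pullback_field: "pullback A.X projection ` carrier (function_field B.X) = A.Phi ` B.K"
  unfolding B.carrier_FF image_image using pullback_Phi by (rule image_cong[OF refl])

lemma line_extension_Phi:
  assumes "v \<in> A.K" "E \<subseteq> A.K"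
  shows "ring.line_extension A.FF (A.Phi ` B.K) (A.Phi v) (A.Phi ` E) = A.Phi ` {b * v + c | b c. b \<in> B.K \<and> c \<in> E}"
proof -
  interpret R: ring A.FF by (rule A.ring_FF)
  have eq: "A.Phi b \<otimes>\<^bsub>A.FF\<^esub> A.Phi v \<oplus>\<^bsub>A.FF\<^esub> A.Phi c = A.Phi (b * v + c)" if "b \<in> B.K" "c \<in> E" for b c
  proof -
    have "b \<in> A.K" "c \<in> A.K" using that assms K_subset by auto
    then show ?thesis using assms A.fractions_closed(2) by (simp add: A.Phi_mult A.Phi_add)
  qed
  have "u \<in> R.line_extension (A.Phi ` B.K) (A.Phi v) (A.Phi ` E) \<longleftrightarrow>
      u \<in> A.Phi ` {b * v + c | b c. b \<in> B.K \<and> c \<in> E}" for u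
    unfolding R.line_extension_mem_iff using eq by force
  then show ?thesis by blast
qed

text \<open>The dimension is assembled from two line extensions: by 1 from the zero space to
  \<open>B.K\<close>, then by \<open>w\<close> to \<open>A.K\<close>.\<close>

lemma has_degree_2:
  assumes w: "w \<in> A.K" "w \<notin> B.K" and gen: "\<And>q. q \<in> A.K \<Longrightarrow> \<exists>b\<in>B.K. \<exists>c\<in>B.K. q = b * w + c"
  shows "has_degree A.X B.X projection 2"
  unfolding has_degree_def pullback_field
proof
  show "dominant A.X B.X projection" by (rule dominant_projection)
  interpret R: ring A.FF by (rule A.ring_FF)
  let ?F = "A.Phi ` B.K"
  have "R.dimension 0 ?F (A.Phi ` {0})" using R.zero_dim[of ?F] by (simp add: A.Phi_zero)
  moreover have "A.Phi 1 \<in> carrier A.FF" by (auto simp: A.carrier_FF)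
  moreover have "A.Phi 1 \<notin> A.Phi ` {0}" using A.Phi_inj[of 1 0] by auto
  ultimately have "R.dimension (Suc 0) ?F (R.line_extension ?F (A.Phi 1) (A.Phi ` {0}))" by (intro R.Suc_dim)
  also have "R.line_extension ?F (A.Phi 1) (A.Phi ` {0}) = A.Phi ` B.K"
  proof -
    have "{b * 1 + c | b c. b \<in> B.K \<and> c \<in> {0}} = B.K" by auto
    then show ?thesis using line_extension_Phi[of 1 "{0}"] by simp
  qed
  finally have "R.dimension (Suc 0) ?F (A.Phi ` B.K)" .
  moreover have "A.Phi w \<in> carrier A.FF" using w by (auto simp: A.carrier_FF)
  moreover have "A.Phi w \<notin> A.Phi ` B.K" using A.Phi_inj w K_subset by blast
  ultimately have "R.dimension (Suc (Suc 0)) ?F (R.line_extension ?F (A.Phi w) (A.Phi ` B.K))" by (intro R.Suc_dim)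
  also have "R.line_extension ?F (A.Phi w) (A.Phi ` B.K) = carrier A.FF"
  proof -
    have "{b * w + c | b c. b \<in> B.K \<and> c \<in> B.K} = A.K"
    proof (rule equalityI; rule subsetI)
      fix x assume "x \<in> {b * w + c | b c. b \<in> B.K \<and> c \<in> B.K}"
      then obtain b c where "b \<in> A.K" "c \<in> A.K" "x = b * w + c" using K_subset by blast
      then show "x \<in> A.K" using w(1) A.fractions_closed(1,2) by simp
    next
      fix x assume "x \<in> A.K"
      then show "x \<in> {b * w + c | b c. b \<in> B.K \<and> c \<in> B.K}" using gen by blast
    qed
    then show ?thesis using line_extension_Phi[OF w(1) K_subset] by (simp add: A.carrier_FF)
  qed
  finally show "R.dimension 2 ?F (carrier A.FF)" by (simp add: numeral_2_eq_2)
qed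

text \<open>The order of one series is measured on both curves; multiplied by \<open>e\<close> and
  by \<open>e'\<close> it gives the same subdegree. Any parameter that \<open>SOME\<close> may
  select is a uniformizer times a unit, hence of subdegree \<open>e'\<close>.\<close>

lemma ramification_infinity:
  "int e * ramification_index A.X B.X projection (A.phi None) = int e'"
proof -
  have proj: "projection (A.phi None) = B.phi None" by simp
  obtain z where z: "z \<in> B.K" "fls_subdegree z = int e'" using B.exists_uniformizer_None by (elim exE conjE)
  have uz: "B.uniformizer None z" by (rule B.uniformizer_None[OF z])
  note ex = exI[of "local_parameter B.X (B.phi None)", OF B.uniformizer_local_parameter[OF B.None_pts uz]]
  define t where "t = (SOME t. local_parameter B.X (B.phi None) t)"
  have "local_parameter B.X (B.phi None) t" unfolding t_def by (rule someI_ex[OF ex])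
  then obtain r where r: "r \<in> B.place_ring None" "t = B.Phi r"
    "{q \<in> B.place_ring None. B.val None q = 0} = {x * r | x. x \<in> B.place_ring None}"
    unfolding B.local_parameter_iff[OF B.None_pts] by (elim bexE conjE)
  obtain y where y: "y \<in> B.place_ring None" "B.val None y \<noteq> 0" "r = z * y"
    by (rule B.generator_associated[OF B.None_pts uz r(1,3)])
  have order_at_one: "order_at B.X (B.phi None) (B.Phi r) = 1"
    using B.order_at_Phi[OF B.None_pts uz y(1,2), of 1] y(3) by simp
  have "z \<noteq> 0" "y \<noteq> 0" using B.unif(2)[OF B.None_pts uz] y(2) by auto
  then have r0: "r \<noteq> 0" "r \<in> B.K" using y(3) B.place_fractions[OF B.None_pts r(1)] by auto
  then have sub: "fls_subdegree r = int e'" using B.order_at_infinity[of r] order_at_one by simp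
  have "ramification_index A.X B.X projection (A.phi None) = order_at A.X (A.phi None) (A.Phi r)"
    unfolding ramification_index_def proj t_def[symmetric] r(2) pullback_Phi[OF r0(2)] ..
  then show ?thesis using A.order_at_infinity[of r] r0 K_subset sub by auto
qed

end

section \<open>The quotient by \<open>t \<mapsto> - t\<close>\<close>

definition flip :: "'k::field fls \<Rightarrow> 'k fls" where
  "flip f = Abs_fls (\<lambda>n. if even n then f $$ n else - f $$ n)"

lemma flip_nth [simp]: "flip f $$ n = (if even n then f $$ n else - f $$ n)"
  unfolding flip_def by (rule nth_Abs_fls_lower_bound[of "fls_subdegree f"]) auto

lemma flip_add: "flip (f + h) = flip f + flip h" and flip_uminus: "flip (- f) = - flip f"
  and flip_diff: "flip (f - h) = flip f - flip h"
  and flip_flip [simp]: "flip (flip f) = f" and flip_const [simp]: "flip (fls_const c) = fls_const c"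
  by (rule fls_eqI, simp)+

lemma flip_0 [simp]: "flip 0 = 0" and flip_1 [simp]: "flip 1 = 1"
  using flip_const[of 0] flip_const[of 1] by simp_all

lemma flip_eq_0_iff [simp]: "flip f = 0 \<longleftrightarrow> f = 0"
  using flip_flip[of f] flip_0 by metis

lemma flip_subdegree [simp]: "fls_subdegree (flip f) = fls_subdegree f"
proof (cases "f = 0")
  case False
  then have "flip f $$ fls_subdegree f \<noteq> 0" by simp
  then show ?thesis by (intro fls_subdegree_eqI) auto
qed simp

lemma flip_mult: "flip (f * h) = flip f * flip h"
proof (rule fls_eqI)
  fix n
  have "(flip f * flip h) $$ n = (\<Sum>i = fls_subdegree f..n - fls_subdegree h. flip f $$ i * flip h $$ (n - i))"
    using fls_times_nth(2)[of "flip f" "flip h" n] by simp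
  also have "\<dots> = (\<Sum>i = fls_subdegree f..n - fls_subdegree h. (if even n then 1 else - 1) * (f $$ i * h $$ (n - i)))"
    by (intro sum.cong refl) auto
  also have "\<dots> = (if even n then 1 else - 1) * (f * h) $$ n"
    using fls_times_nth(2)[of f h n] by (simp add: sum_distrib_left)
  finally show "flip (f * h) $$ n = (flip f * flip h) $$ n" by simp
qed

lemma flip_power: "flip (f ^ n) = flip f ^ n"
  by (induction n) (auto simp: flip_mult)

lemma flip_invariant_subdegree:
  fixes f :: "'k::field_char_0 fls"
  assumes "flip f = f"
  shows "even (fls_subdegree f)"
proof (cases "f = 0")
  case False
  show ?thesis
  proof (rule ccontr)
    assume "odd (fls_subdegree f)"
    then have "f $$ fls_subdegree f = - f $$ fls_subdegree f"
      using arg_cong[OF assms, of "\<lambda>f'. f' $$ fls_subdegree f"] by simp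
    then have "2 * f $$ fls_subdegree f = 0" by simp
    then show False using False by simp
  qed
qed simp

text \<open>If it were 0, every element vanishing at \<open>s\<close> would be 0, but
  \<open>g - fls_const (s g)\<close> has a pole.\<close>

lemma (in pole_algebra) local_generator_nonzero:
  assumes s: "is_point A s" and t: "local_generator A s t"
  shows "t \<noteq> 0"
proof
  assume "t = 0"
  obtain g where g: "g \<in> A" "g \<noteq> 0" "fls_subdegree g = - int conductor"
    using conductor(3)[OF _ conductor(2)] by blast
  let ?f = "g - fls_const (s g)"
  have "?f \<in> A" "s ?f = 0" using g s by (auto simp: point_diff intro: closed)
  then obtain u h where "u \<in> A" "s u \<noteq> 0" "?f * u = t * h" using t unfolding local_generator_def by meson
  then have "?f * u = 0" "u \<noteq> 0" using \<open>t = 0\<close> s by auto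
  then have "g = fls_const (s g)" by simp
  then have "fls_subdegree g = 0" by (metis fls_const_subdegree)
  then show False using g conductor(1) by simp
qed

section \<open>The algebra of invariants\<close>

locale flip_algebra = smooth_algebra A 1
  for A :: "'k::{alg_closed_field, field_char_0} fls set" +
  assumes flip_in: "a \<in> A \<Longrightarrow> flip a \<in> A"
begin

definition invariants :: "'k fls set" where
  "invariants = {a \<in> A. flip a = a}"

abbreviation "trace a \<equiv> a + flip a"

lemma invariants_subset: "invariants \<subseteq> A"
  by (auto simp: invariants_def)

lemma trace_in: "a \<in> A \<Longrightarrow> trace a \<in> invariants"
  using add_in flip_in by (auto simp: invariants_def flip_add)

lemma trace_mult: "b \<in> invariants \<Longrightarrow> trace (b * a) = b * trace a"
  by (auto simp: invariants_def flip_mult distrib_left)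

sublocale B: pole_algebra invariants 2
proof unfold_locales
  show "(0::nat) < 2" by simp
  show "fls_const c \<in> invariants" for c by (simp add: invariants_def)
  fix a b assume ab: "a \<in> invariants" "b \<in> invariants"
  then show "a + b \<in> invariants" using add_in by (simp add: invariants_def flip_add)
  show "a * b \<in> invariants" using ab mult_in by (simp add: invariants_def flip_mult)
  show "fls_subdegree a \<le> 0" using ab subdegree_le_0 by (simp add: invariants_def)
  show "int 2 dvd fls_subdegree a" using ab flip_invariant_subdegree[of a] by (simp add: invariants_def)
next
  show "\<exists>n0. \<forall>n\<ge>n0. 2 dvd n \<longrightarrow> (\<exists>a\<in>invariants. fls_subdegree a = - int n)"
  proof (intro exI allI impI)
    fix n assume n: "conductor \<le> n" "2 dvd n"
    then obtain a where a: "a \<in> A" "a \<noteq> 0" "fls_subdegree a = - int n" using conductor(3) by auto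
    have "a $$ (- int n) \<noteq> 0" using a by (metis nth_fls_subdegree_nonzero)
    \<comment> \<open>For an even pole order the trace doubles the leading coefficient, which stays
      nonzero in characteristic 0.\<close>
    then have "fls_subdegree (trace a) = - int n"
      using n(2) a(3) by (intro fls_subdegree_eqI) auto
    then show "\<exists>a\<in>invariants. fls_subdegree a = - int n" using trace_in a(1) by blast
  qed
qed

text \<open>The trace form yields a proper ideal of \<open>A\<close> that contains the kernel of \<open>s'\<close>.\<close>

lemma lift_point:
  assumes s': "is_point invariants s'"
  shows "\<exists>s. is_point A s \<and> (\<forall>b\<in>invariants. s b = s' b)"
proof -
  let ?J = "{a \<in> A. \<forall>c\<in>A. s' (trace (a * c)) = 0}"
  have ideal: "is_ideal ?J"
    unfolding is_ideal_def
  proof (intro conjI ballI)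
    show "?J \<subseteq> A" "0 \<in> ?J" using B.point_0[OF s'] by auto
  next
    fix a b assume ab: "a \<in> ?J" "b \<in> ?J"
    have "s' (trace ((a + b) * c)) = 0" if c: "c \<in> A" for c
    proof -
      have "trace ((a + b) * c) = trace (a * c) + trace (b * c)" by (simp add: distrib_right flip_add algebra_simps)
      moreover have "trace (a * c) \<in> invariants" "trace (b * c) \<in> invariants"
        using ab c by (simp_all add: trace_in mult_in)
      ultimately show ?thesis using ab c by (simp add: B.point_add[OF s'])
    qed
    then show "a + b \<in> ?J" using ab by (simp add: add_in)
  next
    fix a b assume ab: "a \<in> A" "b \<in> ?J"
    have "s' (trace ((a * b) * c)) = 0" if c: "c \<in> A" for c
    proof -
      have "s' (trace (b * (a * c))) = 0" using ab(2) mult_in[OF ab(1) c] by blast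
      moreover have "(a * b) * c = b * (a * c)" by (simp add: algebra_simps)
      ultimately show ?thesis by (simp only:)
    qed
    then show "a * b \<in> ?J" using ab by (simp add: mult_in)
  qed
  have "s' (trace (1 * 1)) = 2"
    using B.point_add[OF s', of 1 1] B.point_1[OF s'] B.one_in by simp
  then have "s' (trace (1 * 1)) \<noteq> 0" by simp
  then have n1: "1 \<notin> ?J" using one_in by blast
  obtain s where "is_point A s \<and> (\<forall>j\<in>?J. s j = 0)" using nullstellensatz[OF ideal n1] by (elim exE)
  then have s: "is_point A s" "\<And>j. j \<in> ?J \<Longrightarrow> s j = 0" by simp_all
  have "s b = s' b" if b: "b \<in> invariants" for b
  proof -
    let ?b = "b - fls_const (s' b)"
    have bi: "?b \<in> invariants" using b by (intro B.diff_in) auto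
    have b0: "s' ?b = 0" using b by (simp add: B.point_diff[OF s'] B.point_const[OF s'])
    have "s' (trace (?b * c)) = 0" if "c \<in> A" for c
      unfolding trace_mult[OF bi] using b0 by (simp add: B.point_mult[OF s' bi trace_in[OF that]])
    then have "?b \<in> ?J" using bi invariants_subset by auto
    then have "s ?b = 0" by (rule s(2))
    then show ?thesis using b invariants_subset s(1) by (auto simp: point_diff)
  qed
  then show ?thesis using s(1) by blast
qed

text \<open>For an element of odd pole order the difference with its conjugate doubles the leading
  coefficient and is odd.\<close>

lemma odd_element: "\<exists>f\<in>A. f \<noteq> 0 \<and> flip f = - f"
proof -
  let ?n = "2 * conductor + 1"
  obtain a where a: "a \<in> A" "a \<noteq> 0" "fls_subdegree a = - int ?n" using conductor(3)[of ?n] by auto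
  have "a $$ (- int ?n) \<noteq> 0" using a by (metis nth_fls_subdegree_nonzero)
  then have "(a - flip a) $$ (- int ?n) \<noteq> 0" by simp
  then have "a - flip a \<noteq> 0" by (metis fls_zero_nth)
  then show ?thesis using a flip_in diff_in by (intro bexI[of _ "a - flip a"]) (auto simp: flip_diff)
qed

text \<open>Up to the units \<open>v\<close> and \<open>G\<close> at \<open>s\<close>,
  \<open>r\<close> is \<open>t\<close>.\<close>

lemma change_generator:
  assumes s: "is_point A s" and t: "local_generator A s t"
    and r: "r \<in> A" "v \<in> A" "G \<in> A" "s v \<noteq> 0" "s G \<noteq> 0" "r * v = t * G"
  shows "local_generator A s r"
proof -
  have tA: "t \<in> A" "s t = 0" using t by (auto simp: local_generator_def)
  have "s r * s v = s (r * v)" using point_mult[OF s r(1,2)] by simp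
  also have "\<dots> = 0" by (simp only: r(6) point_mult[OF s tA(1) r(3)] tA(2) mult_zero_left)
  finally have "s r = 0" using r by simp
  moreover have "\<exists>u\<in>A. \<exists>g\<in>A. s u \<noteq> 0 \<and> f * u = r * g" if f: "f \<in> A" "s f = 0" for f
  proof -
    obtain u g where ug: "u \<in> A" "g \<in> A" "s u \<noteq> 0" "f * u = t * g" using t f unfolding local_generator_def by meson
    have "f * (u * G) = (t * G) * g" using ug(4) by (simp add: algebra_simps)
    also have "\<dots> = r * (v * g)" by (simp only: r(6)[symmetric] mult.assoc)
    finally have "f * (u * G) = r * (v * g)" .
    moreover have "s (u * G) \<noteq> 0" using ug r s by (simp add: point_mult)
    ultimately show ?thesis using ug r mult_in by blast
  qed
  ultimately show ?thesis using r(1) by (simp add: local_generator_def)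
qed

section \<open>Smoothness of the quotient\<close>

context
  fixes s s' assumes s: "is_point A s" and s': "is_point invariants s'"
    and lift: "\<And>b. b \<in> invariants \<Longrightarrow> s b = s' b"
begin

text \<open>When the involution moves \<open>s\<close>, a function \<open>i\<close> with value 1 at
  \<open>s\<close> and 0 at the conjugate point localises the trace. The trace of
  \<open>t * i ^ 2\<close> is an invariant that still generates at \<open>s\<close>, and traces
  weighted by \<open>i\<close> carry equations over \<open>A\<close> down to the invariants.\<close>

lemma unramified_generator:
  assumes f: "f \<in> A" "s f \<noteq> s (flip f)"
  shows "\<exists>t. local_generator invariants s' t"
proof -
  obtain t where t: "local_generator A s t" using smooth[OF s] by blast
  have tA: "t \<in> A" "s t = 0" using t by (auto simp: local_generator_def)
  \<comment> \<open>Linear interpolation between the values of \<open>f\<close> at the conjugate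
    point and at \<open>s\<close>.\<close>
  define i where "i = fls_const (1 / (s f - s (flip f))) * (f - fls_const (s (flip f)))"
  have iA: "i \<in> A" using f unfolding i_def by (intro closed)
  have si: "s i = 1" using f s unfolding i_def by (simp add: point_mult point_diff closed)
  have "flip i = fls_const (1 / (s f - s (flip f))) * (flip f - fls_const (s (flip f)))"
    unfolding i_def by (simp only: flip_mult flip_diff flip_const)
  then have sfi: "s (flip i) = 0" using f s flip_in by (simp add: point_mult point_diff closed)
  note fiA = flip_in[OF iA] and ftA = flip_in[OF tA(1)]
  let ?r = "trace (t * i ^ 2)"
  have rB: "?r \<in> invariants" using tA iA by (intro trace_in closed)
  obtain v h where vh: "v \<in> A" "h \<in> A" "s v \<noteq> 0" "flip i * v = t * h"
    using t fiA sfi unfolding local_generator_def by meson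
  \<comment> \<open>\<open>flip i\<close> is divisible by \<open>t\<close> near \<open>s\<close>, so
    the conjugate term of \<open>?r\<close> is divisible by \<open>t ^ 2\<close> and
    \<open>?r\<close> remains \<open>t\<close> times a unit.\<close>
  let ?G = "i ^ 2 * v ^ 2 + flip t * (t * h ^ 2)"
  have "?r * v ^ 2 = t * (i ^ 2 * v ^ 2) + flip t * (flip i * v) ^ 2"
    by (simp add: flip_mult flip_power algebra_simps power_mult_distrib)
  also have "\<dots> = t * ?G" unfolding vh(4) by (simp add: algebra_simps power2_eq_square)
  finally have eq: "?r * v ^ 2 = t * ?G" .
  have GA: "?G \<in> A" using iA vh ftA tA by (intro closed)
  have "s ?G = s v ^ 2" using iA vh ftA tA s si by (simp add: point_simps closed)
  then have gen: "local_generator A s ?r"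
    using vh s by (intro change_generator[OF s t _ _ GA _ _ eq]) (auto simp: point_power power_in intro: subsetD[OF invariants_subset rB])
  have "local_generator invariants s' ?r"
    unfolding local_generator_def
  proof (intro conjI ballI impI)
    show "?r \<in> invariants" by (rule rB)
    show "s' ?r = 0" using gen lift[OF rB] by (simp add: local_generator_def)
    fix b assume b: "b \<in> invariants" "s' b = 0"
    then have bA: "b \<in> A" "s b = 0" using invariants_subset lift by auto
    obtain u g where ug: "u \<in> A" "g \<in> A" "s u \<noteq> 0" "b * u = ?r * g" using gen bA unfolding local_generator_def by meson
    \<comment> \<open>The weight \<open>i\<close> makes the new denominator take the value
      \<open>s u\<close>; the plain trace of \<open>u\<close> could vanish at
      \<open>s\<close>.\<close>
    have "b * trace (u * i) = trace (b * (u * i))" using trace_mult[OF b(1)] by simp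
    also have "b * (u * i) = ?r * (g * i)" using ug(4) by (metis mult.assoc)
    also have "trace (?r * (g * i)) = ?r * trace (g * i)" by (rule trace_mult[OF rB])
    finally have eq: "b * trace (u * i) = ?r * trace (g * i)" .
    have uB: "trace (u * i) \<in> invariants" "trace (g * i) \<in> invariants" using ug iA by (auto intro!: trace_in mult_in)
    have "s (trace (u * i)) = s u"
      using ug iA s si sfi flip_in[OF ug(1)] fiA by (simp add: flip_mult point_simps closed)
    then have "s' (trace (u * i)) \<noteq> 0" using ug lift[OF uB(1)] by simp
    then show "\<exists>u\<in>invariants. \<exists>g\<in>invariants. s' u \<noteq> 0 \<and> b * u = ?r * g" using uB eq by blast
  qed
  then show ?thesis by blast
qed

text \<open>At a fixed point \<open>2 * t\<close> is the sum of an even \<open>p\<close> and an odd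
  \<open>m\<close>. If \<open>p\<close> generated, a nonzero odd function would be a power of
  \<open>p\<close> times a unit, and comparison with its conjugate gives a contradiction. So
  \<open>m\<close> generates at \<open>s\<close>, and \<open>m ^ 2\<close> generates among the
  invariants.\<close>

lemma ramified_generator:
  assumes fix_s: "\<And>f. f \<in> A \<Longrightarrow> s (flip f) = s f"
  shows "\<exists>t. local_generator invariants s' t"
proof -
  obtain t where t: "local_generator A s t" using smooth[OF s] by blast
  have tA: "t \<in> A" "s t = 0" using t by (auto simp: local_generator_def)
  note ftA = flip_in[OF tA(1)]
  have t0: "t \<noteq> 0" by (rule local_generator_nonzero[OF s t])
  define p where "p = t + flip t"
  define m where "m = t - flip t"
  have pm: "p \<in> A" "m \<in> A" "s p = 0" "s m = 0" "flip p = p" "flip m = - m"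
    unfolding p_def m_def using tA ftA s fix_s by (auto simp: point_simps flip_add flip_diff closed)
  obtain u1 g1 where 1: "u1 \<in> A" "g1 \<in> A" "s u1 \<noteq> 0" "p * u1 = t * g1" using t pm unfolding local_generator_def by meson
  obtain u2 g2 where 2: "u2 \<in> A" "g2 \<in> A" "s u2 \<noteq> 0" "m * u2 = t * g2" using t pm unfolding local_generator_def by meson
  \<comment> \<open>Because \<open>p + m = 2 * t\<close>, the quotients of \<open>p\<close> and
    \<open>m\<close> by \<open>t\<close> cannot both vanish at \<open>s\<close>.\<close>
  have "t * (g1 * u2 + g2 * u1) = (p * u1) * u2 + (m * u2) * u1" by (simp add: 1(4) 2(4) algebra_simps)
  also have "\<dots> = t * (2 * (u1 * u2))" by (simp add: p_def m_def algebra_simps)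
  finally have "g1 * u2 + g2 * u1 = 2 * (u1 * u2)" using t0 by simp
  then have "s (g1 * u2 + g2 * u1) = s (u1 * u2 + u1 * u2)" by simp
  moreover have "s (g1 * u2 + g2 * u1) = s g1 * s u2 + s g2 * s u1" using 1 2 s by (simp add: point_simps closed)
  moreover have "s (u1 * u2 + u1 * u2) = s u1 * s u2 + s u1 * s u2"
    by (simp only: point_add[OF s mult_in[OF 1(1) 2(1)] mult_in[OF 1(1) 2(1)]] point_mult[OF s 1(1) 2(1)])
  ultimately have key: "s g1 * s u2 + s g2 * s u1 = s u1 * s u2 + s u1 * s u2" by simp
  have "s g1 = 0"
  proof (rule ccontr)
    assume "s g1 \<noteq> 0"
    then have gp: "local_generator A s p" by (intro change_generator[OF s t pm(1) 1(1,2,3) _ 1(4)])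
    obtain f where f: "f \<in> A" "f \<noteq> 0" "flip f = - f" using odd_element by blast
    obtain n u g where ug: "u \<in> A" "g \<in> A" "s u \<noteq> 0" "s g \<noteq> 0" "f * u = p ^ n * g"
      using order_exists[OF s gp f(1,2)] by blast
    have p0: "p ^ n \<noteq> 0" using local_generator_nonzero[OF s gp] by simp
    have "flip (f * u) = flip (p ^ n * g)" using ug(5) by simp
    then have "- (f * flip u) = p ^ n * flip g" using f(3) pm(5) by (simp add: flip_mult flip_power)
    then have "f * flip u = - (p ^ n * flip g)" by (metis minus_minus)
    then have sum: "f * trace u = p ^ n * (g - flip g)" using ug(5) by (simp add: algebra_simps)
    have "p ^ n * (g * trace u) = (f * u) * trace u" by (simp only: ug(5) mult.assoc)
    also have "\<dots> = (f * trace u) * u" by (simp only: mult.assoc mult.commute mult.left_commute)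
    also have "\<dots> = p ^ n * ((g - flip g) * u)" by (simp only: sum mult.assoc)
    finally have "g * trace u = (g - flip g) * u" by (rule mult_left_cancel[OF p0, THEN iffD1])
    then have "s (g * trace u) = s ((g - flip g) * u)" by simp
    \<comment> \<open>At a fixed point \<open>g - flip g\<close> has value 0 and
      \<open>trace u\<close> has value \<open>2 * s u\<close>.\<close>
    then have "s g * (2 * s u) = 0" using ug flip_in s fix_s by (simp add: point_simps closed)
    then show False using ug by simp
  qed
  then have "s g2 \<noteq> 0" using key 1(3) 2(3) by auto
  then have gm: "local_generator A s m" by (intro change_generator[OF s t pm(2) 2(1,2,3) _ 2(4)])
  have mB: "m ^ 2 \<in> invariants" using pm by (simp add: invariants_def flip_power power_in)
  have "local_generator invariants s' (m ^ 2)"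
    unfolding local_generator_def
  proof (intro conjI ballI impI)
    show "m ^ 2 \<in> invariants" by (rule mB)
    show "s' (m ^ 2) = 0" using lift[OF mB] pm s by (simp add: point_power)
    fix b assume b: "b \<in> invariants" "s' b = 0"
    then have bA: "b \<in> A" "s b = 0" "flip b = b" using invariants_subset lift by (auto simp: invariants_def)
    obtain u g where ug: "u \<in> A" "g \<in> A" "s u \<noteq> 0" "b * u = m * g" using gm bA(1,2) unfolding local_generator_def by meson
    \<comment> \<open>A trace makes the cofactor of \<open>m\<close> odd. Odd functions vanish at a
      fixed point, so a second factor \<open>m\<close> can be extracted, and another trace makes the
      remaining factor invariant.\<close>
    let ?d = "g - flip g"
    have dA: "?d \<in> A" "s ?d = 0" using ug(2) flip_in fix_s s by (auto simp: point_diff closed)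
    obtain u' g' where ug': "u' \<in> A" "g' \<in> A" "s u' \<noteq> 0" "?d * u' = m * g'"
      using gm dA unfolding local_generator_def by meson
    have "b * trace u = b * u + flip (b * u)" by (simp add: flip_mult bA(3) distrib_left)
    also have "\<dots> = m * ?d" unfolding ug(4) by (simp add: flip_mult pm(6) algebra_simps)
    finally have e1: "b * trace u = m * ?d" .
    have "?d * trace u' = ?d * u' - flip (?d * u')" by (simp add: flip_mult flip_diff algebra_simps)
    also have "\<dots> = m * trace g'" unfolding ug'(4) by (simp add: flip_mult pm(6) algebra_simps)
    finally have e2: "?d * trace u' = m * trace g'" .
    have "b * (trace u * trace u') = m ^ 2 * trace g'"
    proof -
      have "b * (trace u * trace u') = (b * trace u) * trace u'" by (simp only: mult.assoc)
      also have "\<dots> = m * (?d * trace u')" by (simp only: e1 mult.assoc)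
      also have "\<dots> = m ^ 2 * trace g'" by (simp only: e2 power2_eq_square mult.assoc)
      finally show ?thesis .
    qed
    moreover have uB: "trace u * trace u' \<in> invariants" "trace g' \<in> invariants"
      using ug ug' by (auto intro!: trace_in B.mult_in)
    moreover have "s (trace u * trace u') = 4 * (s u * s u')"
      using ug ug' flip_in s fix_s by (simp add: point_simps closed)
    then have "s' (trace u * trace u') \<noteq> 0" using lift[OF uB(1)] ug ug' by simp
    ultimately show "\<exists>u\<in>invariants. \<exists>g\<in>invariants. s' u \<noteq> 0 \<and> b * u = m ^ 2 * g" by blast
  qed
  then show ?thesis by blast
qed

end

sublocale B: smooth_algebra invariants 2
proof unfold_locales
  fix s' assume s': "is_point invariants s'"
  then obtain s where s: "is_point A s" "\<And>b. b \<in> invariants \<Longrightarrow> s b = s' b" using lift_point by blast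
  show "\<exists>t. local_generator invariants s' t"
  proof (cases "\<forall>f\<in>A. s (flip f) = s f")
    case True
    then show ?thesis by (intro ramified_generator[OF s(1) s' s(2)]) auto
  next
    case False
    then obtain f where "f \<in> A" "s f \<noteq> s (flip f)" by metis
    then show ?thesis by (intro unramified_generator[OF s(1) s' s(2), of f])
  qed
qed

text \<open>The denominator is replaced by its norm \<open>b * flip b\<close>. The even part of the
  numerator is then invariant, and the odd part becomes an invariant times \<open>w\<close> once
  \<open>w ^ 2\<close> is put into the denominator.\<close>

lemma field_extension:
  assumes w: "w \<in> A" "w \<noteq> 0" "flip w = - w"
  shows "w \<notin> fractions invariants"
    and "q \<in> fractions A \<Longrightarrow> \<exists>b\<in>fractions invariants. \<exists>c\<in>fractions invariants. q = b * w + c"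
proof -
  show "w \<notin> fractions invariants"
  proof
    assume "w \<in> fractions invariants"
    then obtain a b where ab: "a \<in> invariants" "b \<in> invariants" "b \<noteq> 0" "w = a / b" by (rule fractionsE)
    then have "w * b = a" by simp
    then have "w * b = flip (w * b)" using ab(1) by (simp add: invariants_def)
    also have "\<dots> = - (w * b)" using ab(2) w(3) by (simp add: flip_mult invariants_def)
    finally have "w * b + w * b = 0" by (simp only: eq_neg_iff_add_eq_0)
    then have "2 * (w * b) = 0" by (simp only: mult_2)
    then show False using w(2) ab(3) by simp
  qed
  assume "q \<in> fractions A"
  then obtain a b where ab: "a \<in> A" "b \<in> A" "b \<noteq> 0" "q = a / b" by (rule fractionsE)
  let ?n = "b * flip b" and ?x = "a * flip b"
  have n: "?n \<in> invariants" "?n \<noteq> 0" using ab flip_in mult_in by (auto simp: invariants_def flip_mult)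
  have x: "?x \<in> A" using ab flip_in mult_in by simp
  let ?d = "(?x - flip ?x) * w"
  have "flip ?d = ?d" by (simp only: flip_mult flip_diff flip_flip w(3)) (simp add: algebra_simps)
  moreover have "?d \<in> A" by (rule mult_in[OF diff_in[OF x flip_in[OF x]] w(1)])
  ultimately have d: "?d \<in> invariants" by (simp add: invariants_def)
  have "w ^ 2 \<in> invariants" using w by (simp add: invariants_def flip_power power_in)
  then have "fls_const 2 * (w ^ 2 * ?n) \<in> invariants" using n by (rule_tac B.mult_in[OF B.const_in B.mult_in])
  moreover have "fls_const 2 * (w ^ 2 * ?n) \<noteq> 0" using w n by simp
  ultimately have w2: "fls_const 2 * (w ^ 2 * ?n) \<in> invariants" "fls_const 2 * (w ^ 2 * ?n) \<noteq> 0" .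
  have "fls_const 2 * ?n \<in> invariants" using n by (intro B.mult_in[OF B.const_in])
  moreover have "fls_const 2 * ?n \<noteq> 0" using n by simp
  ultimately have n2: "fls_const 2 * ?n \<in> invariants" "fls_const 2 * ?n \<noteq> 0" .
  have "q = ?x / ?n" using ab by simp
  also have "\<dots> = ?d / (fls_const 2 * (w ^ 2 * ?n)) * w + trace ?x / (fls_const 2 * ?n)"
  proof -
    have "?d / (fls_const 2 * (w ^ 2 * ?n)) * w = (?x - flip ?x) / (fls_const 2 * ?n)"
      using w n(2) by (simp add: field_simps power2_eq_square)
    then show ?thesis using n(2) by (simp add: add_divide_distrib[symmetric])
  qed
  finally show "\<exists>b\<in>fractions invariants. \<exists>c\<in>fractions invariants. q = b * w + c"
    using fractionsI[OF d w2] fractionsI[OF trace_in[OF x] n2] by blast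
qed

definition pole_semigroup :: "nat set" where
  "pole_semigroup = {n. \<exists>a\<in>A. a \<noteq> 0 \<and> fls_subdegree a = - int n}"

lemma numerical_pole_semigroup: "numerical_semigroup pole_semigroup"
  unfolding numerical_semigroup_def nat_submonoid_def
proof (intro conjI ballI)
  show "0 \<in> pole_semigroup" unfolding pole_semigroup_def by (auto intro!: bexI[of _ 1])
  fix a b assume "a \<in> pole_semigroup" "b \<in> pole_semigroup"
  then obtain x y where "x \<in> A" "x \<noteq> 0" "fls_subdegree x = - int a" "y \<in> A" "y \<noteq> 0" "fls_subdegree y = - int b"
    unfolding pole_semigroup_def by blast
  then show "a + b \<in> pole_semigroup" unfolding pole_semigroup_def
    by (auto intro!: bexI[of _ "x * y"] mult_in)
next
  have "- pole_semigroup \<subseteq> {..<conductor}"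
    using conductor(3) unfolding pole_semigroup_def by (auto simp: not_less[symmetric])
  then show "finite (- pole_semigroup)" using finite_subset by blast
qed

lemma spanning_sequence:
  fixes C :: "'k fls set"
  assumes "pole_algebra C e"
  shows "\<exists>gs (n::nat). (\<forall>i. gs i \<in> pole_space C d) \<and> (\<forall>i>n. gs i = 0) \<and>
    (\<forall>a\<in>pole_space C d. \<exists>c. a = (\<Sum>i\<le>n. fls_const (c i) * gs i))"
proof -
  interpret C: pole_algebra C e by (rule assms)
  obtain T where T: "finite T" "T \<subseteq> pole_space C d"
    and span: "\<forall>a\<in>pole_space C d. \<exists>c. a = (\<Sum>w\<in>T. fls_const (c w) * w)"
    by (rule C.pole_space_spanningE)
  obtain f where f: "bij_betw f {..<card T} T" using ex_bij_betw_nat_finite[OF T(1)] by (auto simp: atLeast0LessThan)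
  define gs where "gs i = (if i < card T then f i else 0)" for i
  have 1: "gs i \<in> pole_space C d" for i
    using f T(2) by (auto simp: gs_def dest: bij_betwE)
  have 2: "gs i = 0" if "i > card T" for i using that by (simp add: gs_def)
  have 3: "\<exists>c. a = (\<Sum>i\<le>card T. fls_const (c i) * gs i)" if a: "a \<in> pole_space C d" for a
  proof -
    obtain c where c: "a = (\<Sum>w\<in>T. fls_const (c w) * w)" using bspec[OF span a] by (rule exE)
    have "(\<Sum>i\<le>card T. fls_const (c (f i)) * gs i) = (\<Sum>i<card T. fls_const (c (f i)) * f i)"
      unfolding lessThan_Suc_atMost[symmetric] by (simp add: gs_def)
    also have "\<dots> = a" unfolding c by (rule sum.reindex_bij_betw[OF f])
    finally show ?thesis by (intro exI[of _ "\<lambda>i. c (f i)"]) simp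
  qed
  show ?thesis using 1 2 3 by (intro exI[of _ gs] exI[of _ "card T"]) simp
qed

theorem double_covering_type: "double_covering_type TYPE('k) pole_semigroup"
proof -
  \<comment> \<open>Even and above both conductors, so that it is a pole order of an invariant
    \<open>g\<close>, and large enough for the bound in \<open>embedded_curve\<close> with either
    algebra.\<close>
  define N where "N = 2 * (2 * conductor + 2 * B.conductor + 2)"
  have N: "N \<ge> B.conductor" "2 dvd N" by (simp_all add: N_def)
  obtain g where g: "g \<in> invariants" "g \<noteq> 0" "fls_subdegree g = - int N" using B.conductor(3)[OF N] by blast
  obtain gs1 where "\<exists>n1::nat. (\<forall>i. gs1 i \<in> pole_space A N) \<and> (\<forall>i>n1. gs1 i = 0) \<and>
      (\<forall>a\<in>pole_space A N. \<exists>c. a = (\<Sum>i\<le>n1. fls_const (c i) * gs1 i))"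
    using spanning_sequence[OF pole_algebra_axioms, of N] by (rule exE)
  then obtain n1 where 1: "(\<forall>i. gs1 i \<in> pole_space A N) \<and> (\<forall>i>n1. gs1 i = 0) \<and>
      (\<forall>a\<in>pole_space A N. \<exists>c. a = (\<Sum>i\<le>n1. fls_const (c i) * gs1 i))"
    by (rule exE)
  obtain gs2 where "\<exists>n2::nat. (\<forall>i. gs2 i \<in> pole_space invariants N) \<and> (\<forall>i>n2. gs2 i = 0) \<and>
      (\<forall>a\<in>pole_space invariants N. \<exists>c. a = (\<Sum>i\<le>n2. fls_const (c i) * gs2 i))"
    using spanning_sequence[OF B.pole_algebra_axioms, of N] by (rule exE)
  then obtain n2 where 2: "(\<forall>i. gs2 i \<in> pole_space invariants N) \<and> (\<forall>i>n2. gs2 i = 0) \<and>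
      (\<forall>a\<in>pole_space invariants N. \<exists>c. a = (\<Sum>i\<le>n2. fls_const (c i) * gs2 i))"
    by (rule exE)
  interpret EA: embedded_curve A 1 conductor N g n1 gs1
  proof unfold_locales
    show "\<exists>a\<in>A. fls_subdegree a = - int m" if "m \<ge> conductor" "1 dvd m" for m using conductor(3)[OF that] by blast
  qed (use conductor g invariants_subset 1 in \<open>auto simp: N_def\<close>)
  interpret EB: embedded_curve invariants 2 B.conductor N g n2 gs2
  proof unfold_locales
    show "\<exists>a\<in>invariants. fls_subdegree a = - int m" if "m \<ge> B.conductor" "2 dvd m" for m using B.conductor(3)[OF that] by blast
  qed (use B.conductor g 2 in \<open>auto simp: N_def\<close>)
  interpret P: curve_pair A 1 conductor N g n1 gs1 invariants 2 B.conductor n2 gs2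
    by unfold_locales (rule invariants_subset)
  obtain w where w: "w \<in> A" "w \<noteq> 0" "flip w = - w" using odd_element by blast
  have "has_degree EA.X EB.X P.projection 2"
    by (rule P.has_degree_2[OF fractions_subset[OF w(1)] field_extension[OF w]])
  then have "double_covering EA.X EB.X P.projection"
    unfolding double_covering_def using EA.curve_X EB.curve_X P.finite_morphism_projection by blast
  \<comment> \<open>With steps 1 and 2, \<open>ramification_infinity\<close> gives index 2.\<close>
  moreover have "ramification_point EA.X EB.X P.projection (EA.phi None)"
    using P.ramification_infinity unfolding ramification_point_def by (simp add: EA.topspace_X)
  moreover have "weierstrass_semigroup EA.X (EA.phi None) = pole_semigroup"
    unfolding EA.weierstrass_semigroup_infinity pole_semigroup_def by simp
  ultimately show ?thesis
    unfolding double_covering_type_def using numerical_pole_semigroup by blast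
qed

end

section \<open>Free modules over a polynomial ring\<close>

text \<open>The least subdegree among nonzero summands is attained once, so its leading term
  survives.\<close>

lemma fls_sum_distinct_subdegrees:
  fixes t :: "'i \<Rightarrow> 'k::field fls"
  assumes "finite J" "\<exists>j\<in>J. t j \<noteq> 0"
    and "\<And>i j. i \<in> J \<Longrightarrow> j \<in> J \<Longrightarrow> t i \<noteq> 0 \<Longrightarrow> t j \<noteq> 0 \<Longrightarrow> fls_subdegree (t i) = fls_subdegree (t j) \<Longrightarrow> i = j"
  shows "\<exists>j\<in>J. t j \<noteq> 0 \<and> sum t J \<noteq> 0 \<and> fls_subdegree (sum t J) = fls_subdegree (t j)"
  using assms
proof (induction J rule: finite_induct)
  case (insert j J)
  show ?case
  proof (cases "\<exists>j\<in>J. t j \<noteq> 0")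
    case False
    then have "sum t J = 0" by (intro sum.neutral) auto
    then show ?thesis using insert False by auto
  next
    case True
    then obtain i where i: "i \<in> J" "t i \<noteq> 0" "sum t J \<noteq> 0" "fls_subdegree (sum t J) = fls_subdegree (t i)"
      using insert.IH insert.prems(2) by blast
    show ?thesis
    proof (cases "t j = 0")
      case True
      then show ?thesis using i insert by auto
    next
      case False
      then have ne: "fls_subdegree (t j) \<noteq> fls_subdegree (sum t J)"
        using insert.prems(2)[of j i] i insert.hyps by auto
      have eq: "sum t (insert j J) = t j + sum t J" using insert by simp
      show ?thesis
      proof (cases "fls_subdegree (t j) < fls_subdegree (sum t J)")
        case True
        then have "fls_subdegree (t j + sum t J) = fls_subdegree (t j)" using False by (intro fls_subdegree_add_eq1)
        moreover have "t j + sum t J \<noteq> 0" using ne by (metis add_eq_0_iff fls_uminus_subdegree)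
        ultimately show ?thesis using False eq by auto
      next
        case False
        then have "fls_subdegree (t j + sum t J) = fls_subdegree (sum t J)" using ne i by (intro fls_subdegree_add_eq2) auto
        moreover have "t j + sum t J \<noteq> 0" using ne by (metis add_eq_0_iff fls_uminus_subdegree)
        ultimately show ?thesis using i eq by auto
      qed
    qed
  qed
qed simp

lemma peval_subdegree:
  fixes x :: "'k::field fls"
  assumes x: "fls_subdegree x = - int m" "m > 0" and p: "p \<noteq> 0"
  shows "peval p x \<noteq> 0 \<and> fls_subdegree (peval p x) = - int (m * degree p)"
  using p
proof (induction p)
  case (pCons c p)
  have x0: "x \<noteq> 0" using x by auto
  show ?case
  proof (cases "p = 0")
    case True
    then show ?thesis using pCons by simp
  next
    case False
    then have nz: "x * peval p x \<noteq> 0" and sd: "fls_subdegree (x * peval p x) = - int (m + m * degree p)"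
      using pCons.IH x0 x by auto
    have "0 < m + m * degree p" using x(2) by simp
    then have "- int (m + m * degree p) < 0" by linarith
    then have lt: "fls_subdegree (x * peval p x) < fls_subdegree (fls_const c)" by (simp only: sd fls_const_subdegree)
    have "fls_subdegree (fls_const c + x * peval p x) = fls_subdegree (x * peval p x)"
      using nz lt by (rule fls_subdegree_add_eq2)
    then have "fls_subdegree (peval (pCons c p) x) = - int (m * degree (pCons c p))" using sd False by simp
    moreover have "m * degree (pCons c p) > 0" using False x(2) by simp
    ultimately show ?thesis by (metis fls_zero_subdegree neg_equal_0_iff_equal of_nat_0_eq_iff less_irrefl)
  qed
qed simp

lemma flip_peval: "flip (peval p x) = peval p (flip x)"
  by (induction p) (auto simp: flip_add flip_mult)

lemma peval_minus: "peval (- p) f = - peval p f"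
  by (induction p) auto

lemma peval_uminus: "peval p (- x) = peval (pcompose p [:0, - 1:]) x"
  by (induction p) (auto simp: pcompose_pCons peval_add peval_minus algebra_simps)

text \<open>The \<open>d j\<close> are distinct modulo \<open>m\<close> and there are
  \<open>m\<close> of them, so they exhaust the residue classes: once products stay in the span,
  they are the Apery set of its pole semigroup with respect to \<open>m\<close>.\<close>

locale free_module =
  fixes x :: "'k::{alg_closed_field, field_char_0} fls" and m :: nat and b :: "nat \<Rightarrow> 'k fls" and d :: "nat \<Rightarrow> nat"
  assumes m_pos: "m > 0" and x_subdegree: "fls_subdegree x = - int m"
    and b_0: "b 0 = 1"
    and b_subdegree: "j < m \<Longrightarrow> fls_subdegree (b j) = - int (d j)"
    and b_nonzero: "j < m \<Longrightarrow> b j \<noteq> 0"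
    and d_distinct: "i < m \<Longrightarrow> j < m \<Longrightarrow> d i mod m = d j mod m \<Longrightarrow> i = j"
begin

definition span :: "'k fls set" where
  "span = range (\<lambda>p. \<Sum>j<m. peval (p j) x * b j)"

lemma span_add: "a \<in> span \<Longrightarrow> a' \<in> span \<Longrightarrow> a + a' \<in> span"
proof -
  assume "a \<in> span" "a' \<in> span"
  then obtain p p' where "a = (\<Sum>j<m. peval (p j) x * b j)" "a' = (\<Sum>j<m. peval (p' j) x * b j)"
    by (auto simp: span_def)
  then have "a + a' = (\<Sum>j<m. peval (p j + p' j) x * b j)"
    by (simp add: peval_add distrib_right sum.distrib)
  then show ?thesis unfolding span_def by (intro image_eqI[of _ _ "\<lambda>j. p j + p' j"]) simp_all
qed

lemma span_peval_mult: "a \<in> span \<Longrightarrow> peval r x * a \<in> span"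
proof -
  assume "a \<in> span"
  then obtain p where "a = (\<Sum>j<m. peval (p j) x * b j)" by (auto simp: span_def)
  then have "peval r x * a = (\<Sum>j<m. peval (r * p j) x * b j)"
    by (simp add: peval_mult sum_distrib_left mult.assoc)
  then show ?thesis unfolding span_def by (intro image_eqI[of _ _ "\<lambda>j. r * p j"]) simp_all
qed

lemma span_b: "j < m \<Longrightarrow> b j \<in> span"
proof -
  assume j: "j < m"
  have "(\<Sum>i<m. peval (if i = j then [:1:] else 0) x * b i) = (\<Sum>i<m. if i = j then b i else 0)"
    by (intro sum.cong) auto
  also have "\<dots> = b j" using j by simp
  finally have "b j = (\<Sum>i<m. peval (if i = j then [:1:] else 0) x * b i)" ..
  then show ?thesis unfolding span_def by (intro image_eqI[of _ _ "\<lambda>i. if i = j then [:1:] else 0"]) simp_all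
qed

lemma span_1: "1 \<in> span"
  using span_b[of 0] m_pos b_0 by simp

lemma span_x_mult: "a \<in> span \<Longrightarrow> x * a \<in> span"
  using span_peval_mult[of a "[:0, 1:]"] by simp

lemma span_const_mult: "a \<in> span \<Longrightarrow> fls_const c * a \<in> span"
  using span_peval_mult[of a "[:c:]"] by simp

lemma span_x_power: "x ^ i \<in> span" and span_x_power_mult: "a \<in> span \<Longrightarrow> x ^ i * a \<in> span"
proof -
  show *: "a \<in> span \<Longrightarrow> x ^ i * a \<in> span" for a
    by (induction i) (auto simp: mult.assoc span_x_mult)
  show "x ^ i \<in> span" using *[OF span_1] by simp
qed

lemma span_x: "x \<in> span" using span_x_power[of 1] by simp

lemma span_const: "fls_const c \<in> span" using span_const_mult[OF span_1] by simp

lemma span_uminus: "a \<in> span \<Longrightarrow> - a \<in> span"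
  using span_const_mult[of a "-1"] by simp

lemma span_diff: "a \<in> span \<Longrightarrow> a' \<in> span \<Longrightarrow> a - a' \<in> span"
  using span_add[of a "- a'"] span_uminus by simp

lemma span_numeral_mult: "a \<in> span \<Longrightarrow> numeral k * a \<in> span"
  using span_const_mult[of a "numeral k"] by simp

lemmas span_intros = span_add span_diff span_uminus span_x_mult span_x_power_mult span_const_mult
  span_numeral_mult span_x_power span_x span_const span_1

lemma span_induct [consumes 1, case_names monomial add zero]:
  assumes "a \<in> span" and "\<And>j p. j < m \<Longrightarrow> P (peval p x * b j)"
    and "\<And>a a'. P a \<Longrightarrow> P a' \<Longrightarrow> P (a + a')" and "P 0"
  shows "P a"
proof -
  obtain p where a: "a = (\<Sum>j<m. peval (p j) x * b j)" using assms(1) by (auto simp: span_def)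
  have "I \<subseteq> {..<m} \<Longrightarrow> P (\<Sum>j\<in>I. peval (p j) x * b j)" if "finite I" for I
    using that by (induction I rule: finite_induct) (auto intro: assms)
  then show ?thesis unfolding a by blast
qed

lemma span_mult_closed:
  assumes "\<And>j. j < m \<Longrightarrow> b j * h \<in> span" "a \<in> span"
  shows "a * h \<in> span"
  using assms(2)
proof (induction a rule: span_induct)
  case (monomial j p)
  then show ?case using span_peval_mult[OF assms(1)] by (simp add: mult.assoc)
next
  case (add a a')
  then show ?case by (simp add: distrib_right span_add)
next
  case zero
  then show ?case using span_const[of 0] by simp
qed

text \<open>The terms have pole orders \<open>m * degree (p j) + d j\<close> in distinct classes
  modulo \<open>m\<close>, so leading terms cannot cancel.\<close>

lemma span_subdegree:
  assumes "a \<in> span" "a \<noteq> 0"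
  shows "\<exists>i. \<exists>j<m. fls_subdegree a = - int (m * i + d j)"
proof -
  obtain p where a: "a = (\<Sum>j<m. peval (p j) x * b j)" using assms(1) by (auto simp: span_def)
  let ?t = "\<lambda>j. peval (p j) x * b j"
  have t: "p j \<noteq> 0 \<and> fls_subdegree (?t j) = - int (m * degree (p j) + d j)" if "j < m" "?t j \<noteq> 0" for j
  proof -
    have "p j \<noteq> 0" using that by auto
    then show ?thesis using peval_subdegree[OF x_subdegree m_pos, of "p j"] that b_subdegree by simp
  qed
  have "\<exists>j\<in>{..<m}. ?t j \<noteq> 0"
  proof (rule ccontr)
    assume "\<not> (\<exists>j\<in>{..<m}. ?t j \<noteq> 0)"
    then have "a = 0" unfolding a by (intro sum.neutral) auto
    then show False using assms(2) by simp
  qed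
  moreover have "i = j" if "i \<in> {..<m}" "j \<in> {..<m}" "?t i \<noteq> 0" "?t j \<noteq> 0" "fls_subdegree (?t i) = fls_subdegree (?t j)" for i j
  proof -
    have "int (m * degree (p i) + d i) = int (m * degree (p j) + d j)" using t[of i] t[of j] that by simp
    then have "m * degree (p i) + d i = m * degree (p j) + d j" by (simp only: of_nat_eq_iff)
    then have "(m * degree (p i) + d i) mod m = (m * degree (p j) + d j) mod m" by (rule arg_cong)
    then have "d i mod m = d j mod m" by (simp only: mod_mult_self4)
    then show ?thesis by (rule d_distinct[rotated 2]) (use that in simp_all)
  qed
  ultimately have "\<exists>j\<in>{..<m}. ?t j \<noteq> 0 \<and> sum ?t {..<m} \<noteq> 0 \<and> fls_subdegree (sum ?t {..<m}) = fls_subdegree (?t j)"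
    by (intro fls_sum_distinct_subdegrees) simp_all
  then obtain j where j: "j < m" "?t j \<noteq> 0" "fls_subdegree (sum ?t {..<m}) = fls_subdegree (?t j)" by blast
  have "fls_subdegree a = - int (m * degree (p j) + d j)" using t[OF j(1,2)] j(3) unfolding a by simp
  then show ?thesis using j(1) by blast
qed

lemma span_pole: "j < m \<Longrightarrow> x ^ i * b j \<in> span \<and> x ^ i * b j \<noteq> 0 \<and> fls_subdegree (x ^ i * b j) = - int (m * i + d j)"
proof -
  assume j: "j < m"
  have x0: "x \<noteq> 0" using x_subdegree m_pos by auto
  show ?thesis
    using span_x_power_mult[OF span_b[OF j]] x0 b_nonzero[OF j]
    by (simp add: b_subdegree[OF j] fls_subdegree_pow x_subdegree algebra_simps)
qed

text \<open>Closure under products reduces to products of basis elements. All large pole orders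
  occur because the \<open>d j\<close> meet every class modulo \<open>m\<close>.\<close>

lemma span_pole_algebra:
  assumes prod: "\<And>i j. i < m \<Longrightarrow> j < m \<Longrightarrow> b i * b j \<in> span"
  shows "pole_algebra span 1"
proof
  show "(0::nat) < 1" by simp
  show "fls_const c \<in> span" for c by (rule span_const)
  show "a + a' \<in> span" if "a \<in> span" "a' \<in> span" for a a' using that by (rule span_add)
  show "a * a' \<in> span" if a: "a \<in> span" and a': "a' \<in> span" for a a'
    using a'
  proof (induction a' rule: span_induct)
    case (monomial j p)
    have "a * b j \<in> span" by (rule span_mult_closed[OF prod a]) (use monomial in auto)
    then show ?case using span_peval_mult[of "a * b j" p] by (simp add: mult.left_commute)
  next
    case (add u v)
    then show ?case by (simp add: distrib_left span_add)
  next
    case zero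
    then show ?case using span_const[of 0] by simp
  qed
  show "fls_subdegree a \<le> 0" if "a \<in> span" for a
    using span_subdegree[OF that] by (cases "a = 0") (simp, metis neg_le_0_iff_le of_nat_0_le_iff)
  show "int 1 dvd fls_subdegree a" for a by simp
  have img: "(\<lambda>j. d j mod m) ` {..<m} = {..<m}"
  proof (rule endo_inj_surj)
    show "inj_on (\<lambda>j. d j mod m) {..<m}" by (rule inj_onI, rule d_distinct) simp_all
  qed (use m_pos in auto)
  show "\<exists>n0. \<forall>n\<ge>n0. 1 dvd n \<longrightarrow> (\<exists>a\<in>span. fls_subdegree a = - int n)"
  proof (intro exI allI impI)
    fix n assume n: "n \<ge> Max (d ` {..<m})"
    have "n mod m \<in> (\<lambda>j. d j mod m) ` {..<m}" unfolding img using m_pos by simp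
    then obtain j where j: "j < m" "n mod m = d j mod m" by auto
    have "d j \<le> Max (d ` {..<m})" using j(1) by (intro Max_ge) auto
    then have "d j \<le> n" using n by simp
    then have "m dvd n - d j" using j(2) mod_eq_dvd_iff_nat[of "d j" n m] by simp
    then obtain i where "n - d j = m * i" by (rule dvdE)
    then have "n = m * i + d j" using \<open>d j \<le> n\<close> by simp
    then show "\<exists>a\<in>span. fls_subdegree a = - int n" using span_pole[OF j(1), of i] by blast
  qed
qed

end

section \<open>Semigroups of double covering type from free modules\<close>

lemma generated_semigroup_add:
  "a \<in> generated_semigroup S \<Longrightarrow> c \<in> generated_semigroup S \<Longrightarrow> a + c \<in> generated_semigroup S"
  unfolding generated_semigroup_def hull_def nat_submonoid_def by blast

lemma generated_semigroup_mem: "a \<in> S \<Longrightarrow> a \<in> generated_semigroup S"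
  unfolding generated_semigroup_def hull_def by blast

lemma generated_semigroup_0: "0 \<in> generated_semigroup S"
  unfolding generated_semigroup_def hull_def nat_submonoid_def by blast

lemma generated_semigroup_mult: "a \<in> generated_semigroup S \<Longrightarrow> a * i \<in> generated_semigroup S"
  by (induction i) (auto simp: generated_semigroup_0 generated_semigroup_add)

lemma generated_semigroup_minimal: "nat_submonoid H \<Longrightarrow> S \<subseteq> H \<Longrightarrow> generated_semigroup S \<subseteq> H"
  unfolding generated_semigroup_def hull_def by blast

text \<open>The elements divisible by \<open>t\<close> in the local ring at \<open>s\<close>, with
  denominators cleared.\<close>

definition local_multiples :: "'k::field fls set \<Rightarrow> ('k fls \<Rightarrow> 'k) \<Rightarrow> 'k fls \<Rightarrow> 'k fls set" where
  "local_multiples A s t = {f \<in> A. \<exists>u\<in>A. \<exists>g\<in>A. s u \<noteq> 0 \<and> f * u = t * g}"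

lemma local_multiplesI:
  "f \<in> A \<Longrightarrow> u \<in> A \<Longrightarrow> g \<in> A \<Longrightarrow> s u \<noteq> 0 \<Longrightarrow> f * u = t * g \<Longrightarrow> f \<in> local_multiples A s t"
  unfolding local_multiples_def by blast

section \<open>Divisibility by a parameter near a point\<close>

context pole_algebra
begin

context
  fixes s t assumes s: "is_point A s" and t: "t \<in> A"
begin

lemma multiples_self: "t \<in> local_multiples A s t"
  by (rule local_multiplesI[of t A 1 1]) (use s t in auto)

lemma multiples_zero: "0 \<in> local_multiples A s t"
  by (rule local_multiplesI[of 0 A 1 0]) (use s t in auto)

lemma multiples_add:
  assumes "f \<in> local_multiples A s t" "h \<in> local_multiples A s t"
  shows "f + h \<in> local_multiples A s t"
proof -
  obtain u g where 1: "f \<in> A" "u \<in> A" "g \<in> A" "s u \<noteq> 0" "f * u = t * g" using assms by (auto simp: local_multiples_def)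
  obtain v k where 2: "h \<in> A" "v \<in> A" "k \<in> A" "s v \<noteq> 0" "h * v = t * k" using assms by (auto simp: local_multiples_def)
  have "(f + h) * (u * v) = (f * u) * v + (h * v) * u" by (simp add: algebra_simps)
  also have "\<dots> = t * (g * v + k * u)" unfolding 1(5) 2(5) by (simp add: algebra_simps)
  finally show ?thesis
    using 1 2 s by (intro local_multiplesI[of "f + h" A "u * v" "g * v + k * u"]) (auto simp: point_mult intro: add_in mult_in)
qed

lemma multiples_mult:
  assumes "f \<in> local_multiples A s t" "a \<in> A"
  shows "a * f \<in> local_multiples A s t"
proof -
  obtain u g where 1: "f \<in> A" "u \<in> A" "g \<in> A" "s u \<noteq> 0" "f * u = t * g" using assms by (auto simp: local_multiples_def)
  have "(a * f) * u = t * (a * g)" using 1(5) by (simp add: mult.assoc mult.left_commute)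
  then show ?thesis using 1 assms by (intro local_multiplesI[of "a * f" A u "a * g"]) (auto intro: mult_in)
qed

lemma multiples_diff:
  assumes "f \<in> local_multiples A s t" "h \<in> local_multiples A s t"
  shows "f - h \<in> local_multiples A s t"
  using multiples_add[OF assms(1) multiples_mult[OF assms(2) const_in[of "-1"]]] by simp

lemma multiples_cancel:
  assumes "f * v \<in> local_multiples A s t" "f \<in> A" "v \<in> A" "s v \<noteq> 0"
  shows "f \<in> local_multiples A s t"
proof -
  obtain u g where 1: "u \<in> A" "g \<in> A" "s u \<noteq> 0" "f * v * u = t * g" using assms by (auto simp: local_multiples_def)
  then show ?thesis using assms s
    by (intro local_multiplesI[of f A "v * u" g]) (auto simp: point_mult mult.assoc intro: mult_in)
qed

text \<open>Elements congruent to their value modulo \<open>t\<close> near \<open>s\<close>. They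
  form a subalgebra, so for \<open>t\<close> vanishing at \<open>s\<close> it is enough to check
  algebra generators.\<close>

definition "centred = {f \<in> A. f - fls_const (s f) \<in> local_multiples A s t}"

lemma centredI: "f \<in> A \<Longrightarrow> f - fls_const (s f) \<in> local_multiples A s t \<Longrightarrow> f \<in> centred"
  by (simp add: centred_def)

lemma centred_const: "fls_const c \<in> centred"
  using s multiples_zero by (simp add: centred_def)

lemma centred_add: "f \<in> centred \<Longrightarrow> h \<in> centred \<Longrightarrow> f + h \<in> centred"
  using multiples_add[of "f - fls_const (s f)" "h - fls_const (s h)"] s
  by (auto simp: centred_def point_add algebra_simps simp flip: fls_plus_const intro: add_in)

lemma centred_mult:
  assumes "f \<in> centred" "h \<in> centred" shows "f * h \<in> centred"
proof -
  have fh: "f \<in> A" "h \<in> A" "f - fls_const (s f) \<in> local_multiples A s t" "h - fls_const (s h) \<in> local_multiples A s t"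
    using assms by (auto simp: centred_def)
  have "f * h - fls_const (s (f * h)) = f * (h - fls_const (s h)) + fls_const (s h) * (f - fls_const (s f))"
    using fh s by (simp add: point_mult algebra_simps)
  also have "\<dots> \<in> local_multiples A s t"
    by (intro multiples_add multiples_mult fh const_in)
  finally show ?thesis using fh by (intro centredI mult_in)
qed

lemma centred_peval: "f \<in> centred \<Longrightarrow> peval p f \<in> centred"
proof (induction p)
  case 0
  show ?case using centred_const[of 0] by simp
next
  case (pCons c p)
  then show ?case by (simp add: centred_add centred_mult centred_const)
qed

lemma generator_if_centred:
  assumes "s t = 0" "A \<subseteq> centred" shows "local_generator A s t"
proof -
  have "\<exists>u\<in>A. \<exists>g\<in>A. s u \<noteq> 0 \<and> f * u = t * g" if "f \<in> A" "s f = 0" for f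
  proof -
    have "f \<in> local_multiples A s t" using assms(2) that by (auto simp: centred_def)
    then show ?thesis by (auto simp: local_multiples_def)
  qed
  then show ?thesis using assms t by (simp add: local_generator_def)
qed

text \<open>Two linear relations whose minor is a unit at \<open>s\<close> are solved by Cramer's
  rule for \<open>W\<close> and \<open>P\<close> as multiples of \<open>t\<close>.\<close>

lemma multiples_cramer:
  assumes WP: "W \<in> A" "P \<in> A"
    and coeffs: "a1 \<in> A" "b1 \<in> A" "c1 \<in> A" "a2 \<in> A" "b2 \<in> A" "c2 \<in> A"
    and E: "a1 * W + b1 * P + c1 * t = 0" "a2 * W + b2 * P + c2 * t = 0"
    and minor: "s (a1 * b2 - a2 * b1) \<noteq> 0"
  shows "W \<in> local_multiples A s t \<and> P \<in> local_multiples A s t"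
proof
  have "W * (a1 * b2 - a2 * b1) = t * (b1 * c2 - b2 * c1)" using E by Groebner_Basis.algebra
  then show "W \<in> local_multiples A s t"
    using coeffs WP minor by (intro local_multiplesI[of W A "a1 * b2 - a2 * b1" "b1 * c2 - b2 * c1"]) (auto intro: diff_in mult_in)
  have "P * (a1 * b2 - a2 * b1) = t * (a2 * c1 - a1 * c2)" using E by Groebner_Basis.algebra
  then show "P \<in> local_multiples A s t"
    using coeffs WP minor by (intro local_multiplesI[of P A "a1 * b2 - a2 * b1" "a2 * c1 - a1 * c2"]) (auto intro: diff_in mult_in)
qed

end

end

context free_module
begin

lemma span_subset_centred:
  assumes prod: "\<And>i j. i < m \<Longrightarrow> j < m \<Longrightarrow> b i * b j \<in> span"
    and s: "is_point span s" and t: "t \<in> span" "s t = 0"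
    and gen: "x - fls_const (s x) \<in> local_multiples span s t"
      "\<And>j. j < m \<Longrightarrow> b j \<in> pole_algebra.centred span s t"
  shows "local_generator span s t"
proof -
  interpret pole_algebra span 1 by (rule span_pole_algebra[OF prod])
  have x: "x \<in> centred s t" using gen(1) span_x by (intro centredI[OF s t(1)])
  have "a \<in> centred s t" if "a \<in> span" for a
    using that
  proof (induction a rule: span_induct)
    case (monomial j p)
    then show ?case by (intro centred_mult[OF s t(1)] centred_peval[OF s t(1) x] gen(2))
  next
    case (add a a')
    then show ?case by (rule centred_add[OF s t(1)])
  next
    case zero
    then show ?case using centred_const[OF s t(1), of 0] by simp
  qed
  then show ?thesis using t(2) by (intro generator_if_centred[OF s t(1)]) auto
qed

text \<open>The assumptions on \<open>S\<close> place the basis orders in the generated semigroup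
  and the generators among the pole orders, which identifies the two. \<open>flip\<close> turns a
  polynomial in \<open>x\<close> into one in \<open>- x\<close>, so the span is stable.\<close>

lemma span_double_covering_type:
  assumes prod: "\<And>i j. i < m \<Longrightarrow> j < m \<Longrightarrow> b i * b j \<in> span"
    and flip_x: "flip x = - x" and flip_b: "\<And>j. j < m \<Longrightarrow> flip (b j) = b j \<or> flip (b j) = - b j"
    and smooth: "\<And>s. is_point span s \<Longrightarrow> \<exists>t. local_generator span s t"
    and S: "m \<in> S" "\<And>j. j < m \<Longrightarrow> d j \<in> generated_semigroup S" "\<And>n. n \<in> S \<Longrightarrow> \<exists>i. \<exists>j<m. n = m * i + d j"
  shows "double_covering_type TYPE('k) (generated_semigroup S)"
proof -
  interpret pole_algebra span 1 by (rule span_pole_algebra[OF prod])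
  have flip: "flip a \<in> span" if "a \<in> span" for a
    using that
  proof (induction a rule: span_induct)
    case (monomial j p)
    have "peval (pcompose p [:0, - 1:]) x * b j \<in> span" by (intro span_peval_mult span_b monomial)
    then show ?case using flip_b[OF monomial] span_uminus
      by (auto simp: flip_mult flip_peval flip_x peval_uminus)
  next
    case (add a a')
    then show ?case by (simp add: flip_add add_in)
  qed simp
  interpret flip_algebra span
    by unfold_locales (auto intro: smooth flip)
  have poles: "pole_semigroup = {n. \<exists>i. \<exists>j<m. n = m * i + d j}"
  proof (rule equalityI; rule subsetI)
    fix n assume "n \<in> pole_semigroup"
    then obtain a where a: "a \<in> span" "a \<noteq> 0" "fls_subdegree a = - int n" by (auto simp: pole_semigroup_def)
    then obtain i j where "j < m" "- int n = - int (m * i + d j)" using span_subdegree by metis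
    then have "n = m * i + d j" by (simp only: neg_equal_iff_equal of_nat_eq_iff)
    then show "n \<in> {n. \<exists>i. \<exists>j<m. n = m * i + d j}" using \<open>j < m\<close> by blast
  next
    fix n assume "n \<in> {n. \<exists>i. \<exists>j<m. n = m * i + d j}"
    then obtain i j where ij: "j < m" "n = m * i + d j" by blast
    show "n \<in> pole_semigroup" unfolding pole_semigroup_def ij(2) using span_pole[OF ij(1), of i] by blast
  qed
  have "pole_semigroup = generated_semigroup S"
  proof
    show "pole_semigroup \<subseteq> generated_semigroup S"
      unfolding poles
      using generated_semigroup_add[OF generated_semigroup_mult[OF generated_semigroup_mem[OF S(1)]] S(2)] by blast
    show "generated_semigroup S \<subseteq> pole_semigroup"
    proof (rule generated_semigroup_minimal)
      show "nat_submonoid pole_semigroup" using numerical_pole_semigroup by (simp add: numerical_semigroup_def)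
      show "S \<subseteq> pole_semigroup" unfolding poles using S(3) by blast
    qed
  qed
  then show ?thesis using double_covering_type by simp
qed

end

section \<open>Roots of even power series\<close>

lemma fls_power_nth_0:
  fixes f :: "'k::field fls"
  assumes "fls_subdegree f \<ge> 0"
  shows "(f ^ n) $$ 0 = (f $$ 0) ^ n"
proof (induction n)
  case (Suc n)
  have "fls_subdegree (f ^ n) \<ge> 0" using assms by (rule fls_pow_subdegree_ge0)
  then show ?case using Suc assms by (simp add: fls_nth_0_mult)
qed simp

text \<open>In the factorisation of \<open>f ^ Suc k - h ^ Suc k\<close> the cofactor of
  \<open>f - h\<close> has constant term \<open>Suc k\<close>, nonzero in characteristic 0.\<close>

lemma fls_root_unique:
  fixes f h :: "'k::field_char_0 fls"
  assumes "fls_subdegree f \<ge> 0" "fls_subdegree h \<ge> 0" "f $$ 0 = 1" "h $$ 0 = 1" "f ^ Suc k = h ^ Suc k"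
  shows "f = h"
proof -
  let ?S = "\<Sum>p<Suc k. f ^ p * h ^ (k - p)"
  have "(f ^ p * h ^ (k - p)) $$ 0 = 1" for p
    using assms by (subst fls_nth_0_mult) (auto simp: fls_pow_subdegree_ge0 fls_power_nth_0)
  moreover have "?S $$ 0 = (\<Sum>p<Suc k. (f ^ p * h ^ (k - p)) $$ 0)"
    by (induction "Suc k") (simp_all add: fls_nth_sum)
  ultimately have "?S $$ 0 = of_nat (Suc k)" by simp
  then have "?S \<noteq> 0" by (metis fls_zero_nth of_nat_neq_0)
  moreover have "(f - h) * ?S = 0" using assms(5) diff_power_eq_sum[of f k h] by simp
  ultimately show ?thesis by simp
qed

text \<open>The power series radical with constant term 1 is unique, and \<open>flip f\<close> is
  another one, so \<open>f\<close> is even.\<close>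

lemma even_root_exists:
  fixes c :: "'k::field_char_0 fls"
  assumes c: "fls_subdegree c \<ge> 0" "c $$ 0 = 1" "flip c = c"
  obtains f where "f ^ Suc k = c" "f \<noteq> 0" "fls_subdegree f = 0" "f $$ 0 = 1" "flip f = f"
proof -
  define C where "C = fls_regpart c"
  have cC: "c = fps_to_fls C" using c(1) by (simp add: C_def fls_regpart_to_fls_trivial)
  have C0: "fps_nth C 0 = 1" using c(2) by (simp add: C_def)
  define R where "R = fps_radical (\<lambda>_ _. 1) (Suc k) C"
  have R: "R ^ Suc k = C" unfolding R_def using power_radical[of C "\<lambda>_ _. 1" k] C0 by simp
  have R0: "fps_nth R 0 = 1" by (simp add: R_def)
  define f where "f = fps_to_fls R"
  have fk: "f ^ Suc k = c" unfolding f_def cC R[symmetric] by (simp add: fps_to_fls_power del: power_Suc)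
  have f0: "f $$ 0 = 1" using R0 by (simp add: f_def)
  have sd: "fls_subdegree f \<ge> 0" by (simp add: f_def fls_subdegree_fls_to_fps_gt0)
  moreover have "fls_subdegree f \<le> 0" using f0 by (intro fls_subdegree_leI) simp
  ultimately have sd0: "fls_subdegree f = 0" by simp
  have "flip f = f" by (rule fls_root_unique[of "flip f" f k]) (use sd f0 fk c(3) in \<open>simp_all add: flip_power[symmetric] del: power_Suc\<close>)
  moreover have "f \<noteq> 0" using f0 by auto
  ultimately show thesis using that fk f0 sd0 by blast
qed

section \<open>The three semigroups\<close>

lemma flip_X_inv [simp]: "flip (fls_X_inv :: 'k::field fls) = - fls_X_inv"
  and flip_X [simp]: "flip (fls_X :: 'k fls) = - fls_X"
  by (rule fls_eqI, simp)+

lemma X_inv_times_X [simp]: "(fls_X_inv :: 'k::field fls) * fls_X = 1"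
  by (rule fls_eqI) (simp add: fls_X_inv_times_conv_shift)

lemma X_inv_power_mult:
  assumes "j \<le> i"
  shows "(fls_X_inv :: 'k::field fls) ^ i * fls_X ^ j = fls_X_inv ^ (i - j)"
proof -
  have "(fls_X_inv :: 'k fls) ^ i = fls_X_inv ^ (i - j) * fls_X_inv ^ j" using assms by (simp flip: power_add)
  then have "(fls_X_inv :: 'k fls) ^ i * fls_X ^ j = fls_X_inv ^ (i - j) * (fls_X_inv * fls_X) ^ j"
    by (simp only: power_mult_distrib mult.assoc)
  then show ?thesis by simp
qed

lemma fls_const_homs: "fls_const (a + b) = fls_const a + fls_const b" "fls_const (a * b) = fls_const a * fls_const b"
    "fls_const (a - b) = fls_const a - fls_const b" "fls_const (a ^ n) = fls_const a ^ n"
  for a b :: "'k::field"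
  by (simp_all add: fls_plus_const fls_minus_const fls_const_power)

text \<open>The curve \<open>y^3 = x^5 + x\<close>, with the involution \<open>(x, y) \<mapsto> (-x, -y)\<close>.\<close>

lemma double_covering_type_3_5:
  "double_covering_type TYPE('k::{alg_closed_field, field_char_0}) (generated_semigroup {3, 5})"
proof -
  let ?T = "fls_X_inv :: 'k fls" and ?X = "fls_X :: 'k fls"
  have "fls_subdegree (1 + ?X ^ 12) \<ge> 0" by (rule fls_subdegree_ge0I) simp
  moreover have "flip (1 + ?X ^ 12) = 1 + ?X ^ 12" by (simp add: flip_add flip_power)
  \<comment> \<open>With \<open>x = ?T ^ 3\<close>, \<open>x ^ 5 + x\<close> is
    \<open>?T ^ 15\<close> times this series, and \<open>y\<close> is its cube root.\<close>
  ultimately obtain c where c: "c ^ Suc 2 = 1 + ?X ^ 12" "c \<noteq> 0" "fls_subdegree c = 0" "flip c = c"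
    using even_root_exists[of "1 + ?X ^ 12" 2] by auto
  define x where "x = ?T ^ 3"
  define y where "y = ?T ^ 5 * c"
  have "y ^ 3 = ?T ^ 15 * c ^ Suc 2" by (simp add: y_def power_mult_distrib flip: power_mult)
  also have "\<dots> = ?T ^ 15 + ?T ^ 3" unfolding c(1) by (simp add: distrib_left X_inv_power_mult)
  finally have y3: "y ^ 3 = x ^ 5 + x" by (simp add: x_def flip: power_mult)
  have y: "y \<noteq> 0" "fls_subdegree y = - 5" using c by (simp_all add: y_def fls_subdegree_pow)
  have less_3: "j < 3 \<longleftrightarrow> j = 0 \<or> j = 1 \<or> j = 2" for j :: nat by auto
  \<comment> \<open>0, 5, 10 is the Apery set of the semigroup with respect to 3.\<close>
  interpret M: free_module x 3 "\<lambda>j. [1, y, y ^ 2] ! j" "\<lambda>j. [0, 5, 10] ! j"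
    by unfold_locales (use y in \<open>auto simp: x_def less_3 fls_subdegree_pow\<close>)
  have yA: "y \<in> M.span" "y ^ 2 \<in> M.span" using M.span_b[of 1] M.span_b[of 2] by simp_all
  have mult_y: "a * y \<in> M.span" if "a \<in> M.span" for a
  proof (rule M.span_mult_closed[OF _ that])
    fix j :: nat assume "j < 3"
    moreover have "y ^ 2 * y = x ^ 5 + x" using y3 by (simp add: power2_eq_square power3_eq_cube)
    moreover have "x ^ 5 + x \<in> M.span" by (intro M.span_intros)
    ultimately show "[1, y, y ^ 2] ! j * y \<in> M.span" using yA by (auto simp: less_3 power2_eq_square)
  qed
  have prod: "[1, y, y ^ 2] ! i * [1, y, y ^ 2] ! j \<in> M.span" if "i < 3" "j < 3" for i j
    using that(2) mult_y[OF M.span_b[OF that(1)]] mult_y[OF mult_y[OF M.span_b[OF that(1)]]] M.span_b[OF that(1)]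
    by (auto simp: less_3 power2_eq_square mult.assoc)
  interpret P: pole_algebra M.span 1 by (rule M.span_pole_algebra[OF prod])
  note xA = M.span_x
  have smooth: "\<exists>t. local_generator M.span s t" if s: "is_point M.span s" for s
  proof -
    note ps = P.point_simps[OF s] P.point_const[OF s] P.point_1[OF s]
    define a b where "a = s x" and "b = s y"
    define al be where "al = fls_const a" and "be = fls_const b"
    have sab: "s x = a" "s y = b" "s al = a" "s be = b" and abA: "al \<in> M.span" "be \<in> M.span"
      using ps by (simp_all add: a_def b_def al_def be_def M.span_const)
    note mem = xA yA abA
    have rel: "b ^ 3 = a ^ 5 + a"
      using arg_cong[OF y3, of s] mem by (simp add: ps P.closed sab)
    then have relc: "be ^ 3 = al ^ 5 + al"
      unfolding al_def be_def by (simp only: fls_const_homs[symmetric])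
    have gens: "local_generator M.span s t"
      if t: "t \<in> M.span" "s t = 0" "x - al \<in> local_multiples M.span s t" "y - be \<in> local_multiples M.span s t" for t
    proof (rule M.span_subset_centred[OF prod s t(1,2)])
      show "x - fls_const (s x) \<in> local_multiples M.span s t" using t(3) by (simp add: al_def a_def)
      have yc: "y \<in> P.centred s t" using t(4) yA by (intro P.centredI[OF s t(1)]) (simp_all add: be_def b_def)
      have one: "1 \<in> P.centred s t" using P.centred_const[OF s t(1), of 1] by simp
      show "[1, y, y ^ 2] ! j \<in> P.centred s t" if "j < 3" for j
        using that one yc P.centred_mult[OF s t(1) yc yc] by (auto simp: less_3 power2_eq_square)
    qed
    show ?thesis
    proof (cases "b = 0")
      case False
      \<comment> \<open>Where \<open>b\<close> is nonzero, \<open>x\<close> is unramified: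
        subtracting the equation at \<open>s\<close> exhibits \<open>y - be\<close> as a multiple of
        \<open>x - al\<close>, up to a unit with value \<open>3 * b ^ 2\<close>.\<close>
      have "(y - be) * (y ^ 2 + be * y + be ^ 2) =
          (x - al) * (x ^ 4 + al * x ^ 3 + al ^ 2 * x ^ 2 + al ^ 3 * x + al ^ 4 + 1)"
        using y3 relc by Groebner_Basis.algebra
      moreover have "s (y ^ 2 + be * y + be ^ 2) = b ^ 2 + b * b + b ^ 2"
        using mem by (simp add: ps P.closed sab)
      then have "s (y ^ 2 + be * y + be ^ 2) = 3 * b ^ 2" by (simp add: power2_eq_square)
      ultimately have "y - be \<in> local_multiples M.span s (x - al)"
        using mem False by (intro local_multiplesI[of _ _ "y ^ 2 + be * y + be ^ 2"
          "x ^ 4 + al * x ^ 3 + al ^ 2 * x ^ 2 + al ^ 3 * x + al ^ 4 + 1"]) (auto intro!: P.closed)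
      moreover have t: "x - al \<in> M.span" "s (x - al) = 0" using mem by (simp_all add: ps P.closed sab)
      ultimately show ?thesis using gens P.multiples_self[OF s t(1)] by blast
    next
      case True
      have be0: "be = 0" using True by (simp add: be_def)
      then have alc: "al ^ 5 + al = 0" using relc by simp
      \<comment> \<open>At a root of \<open>x ^ 5 + x\<close> the parameter is \<open>y\<close>. The
        cofactor of \<open>x - al\<close> has as value the derivative \<open>5 * a ^ 4 + 1\<close>,
        nonzero because the roots are simple.\<close>
      have "(x - al) * (x ^ 4 + al * x ^ 3 + al ^ 2 * x ^ 2 + al ^ 3 * x + al ^ 4 + 1) = y * y ^ 2"
        using y3 alc by Groebner_Basis.algebra
      moreover have "s (x ^ 4 + al * x ^ 3 + al ^ 2 * x ^ 2 + al ^ 3 * x + al ^ 4 + 1) = 5 * a ^ 4 + 1"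
        using mem by (simp add: ps P.closed sab) (simp add: power_numeral_reduce)
      moreover have "5 * a ^ 4 + 1 \<noteq> 0"
      proof
        assume 5: "5 * a ^ 4 + 1 = 0"
        have "a * (a ^ 4 + 1) = 0" using rel True by (simp add: algebra_simps power_numeral_reduce)
        then have "a = 0 \<or> a ^ 4 = - 1" by (simp add: eq_neg_iff_add_eq_0)
        then show False using 5 by auto
      qed
      ultimately have "x - al \<in> local_multiples M.span s y"
        using mem by (intro local_multiplesI[of _ _ "x ^ 4 + al * x ^ 3 + al ^ 2 * x ^ 2 + al ^ 3 * x + al ^ 4 + 1" "y ^ 2"])
          (auto intro!: P.closed)
      moreover have "s y = 0" using True sab by simp
      ultimately show ?thesis using gens[OF yA(1)] P.multiples_self[OF s yA(1)] be0 by auto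
    qed
  qed
  have "5 + 5 \<in> generated_semigroup {3, 5::nat}" by (intro generated_semigroup_add generated_semigroup_mem) auto
  then have d: "[0, 5, 10] ! j \<in> generated_semigroup {3, 5}" if "j < 3" for j
    using that generated_semigroup_0 generated_semigroup_mem[of 5 "{3, 5}"] by (auto simp: less_3)
  show ?thesis
  proof (rule M.span_double_covering_type[OF prod _ _ smooth _ d])
    show "flip x = - x" by (simp add: x_def flip_power)
    have "flip y = - y" using c by (simp add: y_def flip_power flip_mult)
    then show "flip ([1, y, y ^ 2] ! j) = [1, y, y ^ 2] ! j \<or> flip ([1, y, y ^ 2] ! j) = - [1, y, y ^ 2] ! j" if "j < 3" for j
      using that by (auto simp: less_3 flip_power)
    fix n :: nat assume "n \<in> {3, 5}"
    then have "n = 3 * 1 + [0, 5, 10] ! 0 \<or> n = 3 * 0 + [0, 5, 10] ! 1" by auto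
    moreover have "(0::nat) < 3" "(1::nat) < 3" by simp_all
    ultimately show "\<exists>i. \<exists>j<3. n = 3 * i + [0, 5, 10] ! j" by blast
  qed auto
qed

text \<open>
  The cyclic triple cover \<open>y^2 = (x^2 + 1) z\<close>, \<open>z^2 = (x^3 - x) y\<close>, \<open>y z = (x^3 - x) (x^2 + 1)\<close>,
  with the involution \<open>(x, y, z) \<mapsto> (-x, -y, z)\<close>.
\<close>

lemma double_covering_type_3_7_8:
  "double_covering_type TYPE('k::{alg_closed_field, field_char_0}) (generated_semigroup {3, 7, 8})"
proof -
  let ?T = "fls_X_inv :: 'k fls" and ?X = "fls_X :: 'k fls"
  have "fls_subdegree (1 - ?X ^ 6) \<ge> 0" by (rule fls_subdegree_ge0I) simp
  moreover have "flip (1 - ?X ^ 6) = 1 - ?X ^ 6" by (simp add: flip_diff flip_power)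
  ultimately obtain c where c: "c ^ Suc 2 = 1 - ?X ^ 6" "c \<noteq> 0" "fls_subdegree c = 0" "flip c = c"
    using even_root_exists[of "1 - ?X ^ 6" 2] by auto
  have "fls_subdegree (1 + ?X ^ 6) \<ge> 0" by (rule fls_subdegree_ge0I) simp
  moreover have "flip (1 + ?X ^ 6) = 1 + ?X ^ 6" by (simp add: flip_add flip_power)
  ultimately obtain e where e: "e ^ Suc 2 = 1 + ?X ^ 6" "e \<noteq> 0" "fls_subdegree e = 0" "flip e = e"
    using even_root_exists[of "1 + ?X ^ 6" 2] by auto
  define x where "x = ?T ^ 3"
  \<comment> \<open>\<open>y\<close> and \<open>z\<close> are cube roots of
    \<open>(x ^ 3 - x) * (x ^ 2 + 1) ^ 2\<close> and \<open>(x ^ 3 - x) ^ 2 * (x ^ 2 + 1)\<close>.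
    The ring of \<open>x\<close> and \<open>y\<close> alone is singular over the zeros of
    \<open>x ^ 2 + 1\<close>; \<open>z\<close>, which is \<open>y ^ 2\<close> divided by
    \<open>x ^ 2 + 1\<close>, repairs this.\<close>
  define y where "y = ?T ^ 7 * (c * e ^ 2)"
  define z where "z = ?T ^ 8 * (c ^ 2 * e)"
  have cx: "?T ^ 9 * c ^ 3 = x ^ 3 - x"
  proof -
    have "?T ^ 9 * c ^ 3 = ?T ^ 9 * c ^ Suc 2" by simp
    also have "\<dots> = ?T ^ 9 - ?T ^ 3" unfolding c(1) by (simp add: right_diff_distrib X_inv_power_mult)
    finally show ?thesis by (simp add: x_def flip: power_mult)
  qed
  have ex: "?T ^ 6 * e ^ 3 = x ^ 2 + 1"
  proof -
    have "?T ^ 6 * e ^ 3 = ?T ^ 6 * e ^ Suc 2" by simp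
    also have "\<dots> = ?T ^ 6 + 1" unfolding e(1) by (simp add: distrib_left X_inv_power_mult)
    finally show ?thesis by (simp add: x_def flip: power_mult)
  qed
  have "y * z = (?T ^ 9 * c ^ 3) * (?T ^ 6 * e ^ 3)"
    unfolding y_def z_def by Groebner_Basis.algebra
  then have yz: "y * z = (x ^ 3 - x) * (x ^ 2 + 1)" by (simp only: cx ex)
  have "y * y = (?T ^ 6 * e ^ 3) * z" unfolding y_def z_def by Groebner_Basis.algebra
  then have yy: "y * y = (x ^ 2 + 1) * z" by (simp only: ex)
  have "z * z = (?T ^ 9 * c ^ 3) * y" unfolding y_def z_def by Groebner_Basis.algebra
  then have zz: "z * z = (x ^ 3 - x) * y" by (simp only: cx)
  have y: "y \<noteq> 0" "fls_subdegree y = - 7" using c e by (simp_all add: y_def fls_subdegree_pow)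
  have z: "z \<noteq> 0" "fls_subdegree z = - 8" using c e by (simp_all add: z_def fls_subdegree_pow)
  have less_3: "j < 3 \<longleftrightarrow> j = 0 \<or> j = 1 \<or> j = 2" for j :: nat by auto
  interpret M: free_module x 3 "\<lambda>j. [1, y, z] ! j" "\<lambda>j. [0, 7, 8] ! j"
    by unfold_locales (use y z in \<open>auto simp: x_def less_3 fls_subdegree_pow\<close>)
  have yA: "y \<in> M.span" "z \<in> M.span" using M.span_b[of 1] M.span_b[of 2] by simp_all
  have "(x ^ 2 + 1) * z = x ^ 2 * z + z" "(x ^ 3 - x) * y = x ^ 3 * y - x * y"
    "(x ^ 3 - x) * (x ^ 2 + 1) = x ^ 5 - x" by Groebner_Basis.algebra+
  moreover have "x ^ 2 * z + z \<in> M.span" "x ^ 3 * y - x * y \<in> M.span" "x ^ 5 - x \<in> M.span"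
    using yA by (auto intro!: M.span_intros)
  ultimately have prods: "y * y \<in> M.span" "z * z \<in> M.span" "y * z \<in> M.span" "z * y \<in> M.span"
    using yy zz yz by (simp_all add: mult.commute)
  have prod: "[1, y, z] ! i * [1, y, z] ! j \<in> M.span" if "i < 3" "j < 3" for i j
    using that prods yA M.span_1 by (auto simp: less_3)
  interpret P: pole_algebra M.span 1 by (rule M.span_pole_algebra[OF prod])
  note xA = M.span_x
  have smooth: "\<exists>t. local_generator M.span s t" if s: "is_point M.span s" for s
  proof -
    note ps = P.point_simps[OF s] P.point_const[OF s] P.point_1[OF s]
    define a b k where "a = s x" and "b = s y" and "k = s z"
    define al be ka where "al = fls_const a" and "be = fls_const b" and "ka = fls_const k"
    have sab: "s x = a" "s y = b" "s z = k" "s al = a" "s be = b" "s ka = k"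
      and abA: "al \<in> M.span" "be \<in> M.span" "ka \<in> M.span"
      using ps by (simp_all add: a_def b_def k_def al_def be_def ka_def M.span_const)
    note mem = xA yA abA
    have rel: "b * k = (a ^ 3 - a) * (a ^ 2 + 1)" "b * b = (a ^ 2 + 1) * k" "k * k = (a ^ 3 - a) * b"
      using arg_cong[OF yz, of s] arg_cong[OF yy, of s] arg_cong[OF zz, of s] mem
      by (simp_all add: ps P.closed sab)
    have gens: "local_generator M.span s t"
      if t: "t \<in> M.span" "s t = 0" "x - al \<in> local_multiples M.span s t"
        "y - be \<in> local_multiples M.span s t" "z - ka \<in> local_multiples M.span s t" for t
    proof (rule M.span_subset_centred[OF prod s t(1,2)])
      show "x - fls_const (s x) \<in> local_multiples M.span s t" using t(3) by (simp add: al_def a_def)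
      have yc: "y \<in> P.centred s t" using t(4) yA by (intro P.centredI[OF s t(1)]) (simp_all add: be_def b_def)
      have zc: "z \<in> P.centred s t" using t(5) yA by (intro P.centredI[OF s t(1)]) (simp_all add: ka_def k_def)
      have one: "1 \<in> P.centred s t" using P.centred_const[OF s t(1), of 1] by simp
      show "[1, y, z] ! j \<in> P.centred s t" if "j < 3" for j
        using that one yc zc by (auto simp: less_3)
    qed
    \<comment> \<open>Unramified points of \<open>x\<close>, zeros of \<open>x ^ 3 - x\<close> with
      parameter \<open>y\<close>, and zeros of \<open>x ^ 2 + 1\<close> with parameter
      \<open>z\<close>.\<close>
    consider "(a ^ 3 - a) * (a ^ 2 + 1) \<noteq> 0" | "a ^ 3 - a = 0" | "a ^ 2 + 1 = 0" by fastforce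
    then show ?thesis
    proof cases
      case 1
      then have bk: "b \<noteq> 0" "k \<noteq> 0" using rel(1) by auto
      have t: "x - al \<in> M.span" "s (x - al) = 0" using mem by (simp_all add: ps P.closed sab)
      \<comment> \<open>Each of \<open>y\<close> and \<open>z\<close> satisfies a pure cubic
        equation over \<open>x\<close>, so its difference with the value at \<open>s\<close> is
        compared with \<open>x - al\<close> separately.\<close>
      have rb: "b ^ 3 = (a ^ 3 - a) * (a ^ 2 + 1) ^ 2" and rk: "k ^ 3 = (a ^ 3 - a) ^ 2 * (a ^ 2 + 1)"
        using rel by Groebner_Basis.algebra+
      have "be ^ 3 = fls_const (b ^ 3)" "ka ^ 3 = fls_const (k ^ 3)" by (simp_all add: be_def ka_def fls_const_power)
      then have rbc: "be ^ 3 = (al ^ 3 - al) * (al ^ 2 + 1) ^ 2" and rkc: "ka ^ 3 = (al ^ 3 - al) ^ 2 * (al ^ 2 + 1)"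
        by (simp_all only: rb rk fls_const_homs al_def fls_const_1)
      have "(y - be) * (y ^ 2 + be * y + be ^ 2) = y ^ 3 - be ^ 3" by Groebner_Basis.algebra
      also have "y ^ 3 = (x ^ 3 - x) * (x ^ 2 + 1) ^ 2" using yy yz by Groebner_Basis.algebra
      also have "(x ^ 3 - x) * (x ^ 2 + 1) ^ 2 - be ^ 3 = (x - al) *
          ((x^6 + x^5*al + x^4*al^2 + x^3*al^3 + x^2*al^4 + x*al^5 + al^6) +
           (x^4 + x^3*al + x^2*al^2 + x*al^3 + al^4) - (x^2 + x*al + al^2) - 1)"
        unfolding rbc by Groebner_Basis.algebra
      finally have ey: "(y - be) * (y ^ 2 + be * y + be ^ 2) = \<dots>" .
      have "s (y ^ 2 + be * y + be ^ 2) = 3 * b ^ 2"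
        using mem by (simp add: ps P.closed sab power2_eq_square)
      then have ym: "y - be \<in> local_multiples M.span s (x - al)"
        using mem bk by (intro local_multiplesI[OF _ _ _ _ ey]) (auto intro!: P.closed)
      have "(z - ka) * (z ^ 2 + ka * z + ka ^ 2) = z ^ 3 - ka ^ 3" by Groebner_Basis.algebra
      also have "z ^ 3 = (x ^ 3 - x) ^ 2 * (x ^ 2 + 1)" using zz yz by Groebner_Basis.algebra
      also have "(x ^ 3 - x) ^ 2 * (x ^ 2 + 1) - ka ^ 3 = (x - al) *
          ((x^7 + x^6*al + x^5*al^2 + x^4*al^3 + x^3*al^4 + x^2*al^5 + x*al^6 + al^7) -
           (x^5 + x^4*al + x^3*al^2 + x^2*al^3 + x*al^4 + al^5) - (x^3 + x^2*al + x*al^2 + al^3) + (x + al))"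
        unfolding rkc by Groebner_Basis.algebra
      finally have ez: "(z - ka) * (z ^ 2 + ka * z + ka ^ 2) = \<dots>" .
      have "s (z ^ 2 + ka * z + ka ^ 2) = 3 * k ^ 2"
        using mem by (simp add: ps P.closed sab power2_eq_square)
      then have zm: "z - ka \<in> local_multiples M.span s (x - al)"
        using mem bk by (intro local_multiplesI[OF _ _ _ _ ez]) (auto intro!: P.closed)
      show ?thesis using gens[OF t P.multiples_self[OF s t(1)] ym zm] by blast
    next
      case 2
      have "a = 0 \<or> a ^ 2 = 1"
      proof -
        have "a * (a ^ 2 - 1) = 0" using 2 by (simp add: algebra_simps power2_eq_square power3_eq_cube)
        then show ?thesis by auto
      qed
      then have B0: "a ^ 2 + 1 \<noteq> 0" by auto
      have k0: "k = 0" using rel(3) 2 by simp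
      then have b0: "b = 0" using rel(2) by simp
      have c0: "be = 0" "ka = 0" by (simp_all add: be_def ka_def b0 k0)
      have "al ^ 3 - al = fls_const (a ^ 3 - a)" by (simp add: al_def fls_const_homs del: fls_const_eq_0_iff)
      then have alc: "al ^ 3 - al = 0" using 2 by simp
      have ez: "z * (x ^ 2 + 1) = y * y" using yy by (simp add: mult.commute)
      have "s (x ^ 2 + 1) = a ^ 2 + 1" using mem by (simp add: ps P.closed sab)
      then have zm: "z - ka \<in> local_multiples M.span s y"
        using mem B0 ez by (simp add: c0, intro local_multiplesI[OF _ _ _ _ ez]) (auto intro!: P.closed)
      \<comment> \<open>\<open>x ^ 3 - x\<close> is \<open>x - al\<close> times a cofactor with
        value \<open>3 * a ^ 2 - 1\<close> at \<open>s\<close>, and the relation for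
        \<open>y * z\<close> supplies the multiple of \<open>y\<close>.\<close>
      have ex': "(x - al) * ((x ^ 2 + x * al + al ^ 2 - 1) * (x ^ 2 + 1)) = y * z"
        using alc yz by Groebner_Basis.algebra
      have "s ((x ^ 2 + x * al + al ^ 2 - 1) * (x ^ 2 + 1)) = (3 * a ^ 2 - 1) * (a ^ 2 + 1)"
        using mem by (simp add: ps P.closed sab power2_eq_square)
      moreover have "3 * a ^ 2 - 1 \<noteq> 0" using \<open>a = 0 \<or> a ^ 2 = 1\<close> by auto
      ultimately have xm: "x - al \<in> local_multiples M.span s y"
        using mem B0 by (intro local_multiplesI[OF _ _ _ _ ex']) (auto intro!: P.closed)
      have "y - be \<in> local_multiples M.span s y" using P.multiples_self[OF s yA(1)] by (simp add: c0)
      then show ?thesis using gens[OF yA(1) _ xm _ zm] sab b0 by blast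
    next
      case 3
      then have a2: "a ^ 2 = - 1" by (simp add: eq_neg_iff_add_eq_0)
      then have a3: "a ^ 3 = - a" by (simp add: power3_eq_cube power2_eq_square)
      have a0: "a \<noteq> 0" using a2 by auto
      have A0: "a ^ 3 - a \<noteq> 0" using a0 unfolding a3 by simp
      have b0: "b = 0" using rel(2) 3 by simp
      then have k0: "k = 0" using rel(3) by simp
      have c0: "be = 0" "ka = 0" by (simp_all add: be_def ka_def b0 k0)
      have "al ^ 2 + 1 = fls_const (a ^ 2 + 1)" by (simp add: al_def fls_const_homs del: fls_const_eq_0_iff)
      then have alc: "al ^ 2 + 1 = 0" using 3 by simp
      have ey: "y * (x ^ 3 - x) = z * z" using zz by (simp add: mult.commute)
      have sA: "s (x ^ 3 - x) = a ^ 3 - a" using mem by (simp add: ps P.closed sab)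
      then have ym: "y - be \<in> local_multiples M.span s z"
        using mem A0 ey by (simp add: c0, intro local_multiplesI[OF _ _ _ _ ey]) (auto intro!: P.closed)
      \<comment> \<open>Here \<open>x ^ 2 + 1\<close> factors as
        \<open>(x - al) * (x + al)\<close>.\<close>
      have ex': "(x - al) * ((x + al) * (x ^ 3 - x)) = z * y"
        using alc yz by Groebner_Basis.algebra
      have "s ((x + al) * (x ^ 3 - x)) = 2 * a * (a ^ 3 - a)"
        using mem by (simp add: ps P.closed sab)
      then have xm: "x - al \<in> local_multiples M.span s z"
        using mem A0 a0 by (intro local_multiplesI[OF _ _ _ _ ex']) (auto intro!: P.closed)
      have "z - ka \<in> local_multiples M.span s z" using P.multiples_self[OF s yA(2)] by (simp add: c0)
      then show ?thesis using gens[OF yA(2) _ xm ym] sab k0 by blast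
    qed
  qed
  have d: "[0, 7, 8] ! j \<in> generated_semigroup {3, 7, 8}" if "j < 3" for j
    using that generated_semigroup_0 generated_semigroup_mem[of 7 "{3, 7, 8}"] generated_semigroup_mem[of 8 "{3, 7, 8}"]
    by (auto simp: less_3)
  show ?thesis
  proof (rule M.span_double_covering_type[OF prod _ _ smooth _ d])
    show "flip x = - x" by (simp add: x_def flip_power)
    have "flip y = - y" "flip z = z" using c e by (simp_all add: y_def z_def flip_power flip_mult)
    then show "flip ([1, y, z] ! j) = [1, y, z] ! j \<or> flip ([1, y, z] ! j) = - [1, y, z] ! j" if "j < 3" for j
      using that by (auto simp: less_3)
    fix n :: nat assume "n \<in> {3, 7, 8}"
    then have "n = 3 * 1 + [0, 7, 8] ! 0 \<or> n = 3 * 0 + [0, 7, 8] ! 1 \<or> n = 3 * 0 + [0, 7, 8] ! 2" by auto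
    moreover have "(0::nat) < 3" "(1::nat) < 3" "(2::nat) < 3" by simp_all
    ultimately show "\<exists>i. \<exists>j<3. n = 3 * i + [0, 7, 8] ! j" by blast
  qed auto
qed

text \<open>
  In the following, \<open>q = u w\<close> and \<open>r = u p\<close> for a rational function \<open>u\<close> with
  \<open>p^2 - 2 u^3 p + 3 u^2 + 3 = 0\<close> (a curve of genus two) and \<open>w^2 = 2 u^2 p - 3 u - 2 p\<close>.
  The canonical model of the resulting curve of genus five is an intersection of three quadrics,
  and the next lemma is the Jacobian criterion for it after elimination of \<open>r\<close>.
\<close>

lemma quadrics_jacobian:
  fixes w p q r :: "'k::field_char_0"
  assumes rel: "w * r = p * q" "w * q = p ^ 2 - 2 * r + 3" "q ^ 2 = p * r - 2 * p - w ^ 2"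
  defines "a1 \<equiv> 2 * r - w * q" and "b1 \<equiv> 2 * w * p - 2 * q" and "c1 \<equiv> - (2 * p + w ^ 2)"
    and "a2 \<equiv> p * q + 4 * w" and "b2 \<equiv> 4 - 2 * r - 2 * p ^ 2" and "c2 \<equiv> 4 * q + p * w"
  shows "a1 * b2 - a2 * b1 \<noteq> 0 \<or> a1 * c2 - a2 * c1 \<noteq> 0 \<or> b1 * c2 - b2 * c1 \<noteq> 0"
proof (rule ccontr)
  assume "\<not> ?thesis"
  then have m12: "a1 * b2 - a2 * b1 = 0" and m13: "a1 * c2 - a2 * c1 = 0" and m23: "b1 * c2 - b2 * c1 = 0" by auto
  note defs = a1_def b1_def c1_def a2_def b2_def c2_def
  show False
  proof (cases "w = 0 \<and> p = 0")
    case True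
    \<comment> \<open>Here \<open>r\<close> is 3/2 while \<open>p\<close> is 0, so no
      \<open>u\<close> with \<open>r = u * p\<close> exists: this is the pole of \<open>u\<close>
      other than infinity, and a minor is computed directly.\<close>
    then have q: "q = 0" using rel(3) by simp
    have r: "2 * r = 3" using rel(2) True by simp
    have "a1 * b2 - a2 * b1 = 3" using True q r by (simp add: defs)
    then show False using m12 by simp
  next
    case False
    obtain u where u: "q = u * w" "r = u * p"
    proof (cases "w = 0")
      case True
      then have "p \<noteq> 0" using False by simp
      then have "q = 0" using rel(1) True by simp
      then show ?thesis using that[of "r / p"] True \<open>p \<noteq> 0\<close> by simp
    next
      case False
      then have "r = q / w * p" using rel(1) by (simp add: field_simps)
      then show ?thesis using that[of "q / w"] False by simp
    qed
    have w2: "w ^ 2 = 2 * u ^ 2 * p - 3 * u - 2 * p" using rel u by Groebner_Basis.algebra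
    have C: "p ^ 2 - 2 * u ^ 3 * p + 3 * u ^ 2 + 3 = 0" using rel u w2 by Groebner_Basis.algebra
    show False
    proof (cases "w = 0")
      case True
      then have p: "p \<noteq> 0" using False by simp
      \<comment> \<open>With \<open>w = q = 0\<close> the last minor is a product. Its vanishing and
        the curve equations determine \<open>u * p\<close> and \<open>p ^ 2\<close>, and the values
        of \<open>p ^ 2\<close> conflict as 35 = 36.\<close>
      have "p * (4 - 2 * (u * p) - 2 * p ^ 2) * 2 = 0" using m23 True u by (simp add: defs algebra_simps)
      then have "4 - 2 * (u * p) - 2 * p ^ 2 = 0" using p by (simp only: mult_eq_0_iff) simp
      then have "2 * (u * p + p ^ 2) = 2 * 2" by Groebner_Basis.algebra
      then have 1: "u * p + p ^ 2 = 2" by (rule mult_left_cancel[THEN iffD1, rotated]) simp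
      have 2: "p ^ 2 = 2 * (u * p) - 3" using rel(2) True u by (simp add: algebra_simps)
      have 3: "3 * (u * p) = 5" using 1 2 by (simp add: algebra_simps)
      have 4: "2 * u ^ 2 * p - 3 * u - 2 * p = 0" using w2 True by simp
      have "6 * p - u = 2 * u * (3 * (u * p) - 5) - 3 * (2 * u ^ 2 * p - 3 * u - 2 * p)"
        by Groebner_Basis.algebra
      then have "u = 6 * p" unfolding 3 4 by simp
      then have "3 * (6 * p ^ 2) = 5" "6 * p ^ 2 + p ^ 2 = 2" using 3 1 by (simp_all add: power2_eq_square)
      then have "(18 * p ^ 2) * 7 = 35" "(7 * p ^ 2) * 18 = 36" by simp_all
      then show False by (simp add: algebra_simps)
    next
      case w0: False
      \<comment> \<open>Modulo the curve equations this minor factors. The cases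
        \<open>u = 0\<close> and \<open>u * p = 1\<close> that remain are excluded by the last
        minor, the second one by reaching 5 = 0.\<close>
      have "a1 * c2 - a2 * c1 = 24 * u * w * (u * p - 1)"
        unfolding defs u using w2 C by Groebner_Basis.algebra
      then have "u = 0 \<or> u * p = 1" using m13 w0 by simp
      then show False
      proof
        assume u0: "u = 0"
        have "p ^ 2 = - 3" using C u0 by (simp add: eq_neg_iff_add_eq_0)
        then have "p \<noteq> 0" by auto
        have "w ^ 2 = - 2 * p" using w2 u0 by simp
        then have "b1 * c2 - b2 * c1 = 2 * p ^ 2 * w ^ 2" unfolding defs u u0 by Groebner_Basis.algebra
        then show False using m23 \<open>p \<noteq> 0\<close> w0 by simp
      next
        assume up: "u * p = 1"
        have z: "u ^ 4 + 3 * u ^ 2 + 1 = 0" using C up by Groebner_Basis.algebra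
        have "28 * u ^ 2 + 12 = 0" using m23 z up w2 unfolding defs u by Groebner_Basis.algebra
        then have z2: "7 * u ^ 2 = - 3" by Groebner_Basis.algebra
        have "5 = (0::'k)" using z z2 by Groebner_Basis.algebra
        then show False by simp
      qed
    qed
  qed
qed

lemma double_covering_type_5_6_7_8:
  "double_covering_type TYPE('k::{alg_closed_field, field_char_0}) (generated_semigroup {5, 6, 7, 8})"
proof -
  let ?T = "fls_X_inv :: 'k fls" and ?X = "fls_X :: 'k fls"
  have flip_numeral: "flip (numeral n :: 'k fls) = numeral n" for n using flip_const[of "numeral n :: 'k"] by simp
  have "fls_subdegree (1 - 3 * ?X ^ 8 - 3 * ?X ^ 12) \<ge> 0" by (rule fls_subdegree_ge0I) simp
  moreover have "flip (1 - 3 * ?X ^ 8 - 3 * ?X ^ 12) = 1 - 3 * ?X ^ 8 - 3 * ?X ^ 12"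
    by (simp add: flip_diff flip_power flip_mult flip_numeral)
  \<comment> \<open>The equation for \<open>p\<close> is quadratic with discriminant 4 times
    \<open>u ^ 6 - 3 * u ^ 2 - 3\<close>. For \<open>u = ?T ^ 2\<close> this last polynomial is
    \<open>?T ^ 12\<close> times the series under the root, and
    \<open>p = u ^ 3 * (1 + c)\<close>.\<close>
  ultimately obtain c where c: "c ^ Suc 1 = 1 - 3 * ?X ^ 8 - 3 * ?X ^ 12" "fls_subdegree c = 0" "c $$ 0 = 1" "flip c = c"
    using even_root_exists[of "1 - 3 * ?X ^ 8 - 3 * ?X ^ 12" 1] by auto
  \<comment> \<open>The prescribed value of \<open>w ^ 2\<close> is \<open>4 * ?T ^ 10 * v\<close>.
    The factor 1/4 normalises the constant term of \<open>v\<close> to 1 and returns as the 2 in the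
    definition of \<open>w\<close>.\<close>
  define v where "v = fls_const (1 / 4) * (2 * ((1 + c) * (1 - ?X ^ 4)) - 3 * ?X ^ 8)"
  have nn: "fls_subdegree (1 + c) \<ge> 0" "fls_subdegree (1 - ?X ^ 4) \<ge> 0"
    by (rule fls_subdegree_ge0I, use c in simp)+
  have cn: "((1 + c) * (1 - ?X ^ 4)) $$ k = 0" if "k < 0" for k
    using fls_times_nth_eq0[of k "1 + c" "1 - ?X ^ 4"] nn that by simp
  have "fls_subdegree v \<ge> 0" by (rule fls_subdegree_ge0I) (use cn in \<open>simp add: v_def\<close>)
  moreover have "((1 + c) * (1 - ?X ^ 4)) $$ 0 = 2" using fls_nth_0_mult[OF nn] c by simp
  then have "v $$ 0 = 1" by (simp add: v_def)
  moreover have "flip v = v" using c by (simp add: v_def flip_mult flip_diff flip_add flip_power flip_numeral)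
  ultimately obtain e where e: "e ^ Suc 1 = v" "e \<noteq> 0" "fls_subdegree e = 0" "flip e = e"
    using even_root_exists[of v 1] by auto
  define u where "u = ?T ^ 2"
  define p where "p = ?T ^ 6 * (1 + c)"
  define w where "w = ?T ^ 5 * (2 * e)"
  define q where "q = u * w"
  define r where "r = u * p"
  have TX: "?T ^ 4 * ?X ^ 4 = 1" using X_inv_power_mult[of 4 4] by simp
  have c2: "c ^ 2 = 1 - 3 * ?X ^ 8 - 3 * ?X ^ 12" using c(1) by (simp add: power2_eq_square)
  have e2: "4 * e ^ 2 = 2 * (1 + c) * (1 - ?X ^ 4) - 3 * ?X ^ 8"
  proof -
    have "4 * e ^ 2 = 4 * v" using e(1) by (simp add: power2_eq_square)
    also have "\<dots> = (4 * fls_const (1 / 4)) * (2 * ((1 + c) * (1 - ?X ^ 4)) - 3 * ?X ^ 8)" by (simp only: v_def mult.assoc)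
    also have "4 * fls_const (1 / 4) = (1 :: 'k fls)" using fls_const_mult_const[of 4 "1 / 4 :: 'k"] by simp
    finally show ?thesis by (simp only: mult.assoc mult_1)
  qed
  have T8: "?T ^ 12 * ?X ^ 8 = u ^ 2" "?T ^ 12 * ?X ^ 12 = 1" "?T ^ 10 * ?X ^ 8 = u" "?T ^ 10 * ?X ^ 4 = ?T ^ 6"
    by (simp_all add: X_inv_power_mult u_def flip: power_mult)
  have C: "p ^ 2 - 2 * u ^ 3 * p + 3 * u ^ 2 + 3 = 0"
  proof -
    have "p ^ 2 - 2 * u ^ 3 * p = ?T ^ 12 * c ^ 2 - ?T ^ 12" unfolding p_def u_def by Groebner_Basis.algebra
    also have "\<dots> = - 3 * (?T ^ 12 * ?X ^ 8) - 3 * (?T ^ 12 * ?X ^ 12)" unfolding c2 by Groebner_Basis.algebra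
    finally show ?thesis unfolding T8 by Groebner_Basis.algebra
  qed
  have w2: "w ^ 2 = 2 * u ^ 2 * p - 3 * u - 2 * p"
  proof -
    have "w ^ 2 = ?T ^ 10 * (4 * e ^ 2)" unfolding w_def by Groebner_Basis.algebra
    also have "\<dots> = 2 * (?T ^ 10) * (1 + c) - 2 * (?T ^ 10 * ?X ^ 4) * (1 + c) - 3 * (?T ^ 10 * ?X ^ 8)"
      unfolding e2 by Groebner_Basis.algebra
    also have "\<dots> = 2 * u ^ 2 * p - 3 * u - 2 * p" unfolding T8 p_def u_def by Groebner_Basis.algebra
    finally show ?thesis .
  qed
  have "w * q = u * w ^ 2" "q ^ 2 = u ^ 2 * w ^ 2" by (simp_all add: q_def power2_eq_square mult_ac)
  moreover have "u * (2 * u ^ 2 * p - 3 * u - 2 * p) = p ^ 2 - 2 * r + 3 - (p ^ 2 - 2 * u ^ 3 * p + 3 * u ^ 2 + 3)"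
    unfolding r_def by Groebner_Basis.algebra
  moreover have "u ^ 2 * (2 * u ^ 2 * p - 3 * u - 2 * p) =
      p * r - 2 * p - (2 * u ^ 2 * p - 3 * u - 2 * p) - u * (p ^ 2 - 2 * u ^ 3 * p + 3 * u ^ 2 + 3)"
    unfolding r_def by Groebner_Basis.algebra
  ultimately have rel: "w * r = p * q" "w * q = p ^ 2 - 2 * r + 3" "q ^ 2 = p * r - 2 * p - w ^ 2"
    by (simp_all only: C w2 mult_zero_right diff_zero) (simp add: q_def r_def mult_ac)
  have u0: "u \<noteq> 0" by (simp add: u_def)
  \<comment> \<open>These are \<open>w2\<close> multiplied by \<open>w\<close> and by
    \<open>p\<close>; the factor 2 is removed later by \<open>half\<close>.\<close>
  have qr: "2 * (q * r) = w ^ 3 + 2 * (w * p) + 3 * q" and rr: "2 * (r * r) = 3 * r + 2 * (p * p) + w ^ 2 * p"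
    unfolding q_def r_def using w2 by Groebner_Basis.algebra+
  have c1: "fls_subdegree (1 + c) = 0" "1 + c \<noteq> 0"
  proof -
    have "(1 + c) $$ 0 = 2" using c by simp
    then have "fls_subdegree (1 + c) \<le> 0" by (intro fls_subdegree_leI) simp
    then show "fls_subdegree (1 + c) = 0" using nn by simp
    show "1 + c \<noteq> 0"
    proof
      assume "1 + c = 0"
      with \<open>(1 + c) $$ 0 = 2\<close> show False by (simp only: fls_zero_nth zero_neq_numeral)
    qed
  qed
  have nz: "w \<noteq> 0" "p \<noteq> 0" "q \<noteq> 0" "r \<noteq> 0"
    using c1 e u0 by (simp_all add: w_def p_def q_def r_def)
  have sd: "fls_subdegree w = - 5" "fls_subdegree p = - 6" "fls_subdegree q = - 7" "fls_subdegree r = - 8"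
    using c1 e u0 nz by (simp_all add: w_def p_def q_def r_def u_def fls_subdegree_pow)
  have less_5: "j < 5 \<longleftrightarrow> j = 0 \<or> j = 1 \<or> j = 2 \<or> j = 3 \<or> j = 4" for j :: nat by auto
  \<comment> \<open>The Apery set of the semigroup with respect to 5: since 9 is a gap, the class of
    4 starts at 14 = 6 + 8, realised by \<open>p * r\<close>.\<close>
  let ?b = "[1, p, q, r, p * r]" and ?d = "[0, 6, 7, 8, 14] :: nat list"
  interpret M: free_module w 5 "\<lambda>j. ?b ! j" "\<lambda>j. ?d ! j"
    by unfold_locales (use sd nz in \<open>auto simp: less_5\<close>)
  note wA = M.span_x
  have bA: "p \<in> M.span" "q \<in> M.span" "r \<in> M.span" "p * r \<in> M.span"
    using M.span_b[of 1] M.span_b[of 2] M.span_b[of 3] M.span_b[of 4] by simp_all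
  have half: "a \<in> M.span" if "2 * a \<in> M.span" for a
  proof -
    have "fls_const (1 / 2) * (2 * a) \<in> M.span" using that by (rule M.span_const_mult)
    moreover have "fls_const (1 / 2) * (2 * a) = a"
      using fls_const_mult_const[of "1 / 2 :: 'k" 2] by (simp add: mult.assoc[symmetric])
    ultimately show ?thesis by simp
  qed
  have pp: "p * p = w * q + 2 * r - 3" and pq: "p * q = w * r" and qq: "q * q = p * r - 2 * p - w ^ 2"
    using rel by Groebner_Basis.algebra+
  have num: "numeral n \<in> M.span" for n using M.span_const[of "numeral n"] by simp
  have ppA: "p * p \<in> M.span" and pqA: "p * q \<in> M.span" and qqA: "q * q \<in> M.span"
    unfolding pp pq qq using bA by (auto intro!: M.span_intros num)
  have qrA: "q * r \<in> M.span"
    by (rule half, unfold qr) (use bA in \<open>auto intro!: M.span_intros\<close>)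
  have rrA: "r * r \<in> M.span"
    by (rule half, unfold rr) (use bA ppA in \<open>auto intro!: M.span_intros\<close>)
  have mult_p: "a * p \<in> M.span" if "a \<in> M.span" for a
  proof (rule M.span_mult_closed[OF _ that])
    fix j :: nat assume "j < 5"
    moreover have "p * r * p = w * (q * r) + 2 * (r * r) - 3 * r" using pp by Groebner_Basis.algebra
    moreover have "w * (q * r) + 2 * (r * r) - 3 * r \<in> M.span" using bA qrA rrA by (auto intro!: M.span_intros)
    ultimately show "?b ! j * p \<in> M.span" using bA ppA pqA by (auto simp: less_5 mult.commute)
  qed
  have mult_q: "a * q \<in> M.span" if "a \<in> M.span" for a
  proof (rule M.span_mult_closed[OF _ that])
    fix j :: nat assume j: "j < 5"
    have prq: "p * r * q = w * (r * r)"
    proof -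
      have "p * r * q = (p * q) * r" by (simp only: mult_ac)
      then show ?thesis by (simp only: pq mult.assoc)
    qed
    have "p * r * q \<in> M.span" unfolding prq using rrA by (intro M.span_intros)
    with j show "?b ! j * q \<in> M.span" using bA pqA qqA qrA by (auto simp: less_5 mult.commute[of r q])
  qed
  have mult_r: "a * r \<in> M.span" if "a \<in> M.span" for a
  proof (rule M.span_mult_closed[OF _ that])
    fix j :: nat assume "j < 5"
    moreover have "p * r * r \<in> M.span" using mult_p[OF rrA] by (simp add: mult.assoc mult.commute mult.left_commute)
    ultimately show "?b ! j * r \<in> M.span" using bA qrA rrA by (auto simp: less_5)
  qed
  have prod: "?b ! i * ?b ! j \<in> M.span" if "i < 5" "j < 5" for i j
    using that(2) M.span_b[OF that(1)] mult_p[OF M.span_b[OF that(1)]] mult_q[OF M.span_b[OF that(1)]]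
      mult_r[OF M.span_b[OF that(1)]] mult_r[OF mult_p[OF M.span_b[OF that(1)]]]
    by (auto simp: less_5 mult.assoc)
  interpret P: pole_algebra M.span 1 by (rule M.span_pole_algebra[OF prod])
  have smooth: "\<exists>t. local_generator M.span s t" if s: "is_point M.span s" for s
  proof -
    note ps = P.point_simps[OF s] P.point_const[OF s] P.point_1[OF s]
    define w0 p0 q0 r0 where "w0 = s w" and "p0 = s p" and "q0 = s q" and "r0 = s r"
    define w' p' q' r' where "w' = fls_const w0" and "p' = fls_const p0" and "q' = fls_const q0" and "r' = fls_const r0"
    note d0 = w0_def p0_def q0_def r0_def and d1 = w'_def p'_def q'_def r'_def
    have sv: "s w = w0" "s p = p0" "s q = q0" "s r = r0" "s w' = w0" "s p' = p0" "s q' = q0" "s r' = r0"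
      and cA: "w' \<in> M.span" "p' \<in> M.span" "q' \<in> M.span" "r' \<in> M.span"
      using ps by (simp_all add: d0 d1 M.span_const)
    note mem = wA bA(1,2,3) cA
    have snum: "s (numeral n) = numeral n" for n using P.point_const[OF s, of "numeral n"] by simp
    have rel0: "w0 * r0 = p0 * q0" "w0 * q0 = p0 ^ 2 - 2 * r0 + 3" "q0 ^ 2 = p0 * r0 - 2 * p0 - w0 ^ 2"
      using arg_cong[OF rel(1), of s] arg_cong[OF rel(2), of s] arg_cong[OF rel(3), of s] mem num
      by (simp_all add: ps P.closed sv snum)
    have two: "(2 :: 'k fls) = fls_const 2" "(3 :: 'k fls) = fls_const 3" by simp_all
    have relc: "w' * r' = p' * q'" "w' * q' = p' ^ 2 - 2 * r' + 3" "q' ^ 2 = p' * r' - 2 * p' - w' ^ 2"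
      unfolding d1 two using rel0 by (simp_all only: fls_const_homs[symmetric])
    define W Y Q R where "W = w - w'" and "Y = p - p'" and "Q = q - q'" and "R = r - r'"
    note dW = W_def Y_def Q_def R_def
    have WA: "W \<in> M.span" "Y \<in> M.span" "Q \<in> M.span" "R \<in> M.span"
      using mem by (auto simp: dW intro!: P.closed)
    have W0: "s W = 0" "s Y = 0" "s Q = 0" using mem by (simp_all add: dW ps P.closed sv)
    \<comment> \<open>Subtracting the quadrics at \<open>s\<close> gives relations linear in
      \<open>W\<close>, \<open>Y\<close>, \<open>Q\<close>, \<open>R\<close>, of which two are
      doubled and \<open>R\<close> is eliminated by \<open>ER\<close>. At \<open>s\<close> the
      coefficients specialise to the Jacobian entries of \<open>quadrics_jacobian\<close>.\<close>
    define a1 b1 c1 a2 b2 c2 where "a1 = 2 * r' - w * q'" and "b1 = w * (p + p') - 2 * q'" and "c1 = - (2 * p + w ^ 2)"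
      and "a2 = p * q' + 2 * (w + w')" and "b2 = 4 - 2 * r' - p * (p + p')" and "c2 = 2 * (q + q') + p * w"
    note dc = a1_def b1_def c1_def a2_def b2_def c2_def
    have E1: "a1 * W + b1 * Y + c1 * Q = 0" unfolding dc dW using rel relc by Groebner_Basis.algebra
    have E2: "a2 * W + b2 * Y + c2 * Q = 0" unfolding dc dW using rel relc by Groebner_Basis.algebra
    have ER: "R * 2 = (p + p') * Y - w * Q - q' * W" unfolding dW using rel relc by Groebner_Basis.algebra
    have coeffs: "a1 \<in> M.span" "b1 \<in> M.span" "c1 \<in> M.span" "a2 \<in> M.span" "b2 \<in> M.span" "c2 \<in> M.span"
      unfolding dc using mem num by (auto intro!: P.closed)
    have vals: "s a1 = 2 * r0 - w0 * q0" "s b1 = 2 * w0 * p0 - 2 * q0" "s c1 = - (2 * p0 + w0 ^ 2)"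
      "s a2 = p0 * q0 + 4 * w0" "s b2 = 4 - 2 * r0 - 2 * p0 ^ 2" "s c2 = 4 * q0 + p0 * w0"
      unfolding dc using mem num by (simp_all add: ps P.closed sv snum algebra_simps power2_eq_square)
    have gens: "local_generator M.span s t"
      if t: "t \<in> M.span" "s t = 0" "W \<in> local_multiples M.span s t" "Y \<in> local_multiples M.span s t"
        "Q \<in> local_multiples M.span s t" for t
    proof (rule M.span_subset_centred[OF prod s t(1,2)])
      show "w - fls_const (s w) \<in> local_multiples M.span s t" using t(3) by (simp add: dW d0 d1)
      have "R * 2 \<in> local_multiples M.span s t"
        unfolding ER using t mem by (intro P.multiples_diff[OF s t(1)] P.multiples_mult[OF s t(1)] P.add_in) auto
      then have R: "R \<in> local_multiples M.span s t"
        using WA num snum by (intro P.multiples_cancel[OF s t(1), of R 2]) auto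
      have pc: "p \<in> P.centred s t" using t(4) bA by (intro P.centredI[OF s t(1)]) (simp_all add: dW d0 d1)
      have qc: "q \<in> P.centred s t" using t(5) bA by (intro P.centredI[OF s t(1)]) (simp_all add: dW d0 d1)
      have rc: "r \<in> P.centred s t" using R bA by (intro P.centredI[OF s t(1)]) (simp_all add: dW d0 d1)
      have one: "1 \<in> P.centred s t" using P.centred_const[OF s t(1), of 1] by simp
      show "?b ! j \<in> P.centred s t" if "j < 5" for j
        using that one pc qc rc P.centred_mult[OF s t(1) pc rc] by (auto simp: less_5)
    qed
    \<comment> \<open>Whichever minor is a unit at \<open>s\<close>, the difference left out of it
      is the local generator, and Cramer's rule handles the other two.\<close>
    have minors: "s (a1 * b2 - a2 * b1) \<noteq> 0 \<or> s (a1 * c2 - a2 * c1) \<noteq> 0 \<or> s (b1 * c2 - b2 * c1) \<noteq> 0"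
      using quadrics_jacobian[OF rel0] coeffs by (simp add: ps P.closed vals)
    then consider "s (a1 * b2 - a2 * b1) \<noteq> 0" | "s (a1 * c2 - a2 * c1) \<noteq> 0" | "s (b1 * c2 - b2 * c1) \<noteq> 0" by blast
    then show ?thesis
    proof cases
      case 1
      note cr = P.multiples_cramer[OF s WA(3) WA(1,2) coeffs E1 E2 1]
      show ?thesis using gens[OF WA(3) W0(3)] cr P.multiples_self[OF s WA(3)] by blast
    next
      case 2
      have "a1 * W + c1 * Q + b1 * Y = 0" "a2 * W + c2 * Q + b2 * Y = 0" using E1 E2 by (simp_all add: algebra_simps)
      note cr = P.multiples_cramer[OF s WA(2) WA(1,3) coeffs(1,3,2,4,6,5) this 2]
      show ?thesis using gens[OF WA(2) W0(2)] cr P.multiples_self[OF s WA(2)] by blast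
    next
      case 3
      have "b1 * Y + c1 * Q + a1 * W = 0" "b2 * Y + c2 * Q + a2 * W = 0" using E1 E2 by (simp_all add: algebra_simps)
      note cr = P.multiples_cramer[OF s WA(1) WA(2,3) coeffs(2,3,1,5,6,4) this 3]
      show ?thesis using gens[OF WA(1) W0(1)] cr P.multiples_self[OF s WA(1)] by blast
    qed
  qed
  have gen: "6 \<in> generated_semigroup {5, 6, 7, 8::nat}" "7 \<in> generated_semigroup {5, 6, 7, 8::nat}" "8 \<in> generated_semigroup {5, 6, 7, 8::nat}"
    by (intro generated_semigroup_mem; simp)+
  have "6 + 8 \<in> generated_semigroup {5, 6, 7, 8::nat}" by (intro generated_semigroup_add gen)
  then have d: "?d ! j \<in> generated_semigroup {5, 6, 7, 8}" if "j < 5" for j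
    using that generated_semigroup_0 gen by (auto simp: less_5)
  show ?thesis
  proof (rule M.span_double_covering_type[OF prod _ _ smooth _ d])
    show "flip w = - w" using e by (simp add: w_def flip_power flip_mult flip_numeral)
    have fu: "flip u = u" by (simp add: u_def flip_power)
    have fp: "flip p = p" using c by (simp add: p_def flip_power flip_mult flip_add)
    have fw: "flip w = - w" using e by (simp add: w_def flip_power flip_mult flip_numeral)
    have "flip q = - q" "flip r = r" by (simp_all add: q_def r_def flip_mult fu fp fw)
    then show "flip (?b ! j) = ?b ! j \<or> flip (?b ! j) = - ?b ! j" if "j < 5" for j
      using that fp by (auto simp: less_5 flip_mult)
    fix n :: nat assume "n \<in> {5, 6, 7, 8}"
    then have "n = 5 * 1 + ?d ! 0 \<or> n = 5 * 0 + ?d ! 1 \<or> n = 5 * 0 + ?d ! 2 \<or> n = 5 * 0 + ?d ! 3" by auto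
    moreover have "(0::nat) < 5" "(1::nat) < 5" "(2::nat) < 5" "(3::nat) < 5" by simp_all
    ultimately show "\<exists>i. \<exists>j<5. n = 5 * i + ?d ! j" by blast
  qed auto
qed

theorem theorem1:
  fixes k :: "'k::{alg_closed_field, field_char_0} itself"
  shows "double_covering_type k (generated_semigroup {5, 6, 7, 8}) \<and>
         double_covering_type k (generated_semigroup {3, 7, 8}) \<and>
         double_covering_type k (generated_semigroup {3, 5})"
  using double_covering_type_5_6_7_8[where 'k = 'k] double_covering_type_3_7_8[where 'k = 'k]
    double_covering_type_3_5[where 'k = 'k]
  by (simp only: Defs.double_covering_type_def simp_thms)

end
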